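(* Suppose that $a(i)\le 0$ for all $i\in E$. Then the stationary distribution $\nu$ of the diffusion with Markov switching $Y$ has moments of all orders; that is, for all $s>0$, $$\int_{\mathbb{R}}|x|^s\,\nu(dx)<\infty .$$
   Context: Let $E=\{1,\dots,N\}$ with $N>1$. Let $X=(X_t)_{t\ge 0}$ be a Markov jump process with state space $E$, defined on a probability space $(\Omega,\mathcal{A},Q)$, with positive intensity function $\lambda:E\to(0,\infty)$ and jump kernel $q$ (a stochastic matrix on $E$) which is irreducible and satisfies $q(i,i)=0$ for every $i\in E$: in state $i$ the process waits an exponential time with parameter $\lambda(i)$ and then jumps to $j$ with probability $q(i,j)$. $X$ is ergodic with invariant probability measure $\mu$, and is taken stationary. Let $W=(W_t)_{t\ge 0}$ be a standard Brownian motion on a probability space $(\Theta,\mathcal{B},Q')$ with filtration $(\mathcal{F}_t)$, and work on the product space with $\mathbb{P}=Q\otimes Q'$ (so $X$ and $W$ are independent). Let $a,\sigma:E\to\mathbb{R}$. For each $\omega\in\Omega$, $Y=(Y_t)_{t\ge0}$ is the real-valued solution of the linear SDE $$dY_t=a(X_t)Y_t\,dt+\sigma(X_t)\,dW_t,\quad t\ge 0,$$ where $Y_0$ is an $\mathcal{F}_0$-measurable random variable on $(\Theta,\mathcal{B},Q')$. Standing assumption: $\alpha=\sum_{i\in E}a(i)\mu(i)<0$. Under this assumption $Y$ is ergodic: there is a probability measure $\nu$ on $\mathbb{R}$ such that the law of $Y_t$ converges weakly to $\nu$ as $t\to\infty$, independently of the initial condition $Y_0$. This $\nu$ is called the stationary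 (or limit) distribution of $Y$. *)

theory Defs
  imports "HOL-Probability.Probability"
begin

definition stochastic_matrix :: "'s set \<Rightarrow> ('s \<Rightarrow> 's \<Rightarrow> real) \<Rightarrow> bool" where
  "stochastic_matrix E q \<longleftrightarrow>
     (\<forall>i\<in>E. \<forall>j\<in>E. 0 \<le> q i j) \<and> (\<forall>i\<in>E. (\<Sum>j\<in>E. q i j) = 1)"

definition irreducible_kernel :: "'s set \<Rightarrow> ('s \<Rightarrow> 's \<Rightarrow> real) \<Rightarrow> bool" where
  "irreducible_kernel E q \<longleftrightarrow>
     (\<forall>i\<in>E. \<forall>j\<in>E. (i, j) \<in> {(k, l). k \<in> E \<and> l \<in> E \<and> 0 < q k l}\<^sup>+)"

text \<open>
  Jump chain / holding time description. \<open>Z n\<close> is the \<open>n\<close>-th state visited, \<open>S n\<close> the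
  time spent there, so that the \<open>n\<close>-th jump time is \<open>\<Sum>k<n. S k\<close>; these jump times tend
  to infinity. The last conjunct is the joint law of \<open>(Z, S)\<close>: \<open>Z\<close> is a Markov chain with
  kernel \<open>q\<close> and, given \<open>Z\<close>, the \<open>S k\<close> are independent and exponential with parameter
  \<open>lam (Z k)\<close>.
\<close>

definition markov_jump_process ::
  "'w measure \<Rightarrow> 's set \<Rightarrow> ('s \<Rightarrow> real) \<Rightarrow> ('s \<Rightarrow> 's \<Rightarrow> real) \<Rightarrow> (real \<Rightarrow> 'w \<Rightarrow> 's) \<Rightarrow> bool" where
  "markov_jump_process Q E lam q X \<longleftrightarrow>
     prob_space Q \<and>
     (\<forall>t\<ge>0. X t \<in> measurable Q (count_space E)) \<and>
     (\<exists>Z S.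
        (\<forall>n::nat. Z n \<in> measurable Q (count_space E)) \<and>
        (\<forall>n. S n \<in> borel_measurable Q) \<and>
        (\<forall>w\<in>space Q.
           (\<forall>n. 0 < S n w) \<and>
           filterlim (\<lambda>n. \<Sum>k<n. S k w) at_top sequentially \<and>
           (\<forall>n t. (\<Sum>k<n. S k w) \<le> t \<and> t < (\<Sum>k<Suc n. S k w) \<longrightarrow> X t w = Z n w)) \<and>
        (\<forall>n i t. (\<forall>k\<le>n. i k \<in> E) \<and> (\<forall>k\<le>n. 0 \<le> t k) \<longrightarrow>
           measure Q {w \<in> space Q. \<forall>k\<le>n. Z k w = i k \<and> t k < S k w} =
             measure Q {w \<in> space Q. Z 0 w = i 0}
             * (\<Prod>k<n. q (i k) (i (Suc k)))
             * (\<Prod>k\<le>n. exp (- lam (i k) * t k))))"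

text \<open>
  Finite-dimensional distributions are invariant under time shifts and the common marginal
  law is \<open>mu\<close>. For a Markov process this says that it is started from an invariant law \<open>mu\<close>.
\<close>

definition stationary_process ::
  "'w measure \<Rightarrow> 's set \<Rightarrow> (real \<Rightarrow> 'w \<Rightarrow> 's) \<Rightarrow> ('s \<Rightarrow> real) \<Rightarrow> bool" where
  "stationary_process Q E X mu \<longleftrightarrow>
     (\<forall>t\<ge>0. \<forall>i\<in>E. measure Q {w \<in> space Q. X t w = i} = mu i) \<and>
     (\<forall>h\<ge>0. \<forall>J. finite J \<and> J \<subseteq> {0..} \<longrightarrow> (\<forall>i. (\<forall>t\<in>J. i t \<in> E) \<longrightarrow>
        measure Q {w \<in> space Q. \<forall>t\<in>J. X (t + h) w = i t} =
        measure Q {w \<in> space Q. \<forall>t\<in>J. X t w = i t}))"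

definition filtration_on :: "'th measure \<Rightarrow> (real \<Rightarrow> 'th measure) \<Rightarrow> bool" where
  "filtration_on M F \<longleftrightarrow>
     (\<forall>t\<ge>0. subalgebra M (F t)) \<and> (\<forall>s t. 0 \<le> s \<and> s \<le> t \<longrightarrow> subalgebra (F t) (F s))"

definition standard_brownian_motion ::
  "'th measure \<Rightarrow> (real \<Rightarrow> 'th measure) \<Rightarrow> (real \<Rightarrow> 'th \<Rightarrow> real) \<Rightarrow> bool" where
  "standard_brownian_motion M F W \<longleftrightarrow>
     prob_space M \<and> filtration_on M F \<and>
     (\<forall>t\<ge>0. W t \<in> borel_measurable (F t)) \<and>
     (AE \<theta> in M. W 0 \<theta> = 0) \<and>
     (AE \<theta> in M. continuous_on {0..} (\<lambda>t. W t \<theta>)) \<and>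
     (\<forall>s t. 0 \<le> s \<and> s < t \<longrightarrow>
        distributed M lborel (\<lambda>\<theta>. W t \<theta> - W s \<theta>) (normal_density 0 (sqrt (t - s))) \<and>
        prob_space.indep_set M (sets (F s))
          {(\<lambda>\<theta>. W t \<theta> - W s \<theta>) -` B \<inter> space M | B. B \<in> sets borel})"

text \<open>
  \<open>I\<close> is the integral of the right-continuous step function \<open>f\<close> over \<open>[0, t]\<close> against the
  path \<open>w\<close>. For a deterministic \<open>f\<close> and a Brownian path \<open>w\<close> this is the Ito integral of
  an elementary integrand. The value does not depend on the partition \<open>s\<close>.
\<close>

definition has_step_integral ::
  "(real \<Rightarrow> real) \<Rightarrow> (real \<Rightarrow> real) \<Rightarrow> real \<Rightarrow> real \<Rightarrow> bool" where
  "has_step_integral f w t I \<longleftrightarrow>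
     (\<exists>(n::nat) s. s 0 = 0 \<and> s n = t \<and>
        (\<forall>k<n. s k \<le> s (Suc k) \<and> (\<forall>u\<in>{s k..<s (Suc k)}. f u = f (s k))) \<and>
        I = (\<Sum>k<n. f (s k) * (w (s (Suc k)) - w (s k))))"

text \<open>
  \<open>y\<close> is a strong solution of \<open>dy\<^sub>t = a (x\<^sub>t) y\<^sub>t dt + sg (x\<^sub>t) dW\<^sub>t\<close> with initial value \<open>Y0\<close>,
  along a fixed step path \<open>x\<close> of the environment; the last conjunct is the integral form of
  the equation, solved for the stochastic integral.
\<close>

definition solves_linear_sde ::
  "'th measure \<Rightarrow> (real \<Rightarrow> 'th measure) \<Rightarrow> (real \<Rightarrow> 'th \<Rightarrow> real) \<Rightarrow>
   ('s \<Rightarrow> real) \<Rightarrow> ('s \<Rightarrow> real) \<Rightarrow> (real \<Rightarrow> 's) \<Rightarrow> ('th \<Rightarrow> real) \<Rightarrow> (real \<Rightarrow> 'th \<Rightarrow> real) \<Rightarrow> bool" where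
  "solves_linear_sde M F W a sg x Y0 y \<longleftrightarrow>
     (\<forall>t\<ge>0. y t \<in> borel_measurable (F t)) \<and>
     (AE \<theta> in M. continuous_on {0..} (\<lambda>t. y t \<theta>) \<and>
        (\<forall>t\<ge>0. has_step_integral (\<lambda>s. sg (x s)) (\<lambda>s. W s \<theta>) t
           (y t \<theta> - Y0 \<theta> - integral {0..t} (\<lambda>s. a (x s) * y s \<theta>))))"

text \<open>Continuous-time counterpart of \<^const>\<open>weak_conv_m\<close>.\<close>

definition weak_conv_at_top :: "(real \<Rightarrow> real measure) \<Rightarrow> real measure \<Rightarrow> bool" where
  "weak_conv_at_top L \<nu> \<longleftrightarrow>
     (\<forall>x. isCont (cdf \<nu>) x \<longrightarrow> ((\<lambda>t. cdf (L t) x) \<longlongrightarrow> cdf \<nu> x) at_top)"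

end

theory Submission
  imports Defs
begin

text \<open>
  Write \<open>b = - a \<ge> 0\<close> and \<open>A s t\<close> for the integral of \<open>b (X r)\<close> over \<open>[s, t]\<close>. For a fixed path of
  the environment the equation is linear with a step-function drift, and variation of constants
  over the unit intervals gives, at integer times,
  \<open>\<bar>Y n\<bar> \<le> exp (- A 0 n) * \<bar>Y0\<bar> + (\<Sum>k<n. exp (- A (k + 1) n) * \<xi> k)\<close>,
  where \<open>\<xi> k\<close> collects the Brownian increments of the interval \<open>[k, k + 1]\<close>
  (\<open>solution_one_step\<close>, \<open>solution_iterated_bound\<close>). Because \<open>a \<le> 0\<close>, no factor exceeds \<open>1\<close>
  within an interval, so every moment of \<open>\<xi> k\<close> is bounded by a constant that depends neither on
  \<open>k\<close> nor on the path of the environment (\<open>noise_moment\<close>).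

  The decay comes from the environment. As \<open>\<Sum>i. a i * mu i < 0\<close> and \<open>a \<le> 0\<close>, some state has
  \<open>b > 0\<close>; by irreducibility the jump chain keeps returning to it, and therefore
  \<open>exp (- m * A 0 t)\<close> has expectation \<open>O(exp (- \<delta> * t))\<close> for each \<open>m\<close>
  (\<open>exponential_functional_decay\<close>). Here \<open>b \<ge> 0\<close> is decisive: with a positive rate \<open>a i\<close> the
  expectation would grow with \<open>t\<close> once \<open>m\<close> is large. Stationarity transports the estimate to
  \<open>exp (- m * A (k + 1) n)\<close> (\<open>stationary_exponential_functional\<close>).

  The sum over \<open>k\<close> is raised to the power \<open>m\<close> at the price of geometric weights
  (\<open>weighted_sum_power_le\<close>), chosen so that they grow more slowly than the environment decays. Its
  \<open>m\<close>-th moment is thus bounded uniformly in \<open>n\<close>. The initial value need not have any moments, so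
  its contribution is controlled only for the truncated function \<open>min (\<bar>y\<bar> ^ m) B\<close>, where it
  vanishes as \<open>n\<close> tends to infinity (\<open>annealed_truncated_moment\<close>). Truncated powers are bounded
  and continuous, so the bound passes to the weak limit, and the truncation is then removed by
  Fatou's lemma (\<open>weak_limit_moment_le\<close>).
\<close>

section \<open>Step paths and linear equations driven by step integrals\<close>

text \<open>
  The step functions that sample \<open>f\<close> at the next grid point to the right converge to \<open>f\<close> pointwise
  by right-continuity, so dominated convergence applies. The lemma is used for paths of the
  environment, where it turns a time integral into a limit of functions of finitely many
  coordinates, and for Brownian step integrals, where it reduces moments of a time integral to
  moments at fixed times.
\<close>

lemma riemann_sums_tendsto_integral:
  fixes f :: "real \<Rightarrow> real"
  assumes "0 < L" and bound: "\<And>x. x \<in> {u..u+L} \<Longrightarrow> \<bar>f x\<bar> \<le> B"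
    and right: "\<And>x. x \<in> {u..<u+L} \<Longrightarrow> (f \<longlongrightarrow> f x) (at_right x)"
  shows "f integrable_on {u..u+L}"
    and "(\<lambda>M. L / real (Suc M) * (\<Sum>j<Suc M. f (u + L * real (Suc j) / real (Suc M))))
           \<longlonglongrightarrow> integral {u..u+L} f"
proof -
  \<comment> \<open>The next grid point strictly to the right of \<open>r\<close>. The minimum only matters at \<open>r = u + L\<close>, where
    that grid point lies outside the interval.\<close>
  define p where "p M r = min (u + L) (u + L * (of_int \<lfloor>real (Suc M) * (r - u) / L\<rfloor> + 1) / real (Suc M))"
    for M r
  have p_in: "p M r \<in> {r..u+L}" "p M r \<le> r + L / real (Suc M)" if "r \<in> {u..u+L}" for M r
  proof -
    let ?x = "real (Suc M) * (r - u) / L"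
    have "r - u = L * ?x / real (Suc M)" using \<open>0 < L\<close> by (simp del: of_nat_Suc)
    moreover have "L * ?x / real (Suc M) \<le> L * (of_int \<lfloor>?x\<rfloor> + 1) / real (Suc M)"
      using \<open>0 < L\<close> by (intro divide_right_mono mult_left_mono) linarith+
    moreover have "L * (of_int \<lfloor>?x\<rfloor> + 1) / real (Suc M) \<le> L * (?x + 1) / real (Suc M)"
      using \<open>0 < L\<close> by (intro divide_right_mono mult_left_mono) linarith+
    moreover have "L * (?x + 1) / real (Suc M) = L * ?x / real (Suc M) + L / real (Suc M)"
      by (simp add: add_divide_distrib distrib_left del: of_nat_Suc)
    ultimately show "p M r \<in> {r..u+L}" "p M r \<le> r + L / real (Suc M)"
      using that unfolding p_def by auto
  qed
  have step: "((\<lambda>r. f (p M r)) has_integral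
      L / real (Suc M) * (\<Sum>j<m. f (u + L * real (Suc j) / real (Suc M)))) {u..u + L * real m / real (Suc M)}"
    if "m \<le> Suc M" for M m using that
  proof (induction m)
    case 0
    then show ?case by (simp add: has_integral_refl)
  next
    case (Suc m)
    let ?l = "u + L * real m / real (Suc M)" and ?r = "u + L * real (Suc m) / real (Suc M)"
    have lr: "?r - ?l = L / real (Suc M)"
      by (simp add: diff_divide_distrib[symmetric] algebra_simps del: of_nat_Suc) (simp add: algebra_simps)
    have on_piece: "p M r = ?r" if "r \<in> {?l..?r} - {?r}" for r
    proof -
      have a: "real m \<le> real (Suc M) * (r - u) / L"
        using that \<open>0 < L\<close> by (simp add: field_simps)
      have b: "real (Suc M) * (r - u) / L < real m + 1"
        using that \<open>0 < L\<close> by (auto simp add: field_simps)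
      have "\<lfloor>real (Suc M) * (r - u) / L\<rfloor> = int m"
        using a b by linarith
      moreover have "?r \<le> u + L"
      proof -
        have "L * real (Suc m) \<le> L * real (Suc M)" 
          using \<open>0 < L\<close> Suc.prems by (intro mult_left_mono) auto
        then show ?thesis by (simp add: field_simps)
      qed
      ultimately show ?thesis unfolding p_def by (simp add: add.commute)
    qed
    have const: "((\<lambda>r. f ?r) has_integral (?r - ?l) *\<^sub>R f ?r) {?l..?r}"
    proof -
      have "measure lborel {?l..?r} = ?r - ?l" using lr \<open>0 < L\<close> by (intro content_real) (simp add: divide_right_mono)
      then show ?thesis using has_integral_const_real[of "f ?r" ?l ?r] by (simp only:)
    qed
    have piece: "((\<lambda>r. f (p M r)) has_integral (?r - ?l) *\<^sub>R f ?r) {?l..?r}"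
    proof (rule has_integral_spike_finite[OF _ _ const])
      show "finite {?r}" by simp
      show "f (p M r) = f ?r" if "r \<in> {?l..?r} - {?r}" for r using on_piece[OF that] by (simp only:)
    qed
    have "((\<lambda>r. f (p M r)) has_integral
       (L / real (Suc M) * (\<Sum>j<m. f (u + L * real (Suc j) / real (Suc M)))) + (?r - ?l) *\<^sub>R f ?r) {u..?r}"
    proof (rule has_integral_combine[OF _ _ _ piece])
      show "u \<le> ?l" "?l \<le> ?r" using \<open>0 < L\<close> by (simp_all add: divide_right_mono)
      show "((\<lambda>r. f (p M r)) has_integral
        L / real (Suc M) * (\<Sum>j<m. f (u + L * real (Suc j) / real (Suc M)))) {u..?l}"
        using Suc by simp
    qed
    then show ?case unfolding lr by (simp add: distrib_left del: of_nat_Suc)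
  qed
  have full: "((\<lambda>r. f (p M r)) has_integral
      L / real (Suc M) * (\<Sum>j<Suc M. f (u + L * real (Suc j) / real (Suc M)))) {u..u + L}" for M
    using step[of "Suc M" M] by (simp del: of_nat_Suc)
  have lim: "(\<lambda>M. f (p M r)) \<longlonglongrightarrow> f r" if r: "r \<in> {u..u+L}" for r
  proof (cases "r = u + L")
    case True
    have "p M r = r" for M using p_in(1)[OF r, of M] True by auto
    then show ?thesis by simp
  next
    case False
    then have "r \<in> {u..<u+L}" using r by auto
    note R = right[OF this]
    have lp: "(\<lambda>M. p M r) \<longlonglongrightarrow> r"
    proof (rule tendsto_sandwich[where f="\<lambda>_. r" and h="\<lambda>M. r + L / real (Suc M)"])
      have "(\<lambda>M. L / real (Suc M)) \<longlonglongrightarrow> 0"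
        using LIMSEQ_Suc[OF lim_const_over_n[of L]] by simp
      then show "(\<lambda>M. r + L / real (Suc M)) \<longlonglongrightarrow> r" using tendsto_add[OF tendsto_const[of r]] by fastforce
    qed (use p_in[OF r] in auto)
    have "((\<lambda>x. f x) \<longlongrightarrow> f r) (at r within {r..})"
      using R by (simp add: at_within_Ici_at_right)
    then have "continuous (at r within {r..}) f"
      by (simp add: continuous_within)
    then show ?thesis
      using lp p_in(1)[OF r] unfolding continuous_within_sequentially by (auto simp: o_def)
  qed
  have B: "norm (f (p M r)) \<le> B" if "r \<in> {u..u+L}" for M r
    using bound[of "p M r"] p_in(1)[OF that, of M] that by auto
  have *: "f integrable_on {u..u+L} \<and> (\<lambda>M. integral {u..u+L} (\<lambda>r. f (p M r))) \<longlonglongrightarrow> integral {u..u+L} f"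
    using dominated_convergence[of "\<lambda>M r. f (p M r)" "{u..u+L}" "\<lambda>_. B" f] full lim B
    by (auto simp: has_integral_iff)
  show "f integrable_on {u..u+L}" using * by simp
  have "integral {u..u+L} (\<lambda>r. f (p M r)) = L / real (Suc M) * (\<Sum>j<Suc M. f (u + L * real (Suc j) / real (Suc M)))" for M
    using full by blast
  then show "(\<lambda>M. L / real (Suc M) * (\<Sum>j<Suc M. f (u + L * real (Suc j) / real (Suc M))))
           \<longlonglongrightarrow> integral {u..u+L} f" using * by simp
qed

lemma indefinite_integral_has_real_derivative:
  fixes g :: "real \<Rightarrow> real"
  assumes "g integrable_on {s..t}" "r \<in> {s<..<t}" "isCont g r"
  shows "((\<lambda>x. integral {s..x} g) has_real_derivative g r) (at r)"
proof -
  have "((\<lambda>x. integral {s..x} g) has_vector_derivative g r) (at r within {s..t} - {})"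
  proof (rule integral_has_vector_derivative_continuous_at)
    show "continuous (at r within {s..t} - {}) g" using assms(3) by (rule continuous_at_imp_continuous_at_within)
  qed (use assms(1,2) in auto)
  moreover have "at r within {s..t} = at r"
    using assms(2) by (intro at_within_interior) auto
  ultimately show ?thesis by (simp add: has_real_derivative_iff_has_vector_derivative)
qed

text \<open>
  Neighbouring levels may coincide. Hence every function of the state of a jump process is again of
  this form, with the same jump times.
\<close>

locale step_function =
  fixes T :: "nat \<Rightarrow> real" and v :: "nat \<Rightarrow> real" and f :: "real \<Rightarrow> real"
  assumes T_0: "T 0 = 0" and T_less_Suc: "\<And>n. T n < T (Suc n)"
    and T_at_top: "filterlim T at_top sequentially"
    and f_eq: "\<And>n t. T n \<le> t \<Longrightarrow> t < T (Suc n) \<Longrightarrow> f t = v n"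
begin

lemma T_strict_mono: "strict_mono T"
  by (simp add: strict_mono_Suc_iff T_less_Suc)

lemma T_nonneg: "0 \<le> T n"
  using T_strict_mono T_0 by (metis strict_mono_less_eq zero_le)

lemma ex_T_ge: "\<exists>n. t \<le> T n"
  using T_at_top unfolding filterlim_at_top by (meson eventually_sequentially order_refl)

lemma ex_piece:
  assumes "0 \<le> t" obtains n where "T n \<le> t" "t < T (Suc n)"
proof -
  obtain m where "t + 1 \<le> T m" using ex_T_ge by blast
  then have ex: "t < T m" by simp
  define k where "k = (LEAST m. t < T m)"
  have k: "t < T k" unfolding k_def using ex by (rule LeastI)
  then have "k \<noteq> 0" using assms T_0 by (intro notI) simp
  then obtain n where n: "k = Suc n" using not0_implies_Suc by blast
  then have "\<not> t < T n" using not_less_Least[of n "\<lambda>m. t < T m"] k_def by auto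
  then show ?thesis using that[of n] k n by auto
qed

lemma right_continuous:
  assumes "0 \<le> t" shows "(f \<longlongrightarrow> f t) (at_right t)"
proof -
  obtain n where n: "T n \<le> t" "t < T (Suc n)" using ex_piece[OF assms] .
  have "eventually (\<lambda>s. s \<in> {t<..<T (Suc n)}) (at_right t)"
    using n by (intro eventually_at_right_real)
  then have "eventually (\<lambda>s. f s = f t) (at_right t)"
    by (rule eventually_mono) (use n f_eq in auto)
  then show ?thesis by (rule tendsto_eventually)
qed

lemma isCont_off_jumps:
  assumes "0 \<le> t" "t \<notin> range T" shows "isCont f t"
proof -
  obtain n where n: "T n \<le> t" "t < T (Suc n)" using ex_piece[OF assms(1)] .
  then have "T n < t" using assms(2) by (metis less_eq_real_def rangeI)
  then have "eventually (\<lambda>s. s \<in> {T n<..<T (Suc n)}) (nhds t)"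
    using n by (intro eventually_nhds_in_open) auto
  then have "eventually (\<lambda>s. f s = v n) (nhds t)"
    by (rule eventually_mono) (use f_eq in auto)
  then have "isCont f t = isCont (\<lambda>_. v n) t" by (rule isCont_cong)
  then show ?thesis by simp
qed

lemma finite_jumps: "finite {s \<in> range T. s \<le> t}"
proof -
  obtain n where n: "t < T n" using ex_T_ge[of "t + 1"] by (metis less_add_one order_less_le_trans)
  have "{s \<in> range T. s \<le> t} \<subseteq> T ` {..n}"
  proof clarsimp
    fix k assume "T k \<le> t"
    then have "T k < T n" using n by simp
    then have "k < n" using T_strict_mono by (simp add: strict_mono_less)
    then show "T k \<in> T ` {..n}" by auto
  qed
  then show ?thesis by (rule finite_subset) auto
qed

lemma bounded_value:
  assumes "\<And>n. \<bar>v n\<bar> \<le> B" "0 \<le> t" shows "\<bar>f t\<bar> \<le> B"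
  using ex_piece[OF assms(2)] f_eq assms(1) by metis

lemma integrable:
  assumes "\<And>n. \<bar>v n\<bar> \<le> B" "0 \<le> s" "s \<le> t"
  shows "f integrable_on {s..t}"
proof (cases "s = t")
  case False
  have "f integrable_on {s..s + (t - s)}"
    using assms False bounded_value right_continuous
    by (intro riemann_sums_tendsto_integral(1)[where B=B]) auto
  then show ?thesis by simp
qed (use integrable_on_refl[of f s] in simp)

lemma integral_upto_jump:
  assumes "\<And>n. \<bar>v n\<bar> \<le> B"
  shows "integral {0..T n} f = (\<Sum>k<n. v k * (T (Suc k) - T k))"
proof (induction n)
  case (Suc n)
  have "(f has_integral v n * (T (Suc n) - T n)) {T n..T (Suc n)}"
  proof (rule has_integral_spike_finite[where S="{T (Suc n)}" and f="\<lambda>_. v n"])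
    have "measure lborel {T n..T (Suc n)} = T (Suc n) - T n"
      using T_less_Suc[of n] by (intro content_real) auto
    then show "((\<lambda>_. v n) has_integral v n * (T (Suc n) - T n)) {T n..T (Suc n)}"
      using has_integral_const_real[of "v n" "T n" "T (Suc n)"] by (simp add: mult.commute)
  qed (auto intro!: f_eq)
  then have "integral {T n..T (Suc n)} f = v n * (T (Suc n) - T n)" by (rule integral_unique)
  moreover have "integral {0..T n} f + integral {T n..T (Suc n)} f = integral {0..T (Suc n)} f"
    using T_nonneg[of n] T_less_Suc[of n] integrable[OF assms]
    by (intro Henstock_Kurzweil_Integration.integral_combine) auto
  ultimately show ?case using Suc by simp
qed (simp add: T_0)

text \<open>
  The integral over \<open>[0, t]\<close> of the step function against \<open>w\<close>, with the jump times as partition.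
  Unlike the partition in \<^const>\<open>has_step_integral\<close>, this one is the same for all \<open>w\<close>, which makes
  the integral of a Brownian path a finite linear combination of increments with fixed coefficients.
  The number \<open>M\<close> of pieces is a horizon: it has no influence as long as \<open>t \<le> T M\<close>.
\<close>

definition step_integral :: "nat \<Rightarrow> (real \<Rightarrow> real) \<Rightarrow> real \<Rightarrow> real" where
  "step_integral M w t = (\<Sum>n<M. v n * (w (min t (T (Suc n))) - w (min t (T n))))"

lemma step_integral_diff:
  assumes "s \<le> t"
  shows "step_integral M w t - step_integral M w s =
    (\<Sum>n<M. v n * (w (max s (min t (T (Suc n)))) - w (max s (min t (T n)))))"
proof -
  have *: "w (min t r) - w (min s r) = w (max s (min t r)) - w s" for r
    using assms by (auto simp: min_def max_def)
  have "step_integral M w t - step_integral M w s =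
     (\<Sum>n<M. v n * ((w (min t (T (Suc n))) - w (min s (T (Suc n)))) - (w (min t (T n)) - w (min s (T n)))))"
    unfolding step_integral_def sum_subtractf[symmetric] by (simp add: algebra_simps)
  then show ?thesis unfolding * by simp
qed

text \<open>
  Cut every piece \<open>[T n, T (Suc n)]\<close> down to \<open>[s, t]\<close>. A piece either disappears or has level \<open>f s\<close>, and
  the remaining sum telescopes.
\<close>

lemma step_integral_const_piece:
  assumes "0 \<le> s" "s \<le> t" "t \<le> T M" and const: "\<And>r. r \<in> {s..<t} \<Longrightarrow> f r = f s"
  shows "step_integral M w t - step_integral M w s = f s * (w t - w s)"
proof -
  let ?c = "\<lambda>n. max s (min t (T n))"
  have "v n * (w (?c (Suc n)) - w (?c n)) = f s * (w (?c (Suc n)) - w (?c n))" for n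
  proof (cases "T (Suc n) \<le> s \<or> t \<le> T n")
    case True
    then have "?c (Suc n) = ?c n" using T_less_Suc[of n] assms(2) by auto
    then show ?thesis by simp
  next
    case False
    then have "max s (T n) \<in> {s..<t} \<or> s = t" using T_less_Suc[of n] assms by auto
    then show ?thesis
    proof
      assume *: "max s (T n) \<in> {s..<t}"
      have "f (max s (T n)) = v n" using False T_less_Suc[of n] by (intro f_eq) auto
      then show ?thesis using const[OF *] by simp
    next
      assume "s = t"
      then show ?thesis by simp
    qed
  qed
  then have "step_integral M w t - step_integral M w s = (\<Sum>n<M. f s * (w (?c (Suc n)) - w (?c n)))"
    unfolding step_integral_diff[OF assms(2)] by (intro sum.cong refl)
  also have "\<dots> = f s * (w (?c M) - w (?c 0))"
    using sum_lessThan_telescope[of "\<lambda>n. w (?c n)" M] by (simp only: sum_distrib_left[symmetric])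
  also have "?c M = t" using assms(1-3) by simp
  also have "?c 0 = s" using assms(1,2) T_0 by simp
  finally show ?thesis .
qed

text \<open>
  On each cell of an admissible partition the function is constant, so the summand is the increment
  of \<^const>\<open>step_integral\<close> over the cell.
\<close>

lemma has_step_integral_unique:
  assumes "has_step_integral f w t I" "0 \<le> t" "t \<le> T M"
  shows "I = step_integral M w t"
proof -
  obtain n s where s: "s 0 = 0" "s n = t" and
    step_le: "\<And>k. k < n \<Longrightarrow> s k \<le> s (Suc k)"
    and const: "\<And>k u. k < n \<Longrightarrow> u \<in> {s k..<s (Suc k)} \<Longrightarrow> f u = f (s k)"
    and I: "I = (\<Sum>k<n. f (s k) * (w (s (Suc k)) - w (s k)))"
    using assms(1) unfolding has_step_integral_def by (elim exE conjE) blast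
  have up: "s j \<le> s k" if "j \<le> k" "k \<le> n" for j k
    using that
  proof (induction k rule: dec_induct)
    case (step i)
    then have "s j \<le> s i" "s i \<le> s (Suc i)" using step_le[of i] by auto
    then show ?case by (rule order_trans)
  qed simp
  have "step_integral M w (s (Suc k)) - step_integral M w (s k) = f (s k) * (w (s (Suc k)) - w (s k))"
    if "k < n" for k
  proof (rule step_integral_const_piece)
    show "0 \<le> s k" using up[of 0 k] s(1) that by simp
    show "s (Suc k) \<le> T M" using up[of "Suc k" n] s(2) assms(3) that by simp
    show "s k \<le> s (Suc k)" using step_le that .
    show "f r = f (s k)" if "r \<in> {s k..<s (Suc k)}" for r using const \<open>k < n\<close> that .
  qed
  then have "I = (\<Sum>k<n. step_integral M w (s (Suc k)) - step_integral M w (s k))"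
    unfolding I by simp
  also have "\<dots> = step_integral M w t - step_integral M w 0"
    using sum_lessThan_telescope[of "\<lambda>k. step_integral M w (s k)" n] s by simp
  also have "step_integral M w 0 = 0"
    unfolding step_integral_def using T_nonneg by (simp add: min_def)
  finally show ?thesis by simp
qed

lemma continuous_step_integral:
  assumes "continuous_on {0..} w" shows "continuous_on {0..} (step_integral M w)"
proof -
  have "continuous_on {0..} (\<lambda>t. w (min t (T n)))" for n
  proof (rule continuous_on_compose2[OF assms])
    show "continuous_on {0..} (\<lambda>t. min t (T n))" by (intro continuous_on_min continuous_on_id continuous_on_const)
    show "(\<lambda>t. min t (T n)) ` {0..} \<subseteq> {0..}" using T_nonneg[of n] by auto
  qed
  then show ?thesis unfolding step_integral_def
    by (intro continuous_on_sum continuous_on_mult continuous_on_diff continuous_on_const)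
qed

text \<open>
  Variation of constants by integration by parts, so that the driving path \<open>G\<close> need only be
  continuous. With \<open>P\<close> the primitive of \<open>f\<close> from \<open>s\<close>, the function \<open>z r = y r - (G r - G s)\<close> satisfies
  \<open>z' = f * y\<close> off the jump times, and \<open>exp (- P) * z\<close> has the derivative
  \<open>exp (- P) * f * (G - G s)\<close>. Since \<open>f \<le> 0\<close>, the factor \<open>exp (P t - P r)\<close> that multiplies the noise
  is at most \<open>1\<close>.
\<close>

lemma linear_ode_bound:
  assumes v: "\<And>n. v n \<le> 0" "\<And>n. - \<beta> \<le> v n"
    and y: "continuous_on {0..t} y" and G: "continuous_on {0..t} G"
    and eq: "\<And>r. 0 \<le> r \<Longrightarrow> r \<le> t \<Longrightarrow> y r = c + integral {0..r} (\<lambda>x. f x * y x) + G r"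
    and st: "0 \<le> s" "s \<le> t"
  shows "\<bar>y t\<bar> \<le> exp (integral {s..t} f) * \<bar>y s\<bar> + (\<bar>G t - G s\<bar> + \<beta> * integral {s..t} (\<lambda>r. \<bar>G r - G s\<bar>))"
proof -
  have vb: "\<bar>v n\<bar> \<le> \<beta>" for n using v[of n] by auto
  have f_int: "f integrable_on {x..x'}" if "0 \<le> x" for x x'
    using integrable[OF vb that] by (cases "x \<le> x'") auto
  have f_sign: "f r \<le> 0" "- \<beta> \<le> f r" if "0 \<le> r" for r
    using ex_piece[OF that] f_eq v by metis+
  have fy_int: "(\<lambda>x. f x * y x) integrable_on {0..t}"
  proof (cases "t = 0")
    case False
    have "bounded (y ` {0..t})" using y by (intro compact_imp_bounded compact_continuous_image) auto
    then obtain Y where "\<forall>x\<in>y ` {0..t}. norm x \<le> Y" unfolding bounded_iff by blast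
    then have Y: "\<bar>y r\<bar> \<le> Y" if "r \<in> {0..t}" for r using that by simp
    have "(\<lambda>x. f x * y x) integrable_on {0..0 + t}"
    proof (rule riemann_sums_tendsto_integral(1)[where B="\<beta> * Y"])
      show "0 < t" using False st by simp
      fix x assume "x \<in> {0..0+t}"
      then show "\<bar>f x * y x\<bar> \<le> \<beta> * Y"
        using bounded_value[OF vb, of x] Y[of x] unfolding abs_mult by (intro mult_mono) auto
    next
      fix x assume x: "x \<in> {0..<0+t}"
      have "(y \<longlongrightarrow> y x) (at_right x)"
      proof -
        have "(y \<longlongrightarrow> y x) (at x within {0..t})" using y x by (simp add: continuous_on_def)
        then have "(y \<longlongrightarrow> y x) (at x within {x..t})" by (rule tendsto_within_subset) (use x in auto)
        then show ?thesis using x by (simp add: at_within_Icc_at_right)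
      qed
      then show "((\<lambda>x. f x * y x) \<longlongrightarrow> f x * y x) (at_right x)"
        using right_continuous[of x] x by (intro tendsto_mult) auto
    qed
    then show ?thesis by simp
  qed (use integrable_on_refl[of _ "0::real"] in simp)
  have fy_int': "(\<lambda>x. f x * y x) integrable_on {x..x'}" if "0 \<le> x" "x' \<le> t" for x x'
    using integrable_on_subinterval[OF fy_int] that by simp
  define P where "P r = integral {s..r} f" for r
  define z where "z r = y r - (G r - G s)" for r
  have z_eq: "z r = y s + integral {s..r} (\<lambda>x. f x * y x)" if "r \<in> {s..t}" for r
  proof -
    have "integral {0..s} (\<lambda>x. f x * y x) + integral {s..r} (\<lambda>x. f x * y x) = integral {0..r} (\<lambda>x. f x * y x)"
      using that st by (intro Henstock_Kurzweil_Integration.integral_combine fy_int') auto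
    then show ?thesis unfolding z_def using eq[of r] eq[of s] that st by simp
  qed
  have P_deriv: "(P has_real_derivative f r) (at r)" if "r \<in> {s<..<t} - range T" for r
    unfolding P_def using that st
    by (intro indefinite_integral_has_real_derivative[where t=t] f_int isCont_off_jumps) auto
  have z_deriv: "(z has_real_derivative f r * y r) (at r)" if r: "r \<in> {s<..<t} - range T" for r
  proof -
    have "isCont y r"
      using continuous_on_interior[OF y, of r] that st by auto
    then have "((\<lambda>r. integral {s..r} (\<lambda>x. f x * y x)) has_real_derivative f r * y r) (at r)"
      using r st by (intro indefinite_integral_has_real_derivative[where t=t] fy_int' isCont_mult isCont_off_jumps) auto
    then have "((\<lambda>r. y s + integral {s..r} (\<lambda>x. f x * y x)) has_real_derivative f r * y r) (at r)"
      using DERIV_add[OF DERIV_const] by fastforce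
    then show ?thesis
      by (rule has_field_derivative_transform_within_open[where S="{s<..<t}"]) (use r z_eq in auto)
  qed
  have P_cont: "continuous_on {s..t} P" unfolding P_def
    using f_int st by (intro indefinite_integral_continuous_1) auto
  have z_cont: "continuous_on {s..t} z" unfolding z_def
    using st by (intro continuous_intros continuous_on_subset[OF y] continuous_on_subset[OF G]) auto
  define e where "e r = exp (- P r) * z r" for r
  have e_int: "((\<lambda>r. exp (- P r) * f r * (G r - G s)) has_integral (e t - e s)) {s..t}"
  proof (rule fundamental_theorem_of_calculus_interior_strong[where S="{r \<in> range T. r \<le> t}"])
    show "finite {r \<in> range T. r \<le> t}" by (rule finite_jumps)
    show "s \<le> t" by fact
    show "continuous_on {s..t} e" unfolding e_def by (intro continuous_intros P_cont z_cont)
    fix r assume "r \<in> {s<..<t} - {r \<in> range T. r \<le> t}"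
    then have r: "r \<in> {s<..<t} - range T" by auto
    have "(e has_real_derivative exp (- P r) * (- f r) * z r + exp (- P r) * (f r * y r)) (at r)"
      unfolding e_def by (auto intro!: derivative_eq_intros P_deriv[OF r] z_deriv[OF r])
    moreover have "exp (- P r) * (- f r) * z r + exp (- P r) * (f r * y r) = exp (- P r) * f r * (G r - G s)"
      unfolding z_def by (simp add: algebra_simps)
    ultimately show "(e has_vector_derivative exp (- P r) * f r * (G r - G s)) (at r)"
      by (simp add: has_real_derivative_iff_has_vector_derivative)
  qed
  have P_mono: "P t \<le> P r" if "r \<in> {s..t}" for r
  proof -
    have "integral {s..r} f + integral {r..t} f = integral {s..t} f"
      using that f_int st by (intro Henstock_Kurzweil_Integration.integral_combine) auto
    moreover have "integral {r..t} f \<le> integral {r..t} (\<lambda>_. 0)"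
      using that f_int st f_sign by (intro integral_le) auto
    ultimately show ?thesis unfolding P_def by simp
  qed
  have absG: "(\<lambda>r. \<bar>G r - G s\<bar>) integrable_on {s..t}"
    using st by (intro integrable_continuous_real continuous_intros continuous_on_subset[OF G]) auto
  have "norm (integral {s..t} (\<lambda>r. exp (- P r) * f r * (G r - G s)))
      \<le> integral {s..t} (\<lambda>r. exp (- P t) * \<beta> * \<bar>G r - G s\<bar>)"
  proof (rule integral_norm_bound_integral)
    show "(\<lambda>r. exp (- P r) * f r * (G r - G s)) integrable_on {s..t}" using e_int by blast
    show "(\<lambda>r. exp (- P t) * \<beta> * \<bar>G r - G s\<bar>) integrable_on {s..t}"
      using absG by (rule integrable_on_mult_right)
    fix r assume r: "r \<in> {s..t}"
    have "\<bar>f r\<bar> \<le> \<beta>" using f_sign[of r] r st by auto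
    moreover have "0 \<le> \<beta>" using vb[of 0] by linarith
    ultimately show "norm (exp (- P r) * f r * (G r - G s)) \<le> exp (- P t) * \<beta> * \<bar>G r - G s\<bar>"
      using P_mono[OF r] by (auto simp: abs_mult intro!: mult_mono)
  qed
  then have "\<bar>e t - e s\<bar> \<le> exp (- P t) * (\<beta> * integral {s..t} (\<lambda>r. \<bar>G r - G s\<bar>))"
    using e_int by (simp add: integral_unique mult.assoc)
  moreover have "\<bar>e t\<bar> \<le> \<bar>e s\<bar> + \<bar>e t - e s\<bar>" by linarith
  moreover have "e s = y s" unfolding e_def P_def z_def by simp
  ultimately have "\<bar>e t\<bar> \<le> \<bar>y s\<bar> + exp (- P t) * (\<beta> * integral {s..t} (\<lambda>r. \<bar>G r - G s\<bar>))" by simp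
  then have "exp (P t) * \<bar>e t\<bar> \<le> exp (P t) * (\<bar>y s\<bar> + exp (- P t) * (\<beta> * integral {s..t} (\<lambda>r. \<bar>G r - G s\<bar>)))"
    by (intro mult_left_mono) auto
  also have "\<dots> = exp (P t) * \<bar>y s\<bar> + \<beta> * integral {s..t} (\<lambda>r. \<bar>G r - G s\<bar>)"
    by (simp add: algebra_simps exp_minus)
  also have "exp (P t) * \<bar>e t\<bar> = \<bar>z t\<bar>"
    unfolding e_def by (simp add: abs_mult exp_minus)
  finally have "\<bar>z t\<bar> \<le> exp (P t) * \<bar>y s\<bar> + \<beta> * integral {s..t} (\<lambda>r. \<bar>G r - G s\<bar>)" .
  moreover have "\<bar>y t\<bar> \<le> \<bar>z t\<bar> + \<bar>G t - G s\<bar>" unfolding z_def by linarith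
  ultimately show ?thesis unfolding P_def by linarith
qed

end

section \<open>Finite matrices with mass loss\<close>

text \<open>
  A path of the chain that runs through the states \<open>i 0, \<dots>, i (n - 1)\<close> contributes to the \<open>n\<close>-th
  power of this operator with its probability times \<open>\<gamma> (i 0) * \<dots> * \<gamma> (i (n - 1))\<close>.
\<close>

definition subkernel :: "'s set \<Rightarrow> ('s \<Rightarrow> 's \<Rightarrow> real) \<Rightarrow> ('s \<Rightarrow> real) \<Rightarrow> ('s \<Rightarrow> real) \<Rightarrow> 's \<Rightarrow> real" where
  "subkernel E q \<gamma> h i = \<gamma> i * (\<Sum>j\<in>E. q i j * h j)"

lemma subkernel_power_mono:
  assumes "\<And>i j. i \<in> E \<Longrightarrow> j \<in> E \<Longrightarrow> 0 \<le> q i j" "\<And>i. i \<in> E \<Longrightarrow> 0 \<le> \<gamma> i"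
    and "\<And>i. i \<in> E \<Longrightarrow> h i \<le> h' i" and "i \<in> E"
  shows "(subkernel E q \<gamma> ^^ n) h i \<le> (subkernel E q \<gamma> ^^ n) h' i"
  using assms(4)
proof (induction n arbitrary: i)
  case (Suc n)
  then show ?case using assms(1,2)
    by (auto simp: subkernel_def intro!: mult_left_mono sum_mono)
qed (use assms(3) in auto)

lemma subkernel_power_cmult:
  "(subkernel E q \<gamma> ^^ n) (\<lambda>i. c * h i) = (\<lambda>i. c * (subkernel E q \<gamma> ^^ n) h i)"
  by (induction n) (auto simp: subkernel_def sum_distrib_left mult_ac)

text \<open>
  Mass is lost in \<open>i0\<close>, and \<open>i0\<close> can be reached from every state. Since the state space is finite,
  there is a common number \<open>M\<close> of steps after which every starting state retains at most a
  fraction \<open>\<rho> < 1\<close> of its mass; iterate.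
\<close>

lemma subkernel_power_decay:
  assumes E: "finite E" and q: "stochastic_matrix E q" and irr: "irreducible_kernel E q"
    and \<gamma>: "\<And>i. i \<in> E \<Longrightarrow> 0 \<le> \<gamma> i" "\<And>i. i \<in> E \<Longrightarrow> \<gamma> i \<le> 1" and i0: "i0 \<in> E" "\<gamma> i0 < 1"
  obtains C r where "0 < r" "r < 1" "\<And>n i. i \<in> E \<Longrightarrow> (subkernel E q \<gamma> ^^ n) (\<lambda>_. 1) i \<le> C * r ^ n"
proof -
  let ?K = "subkernel E q \<gamma>"
  define u where "u n = (?K ^^ n) (\<lambda>_. 1)" for n
  have q0: "0 \<le> q i j" if "i \<in> E" "j \<in> E" for i j using q that by (auto simp: stochastic_matrix_def)
  have q1: "(\<Sum>j\<in>E. q i j) = 1" if "i \<in> E" for i using q that by (auto simp: stochastic_matrix_def)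
  note mono = subkernel_power_mono[of E q \<gamma>, OF q0 \<gamma>(1)]
  have u_Suc: "u (Suc n) i = \<gamma> i * (\<Sum>j\<in>E. q i j * u n j)" for n i by (simp add: u_def subkernel_def)
  have u_nonneg: "0 \<le> u n i" if "i \<in> E" for n i
    using that by (induction n arbitrary: i) (auto simp: u_Suc u_def[of 0] q0 \<gamma> intro!: mult_nonneg_nonneg sum_nonneg)
  have u_1: "u 1 i \<le> 1" if "i \<in> E" for i using that \<gamma> q1 by (simp add: u_def subkernel_def)
  have u_add: "u (m + n) = (?K ^^ n) (u m)" for m n
    by (simp add: u_def funpow_add add.commute[of m n])
  have u_dec1: "u (Suc n) i \<le> u n i" if "i \<in> E" for n i
    using mono[where h="u 1" and h'="\<lambda>_. 1" and n=n, OF _ _ _ _ that] u_1 u_add[of 1 n] by (simp add: u_def)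
  have u_dec: "u n i \<le> u m i" if "m \<le> n" "i \<in> E" for m n i
    using that(1) by (induction n rule: dec_induct) (auto intro: order_trans u_dec1 that(2))
  have u_le_1: "u n i \<le> 1" if "i \<in> E" for n i
    using u_dec[of 0 n i] that by (simp add: u_def)
  have u_less_1: "u (Suc n) i < 1" if i: "i \<in> E" and j: "j \<in> E" "0 < q i j" "u n j < 1" for n i j
  proof -
    have "(\<Sum>k\<in>E. q i k * u n k) < (\<Sum>k\<in>E. q i k * 1)"
    proof (rule sum_strict_mono_ex1)
      show "\<forall>k\<in>E. q i k * u n k \<le> q i k * 1" using q0 u_le_1 i by (auto intro!: mult_left_mono simp del: mult_1_right)
      show "\<exists>k\<in>E. q i k * u n k < q i k * 1" using j by (intro bexI[of _ j]) auto
    qed fact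
    then have "(\<Sum>k\<in>E. q i k * u n k) < 1" using q1[OF i] by simp
    moreover have "0 \<le> (\<Sum>k\<in>E. q i k * u n k)" using q0 u_nonneg i by (auto intro!: sum_nonneg)
    moreover have "u (Suc n) i \<le> 1 * (\<Sum>k\<in>E. q i k * u n k)"
      unfolding u_Suc using \<gamma>(2)[OF i] calculation(2) by (rule mult_right_mono)
    ultimately show ?thesis by simp
  qed
  have ex: "\<exists>n. u n i < 1" if "i \<in> E" for i
  proof -
    have "(i, i0) \<in> {(k, l). k \<in> E \<and> l \<in> E \<and> 0 < q k l}\<^sup>+"
      using irr that i0 by (auto simp: irreducible_kernel_def)
    then show ?thesis
    proof (induction rule: converse_trancl_induct)
      case (base y)
      have "u 1 i0 < 1" using i0 q1 by (simp add: u_def subkernel_def)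
      then show ?case using base u_less_1[of y i0 1] by auto
    next
      case (step y z)
      then show ?case using u_less_1[of y z] by auto
    qed
  qed
  then obtain m where m: "\<And>i. i \<in> E \<Longrightarrow> u (m i) i < 1" by metis
  define M where "M = Suc (Max (m ` E))"
  have M: "u M i < 1" if "i \<in> E" for i
  proof -
    have "m i \<le> M" unfolding M_def using E that by (intro le_SucI Max_ge) auto
    then show ?thesis using u_dec[of "m i" M i] m[of i] that by linarith
  qed
  \<comment> \<open>The maximum with \<open>1/2\<close> keeps the ratio positive, as required for its root and inverse.\<close>
  define \<rho> where "\<rho> = max (1/2) (Max (u M ` E))"
  have "Max (u M ` E) < 1" using E i0 M by (subst Max_less_iff) auto
  then have \<rho>: "0 < \<rho>" "\<rho> < 1" unfolding \<rho>_def by auto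
  have u_M: "u M i \<le> \<rho>" if "i \<in> E" for i
    unfolding \<rho>_def using E that by (intro max.coboundedI2 Max_ge) auto
  have pow: "u (j * M) i \<le> \<rho> ^ j" if "i \<in> E" for i j
  proof (induction j)
    case 0
    then show ?case by (simp add: u_def)
  next
    case (Suc j)
    have "u (M + j * M) i \<le> (?K ^^ (j * M)) (\<lambda>_. \<rho> * 1) i"
      unfolding u_add using u_M that by (intro mono) auto
    also have "\<dots> = \<rho> * u (j * M) i" unfolding subkernel_power_cmult u_def by simp
    also have "\<dots> \<le> \<rho> * \<rho> ^ j" using Suc \<rho> by (intro mult_left_mono) auto
    finally show ?case by simp
  qed
  define r where "r = root M \<rho>"
  have M0: "0 < M" by (simp add: M_def)
  have r: "0 < r" "r < 1" "r ^ M = \<rho>" using \<rho> M0 by (auto simp: r_def)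
  have "u n i \<le> 1 / \<rho> * r ^ n" if "i \<in> E" for n i
  proof -
    have "u n i \<le> u (n div M * M) i" using that by (intro u_dec) auto
    also have "\<dots> \<le> \<rho> ^ (n div M)" using pow that by simp
    also have "\<dots> = 1 / \<rho> * r ^ (M * (n div M) + M)"
      using \<rho> r by (simp add: power_add power_mult)
    also have "\<dots> \<le> 1 / \<rho> * r ^ n"
    proof (intro mult_left_mono power_decreasing)
      have "n = M * (n div M) + n mod M" by simp
      moreover have "n mod M < M" using M0 by simp
      ultimately show "n \<le> M * (n div M) + M" by linarith
    qed (use r \<rho> in auto)
    finally show ?thesis .
  qed
  then show ?thesis using that[of r "1 / \<rho>"] r by (simp add: u_def)
qed

section \<open>Expectations over paths of a jump chain\<close>

lemma path_event_measurable:
  assumes "finite J" and X: "\<And>j. j \<in> J \<Longrightarrow> X j \<in> measurable Q (count_space E)"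
  shows "{\<omega> \<in> space Q. \<forall>j\<in>J. X j \<omega> = i j} \<in> sets Q"
proof -
  have single: "X j -` (E \<inter> {i j}) \<inter> space Q \<in> sets Q" if "j \<in> J" for j
    using X[OF that] by (rule measurable_sets) auto
  then have "(\<Inter>j\<in>J. X j -` (E \<inter> {i j}) \<inter> space Q) \<inter> space Q \<in> sets Q"
  proof (cases "J = {}")
    case False
    then show ?thesis using \<open>finite J\<close> single by (intro sets.Int[OF sets.finite_INT sets.top])
  qed simp
  also have "(\<Inter>j\<in>J. X j -` (E \<inter> {i j}) \<inter> space Q) \<inter> space Q = {\<omega> \<in> space Q. \<forall>j\<in>J. X j \<omega> = i j}"
    using measurable_space[OF X] by auto
  finally show ?thesis .
qed

text \<open>
  The events that prescribe the values of finitely many finite-valued variables partition the space.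
\<close>

lemma nn_integral_sum_over_paths:
  assumes "finite J" "finite E" and X: "\<And>j. j \<in> J \<Longrightarrow> X j \<in> measurable Q (count_space E)"
    and [measurable]: "\<Psi> \<in> borel_measurable Q"
  shows "(\<integral>\<^sup>+\<omega>. \<Psi> \<omega> \<partial>Q) =
    (\<Sum>i\<in>PiE J (\<lambda>_. E). \<integral>\<^sup>+\<omega>. \<Psi> \<omega> * indicator {\<omega> \<in> space Q. \<forall>j\<in>J. X j \<omega> = i j} \<omega> \<partial>Q)"
proof -
  let ?A = "\<lambda>i. {\<omega> \<in> space Q. \<forall>j\<in>J. X j \<omega> = i j}"
  have fin: "finite (PiE J (\<lambda>_. E))" using assms by (intro finite_PiE) auto
  have [measurable]: "?A i \<in> sets Q" for i using assms(1) X by (rule path_event_measurable)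
  have one: "(\<Sum>i\<in>PiE J (\<lambda>_. E). indicator (?A i) \<omega>) = (1::ennreal)" if \<omega>: "\<omega> \<in> space Q" for \<omega>
  proof -
    let ?i = "restrict (\<lambda>j. X j \<omega>) J"
    have in_PiE: "?i \<in> PiE J (\<lambda>_. E)" using measurable_space[OF X \<omega>] by auto
    have "(\<Sum>i\<in>PiE J (\<lambda>_. E). indicator (?A i) \<omega>) = (\<Sum>i\<in>PiE J (\<lambda>_. E). if ?i = i then 1 else (0::ennreal))"
    proof (intro sum.cong refl)
      fix i assume "i \<in> PiE J (\<lambda>_. E)"
      then have "?i = i \<longleftrightarrow> (\<forall>j\<in>J. X j \<omega> = i j)"
        using PiE_ext[OF in_PiE, of i] by auto
      then show "indicator (?A i) \<omega> = (if ?i = i then 1 else (0::ennreal))"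
        using \<omega> by (simp add: indicator_def)
    qed
    then show ?thesis using fin in_PiE by simp
  qed
  have "(\<integral>\<^sup>+\<omega>. \<Psi> \<omega> \<partial>Q) = (\<integral>\<^sup>+\<omega>. (\<Sum>i\<in>PiE J (\<lambda>_. E). \<Psi> \<omega> * indicator (?A i) \<omega>) \<partial>Q)"
    by (intro nn_integral_cong) (simp add: sum_distrib_left[symmetric] one)
  then show ?thesis by (subst (asm) nn_integral_sum) auto
qed

lemma sigma_sets_greaterThan: "sigma_sets UNIV (insert UNIV (range greaterThan)) = sets (borel :: real measure)"
proof -
  have "sets (borel :: real measure) = sigma_sets UNIV (range greaterThan)"
    unfolding borel_Ioi by (rule sets_measure_of) auto
  moreover have "sigma_sets UNIV (insert UNIV (range greaterThan)) = sigma_sets UNIV (range (greaterThan :: real \<Rightarrow> _))"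
    by (rule sigma_sets_eqI) (auto intro: sigma_sets_top)
  ultimately show ?thesis by simp
qed

locale jump_chain = prob_space Q for Q :: "'w measure" +
  fixes E :: "'s set" and lam :: "'s \<Rightarrow> real" and q :: "'s \<Rightarrow> 's \<Rightarrow> real"
    and Z :: "nat \<Rightarrow> 'w \<Rightarrow> 's" and S :: "nat \<Rightarrow> 'w \<Rightarrow> real"
  assumes finite_E: "finite E"
    and lam_pos: "\<And>i. i \<in> E \<Longrightarrow> 0 < lam i"
    and q_nonneg: "\<And>i j. i \<in> E \<Longrightarrow> j \<in> E \<Longrightarrow> 0 \<le> q i j"
    and Z_measurable: "\<And>n. Z n \<in> measurable Q (count_space E)"
    and S_measurable [measurable]: "\<And>n. S n \<in> borel_measurable Q"
    and S_pos: "\<And>n \<omega>. \<omega> \<in> space Q \<Longrightarrow> 0 < S n \<omega>"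
    and law: "\<And>n i t. \<forall>k\<le>n. i k \<in> E \<Longrightarrow> \<forall>k\<le>n. 0 \<le> t k \<Longrightarrow>
       prob {\<omega> \<in> space Q. \<forall>k\<le>n. Z k \<omega> = i k \<and> t k < S k \<omega>} =
         prob {\<omega> \<in> space Q. Z 0 \<omega> = i 0} * (\<Prod>k<n. q (i k) (i (Suc k))) * (\<Prod>k\<le>n. exp (- lam (i k) * t k))"
begin

text \<open>
  Conditionally on the first \<open>n + 1\<close> states, the joint tails of the holding times factorise into
  exponential tails. The half-lines generate the Borel sets and are stable under intersection, so
  the holding times are independent exponentials under the conditional measure, and the expectation
  of a product is the product of the expectations.
\<close>

lemma path_expectation:
  assumes i: "\<And>k. k \<le> n \<Longrightarrow> i k \<in> E" and g [measurable]: "\<And>k. g k \<in> borel_measurable borel"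
  shows "(\<integral>\<^sup>+\<omega>. (\<Prod>k\<le>n. g k (S k \<omega>)) * indicator {\<omega> \<in> space Q. \<forall>k\<in>{..n}. Z k \<omega> = i k} \<omega> \<partial>Q) =
    ennreal (prob {\<omega> \<in> space Q. Z 0 \<omega> = i 0} * (\<Prod>k<n. q (i k) (i (Suc k)))) *
    (\<Prod>k\<le>n. \<integral>\<^sup>+x. ennreal (exponential_density (lam (i k)) x) * g k x \<partial>lborel)"
proof -
  define A where "A = {\<omega> \<in> space Q. \<forall>k\<in>{..n}. Z k \<omega> = i k}"
  define c where "c = prob {\<omega> \<in> space Q. Z 0 \<omega> = i 0} * (\<Prod>k<n. q (i k) (i (Suc k)))"
  have A [measurable]: "A \<in> sets Q"
    unfolding A_def by (rule path_event_measurable) (auto intro: Z_measurable)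
  have joint: "prob (A \<inter> {\<omega> \<in> space Q. \<forall>k\<le>n. t k < S k \<omega>}) = c * (\<Prod>k\<le>n. exp (- lam (i k) * t k))"
    if "\<And>k. 0 \<le> t k" for t
  proof -
    have "A \<inter> {\<omega> \<in> space Q. \<forall>k\<le>n. t k < S k \<omega>} = {\<omega> \<in> space Q. \<forall>k\<le>n. Z k \<omega> = i k \<and> t k < S k \<omega>}"
      unfolding A_def by auto
    then show ?thesis using law[of n i t] i that by (simp add: c_def)
  qed
  have "A \<inter> {\<omega> \<in> space Q. \<forall>k\<le>n. 0 < S k \<omega>} = A" using S_pos by (auto simp: A_def)
  then have prob_A: "prob A = c" using joint[of "\<lambda>_. 0"] by simp
  have em_A: "emeasure Q A = ennreal c" by (simp add: emeasure_eq_measure prob_A)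
  show ?thesis
  proof (cases "c = 0")
    case True
    then have "AE \<omega> in Q. \<omega> \<notin> A" using em_A by (intro AE_not_in) (auto simp: null_sets_def)
    then have "(\<integral>\<^sup>+\<omega>. (\<Prod>k\<le>n. g k (S k \<omega>)) * indicator A \<omega> \<partial>Q) = (\<integral>\<^sup>+\<omega>. 0 \<partial>Q)"
      by (intro nn_integral_cong_AE) (auto elim: eventually_mono)
    then show ?thesis using True unfolding A_def[symmetric] c_def[symmetric] by simp
  next
    case False
    have c: "0 < c" using False prob_A measure_nonneg[of Q A] by simp
    define U where "U = uniform_measure Q A"
    have [simp]: "space U = space Q" and sets_U [measurable_cong]: "sets U = sets Q" by (simp_all add: U_def)
    interpret U: prob_space U
      unfolding U_def using em_A c by (intro prob_space_uniform_measure) auto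
    have tails: "U.prob {\<omega> \<in> space Q. \<forall>k\<le>n. t k < S k \<omega>} = (\<Prod>k\<le>n. exp (- lam (i k) * t k))"
      if "\<And>k. 0 \<le> t k" for t
    proof -
      have "U.prob {\<omega> \<in> space Q. \<forall>k\<le>n. t k < S k \<omega>} =
          prob (A \<inter> {\<omega> \<in> space Q. \<forall>k\<le>n. t k < S k \<omega>}) / prob A"
        unfolding U_def using em_A c by (intro measure_uniform_measure) auto
      then show ?thesis using joint[OF that] prob_A c by simp
    qed
    have tail: "U.prob {\<omega> \<in> space Q. t < S k \<omega>} = exp (- lam (i k) * t)" if "k \<le> n" "0 \<le> t" for k t
    proof -
      let ?t = "\<lambda>j. if j = k then t else 0"
      have "{\<omega> \<in> space Q. t < S k \<omega>} = {\<omega> \<in> space Q. \<forall>j\<le>n. ?t j < S j \<omega>}"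
        using S_pos that by auto
      moreover have "(\<Prod>j\<le>n. exp (- lam (i j) * ?t j)) = (\<Prod>j\<le>n. if j = k then exp (- lam (i k) * t) else 1)"
        by (intro prod.cong) auto
      ultimately show ?thesis using tails[of ?t] that by simp
    qed
    have distr: "distributed U lborel (S k) (exponential_density (lam (i k)))" if "k \<le> n" for k
    proof (rule exponential_distributedI)
      show "S k \<in> borel_measurable U" by measurable
      show "0 < lam (i k)" using lam_pos i that .
      fix a :: real assume "0 \<le> a"
      have "{\<omega> \<in> space U. S k \<omega> \<le> a} = space U - {\<omega> \<in> space U. a < S k \<omega>}" by auto
      then have "U.prob {\<omega> \<in> space U. S k \<omega> \<le> a} = 1 - U.prob {\<omega> \<in> space U. a < S k \<omega>}"
        by (simp only:) (rule U.prob_compl, measurable)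
      then show "emeasure U {\<omega> \<in> space U. S k \<omega> \<le> a} = 1 - ennreal (exp (- a * lam (i k)))"
        using tail[OF that \<open>0 \<le> a\<close>] lam_pos[OF i[OF that]] \<open>0 \<le> a\<close>
        by (simp add: U.emeasure_eq_measure mult.commute ennreal_minus ennreal_1[symmetric] del: ennreal_1)
    qed
    \<comment> \<open>The whole line is in the generator as well; a holding time lies in it exactly when it exceeds \<open>0\<close>.\<close>
    let ?E = "\<lambda>_. insert UNIV (range greaterThan) :: real set set"
    have indep: "U.indep_vars (\<lambda>_. borel) S {..n}"
    proof (subst U.indep_vars_finite[where E="?E"])
      show "Int_stable (?E k)" for k :: nat
      proof (rule Int_stableI)
        fix a b :: "real set" assume ab: "a \<in> ?E k" "b \<in> ?E k"
        have "{x<..} \<inter> {y<..} = {max x y<..}" for x y :: real by auto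
        then show "a \<inter> b \<in> ?E k" using ab by auto
      qed
      show "\<forall>B\<in>Pi {..n} ?E. U.prob (\<Inter>j\<in>{..n}. S j -` B j \<inter> space U) = (\<Prod>j\<in>{..n}. U.prob (S j -` B j \<inter> space U))"
      proof
        fix B assume B: "B \<in> Pi {..n} ?E"
        have "\<exists>t\<ge>0. \<forall>\<omega>\<in>space Q. S k \<omega> \<in> B k \<longleftrightarrow> t < S k \<omega>" if "k \<le> n" for k
        proof -
          from B that have "B k = UNIV \<or> (\<exists>t. B k = {t<..})" by (auto simp: Pi_iff)
          then show ?thesis
          proof (elim disjE exE)
            assume "B k = UNIV" then show ?thesis using S_pos by (intro exI[of _ 0]) auto
          next
            fix t assume "B k = {t<..}" then show ?thesis using S_pos by (intro exI[of _ "max 0 t"]) auto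
          qed
        qed
        then obtain t where t: "\<And>k. k \<le> n \<Longrightarrow> 0 \<le> t k"
          "\<And>k \<omega>. k \<le> n \<Longrightarrow> \<omega> \<in> space Q \<Longrightarrow> S k \<omega> \<in> B k \<longleftrightarrow> t k < S k \<omega>" by metis
        define t' where "t' k = (if k \<le> n then t k else 0)" for k
        have t': "0 \<le> t' k" for k using t(1) by (simp add: t'_def)
        have "S k -` B k \<inter> space U = {\<omega> \<in> space Q. t' k < S k \<omega>}" if "k \<le> n" for k
          using t(2)[OF that] that by (auto simp: t'_def)
        then have "U.prob (S k -` B k \<inter> space U) = exp (- lam (i k) * t' k)" if "k \<le> n" for k
          using tail[OF that t'] that by simp
        moreover have "(\<Inter>j\<in>{..n}. S j -` B j \<inter> space U) = {\<omega> \<in> space Q. \<forall>k\<le>n. t' k < S k \<omega>}"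
          using t(2) by (auto simp: t'_def)
        ultimately show "U.prob (\<Inter>j\<in>{..n}. S j -` B j \<inter> space U) = (\<Prod>j\<in>{..n}. U.prob (S j -` B j \<inter> space U))"
          using tails[OF t'] by simp
      qed
    qed (auto simp: sigma_sets_greaterThan)
    have "(\<integral>\<^sup>+\<omega>. (\<Prod>k\<le>n. g k (S k \<omega>)) \<partial>U) = (\<Prod>k\<le>n. \<integral>\<^sup>+\<omega>. g k (S k \<omega>) \<partial>U)"
      by (intro U.indep_vars_nn_integral U.indep_vars_compose2[OF indep]) auto
    also have "\<dots> = (\<Prod>k\<le>n. \<integral>\<^sup>+x. ennreal (exponential_density (lam (i k)) x) * g k x \<partial>lborel)"
      by (intro prod.cong refl distributed_nn_integral[symmetric, OF distr]) auto
    finally have "(\<integral>\<^sup>+\<omega>. (\<Prod>k\<le>n. g k (S k \<omega>)) * indicator A \<omega> \<partial>Q) / ennreal c =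
        (\<Prod>k\<le>n. \<integral>\<^sup>+x. ennreal (exponential_density (lam (i k)) x) * g k x \<partial>lborel)"
      unfolding U_def using em_A by (subst (asm) nn_integral_uniform_measure) auto
    then have "ennreal c * ((\<integral>\<^sup>+\<omega>. (\<Prod>k\<le>n. g k (S k \<omega>)) * indicator A \<omega> \<partial>Q) / ennreal c) =
        ennreal c * (\<Prod>k\<le>n. \<integral>\<^sup>+x. ennreal (exponential_density (lam (i k)) x) * g k x \<partial>lborel)"
      by (simp only:)
    moreover have "ennreal c * (x / ennreal c) = x" for x
      using c by (simp add: ennreal_times_divide mult.commute[of "ennreal c"] ennreal_mult_divide_eq)
    ultimately show ?thesis
      unfolding A_def[symmetric] c_def[symmetric] by simp
  qed
qed

definition path_sum :: "('s \<Rightarrow> ennreal) \<Rightarrow> nat \<Rightarrow> ('s \<Rightarrow> ennreal) \<Rightarrow> ennreal" where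
  "path_sum G n h = (\<Sum>i\<in>PiE {..n} (\<lambda>_. E).
     ennreal (prob {\<omega> \<in> space Q. Z 0 \<omega> = i 0} * (\<Prod>k<n. q (i k) (i (Suc k)))) * (\<Prod>k<n. G (i k)) * h (i n))"

text \<open>
  Summing out the last state. This is the form in which the Markov property of the chain is used.
\<close>

lemma path_sum_Suc:
  "path_sum G (Suc n) h = path_sum G n (\<lambda>i. G i * (\<Sum>j\<in>E. ennreal (q i j) * h j))"
proof -
  let ?w = "\<lambda>n i. ennreal (prob {\<omega> \<in> space Q. Z 0 \<omega> = i 0} * (\<Prod>k<n. q (i k) (i (Suc k)))) * (\<Prod>k<n. G (i k))"
  let ?P = "PiE {..n} (\<lambda>_. E)"
  have inj: "inj_on (\<lambda>(j, i). i(Suc n := j)) (E \<times> ?P)"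
    by (rule inj_combinator) simp
  have w: "?w (Suc n) (i(Suc n := j)) = ?w n i * G (i n) * ennreal (q (i n) j)" if "i \<in> ?P" "j \<in> E" for i j
  proof -
    have E: "i k \<in> E" if "k \<le> n" for k using \<open>i \<in> ?P\<close> that by auto
    have "ennreal (prob {\<omega> \<in> space Q. Z 0 \<omega> = i 0} * (\<Prod>k<n. q (i k) (i (Suc k))) * q (i n) j)
        = ennreal (prob {\<omega> \<in> space Q. Z 0 \<omega> = i 0} * (\<Prod>k<n. q (i k) (i (Suc k)))) * ennreal (q (i n) j)"
      using E that by (intro ennreal_mult) (auto intro!: mult_nonneg_nonneg prod_nonneg q_nonneg)
    moreover have "(\<Prod>k<n. q ((i(Suc n := j)) k) ((i(Suc n := j)) (Suc k))) = (\<Prod>k<n. q (i k) (i (Suc k)))"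
      by (intro prod.cong) auto
    moreover have "(\<Prod>k<n. G ((i(Suc n := j)) k)) = (\<Prod>k<n. G (i k))"
      by (intro prod.cong) auto
    ultimately show ?thesis by (simp add: mult_ac)
  qed
  have "path_sum G (Suc n) h = (\<Sum>i\<in>(\<lambda>(j, i). i(Suc n := j)) ` (E \<times> ?P). ?w (Suc n) i * h (i (Suc n)))"
    unfolding path_sum_def atMost_Suc PiE_insert_eq by simp
  also have "\<dots> = (\<Sum>(j, i)\<in>E \<times> ?P. ?w (Suc n) (i(Suc n := j)) * h j)"
    by (subst sum.reindex[OF inj]) (auto intro!: sum.cong)
  also have "\<dots> = (\<Sum>i\<in>?P. \<Sum>j\<in>E. ?w (Suc n) (i(Suc n := j)) * h j)"
    unfolding sum.cartesian_product[symmetric] by (rule sum.swap)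
  also have "\<dots> = (\<Sum>i\<in>?P. \<Sum>j\<in>E. ?w n i * G (i n) * ennreal (q (i n) j) * h j)"
    using w by (intro sum.cong refl) (simp only:)
  also have "\<dots> = path_sum G n (\<lambda>i. G i * (\<Sum>j\<in>E. ennreal (q i j) * h j))"
    unfolding path_sum_def by (simp only: sum_distrib_left mult.assoc)
  finally show ?thesis .
qed

lemma path_sum_mono:
  assumes "\<And>i. i \<in> E \<Longrightarrow> h i \<le> h' i" shows "path_sum G n h \<le> path_sum G n h'"
  unfolding path_sum_def by (intro sum_mono mult_left_mono assms) auto

lemma measurable_at_chain:
  assumes "\<And>i. i \<in> E \<Longrightarrow> G i \<in> borel_measurable borel"
  shows "(\<lambda>\<omega>. G (Z k \<omega>) (S k \<omega>)) \<in> borel_measurable Q"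
  by (rule measurable_compose_countable'[where g="Z k" and I=E and f="\<lambda>i \<omega>. G i (S k \<omega>)"])
     (auto intro!: measurable_compose[OF S_measurable] assms Z_measurable countable_finite finite_E)

text \<open>
  The last visited state has its own factor \<open>H\<close>, because in the application the holding time in
  progress is weighted differently from the completed ones.
\<close>

lemma chain_expectation:
  fixes G H :: "'s \<Rightarrow> real \<Rightarrow> ennreal"
  assumes G: "\<And>i. i \<in> E \<Longrightarrow> G i \<in> borel_measurable borel" and H: "\<And>i. i \<in> E \<Longrightarrow> H i \<in> borel_measurable borel"
  shows "(\<integral>\<^sup>+\<omega>. (\<Prod>k<n. G (Z k \<omega>) (S k \<omega>)) * H (Z n \<omega>) (S n \<omega>) \<partial>Q) =
    path_sum (\<lambda>i. \<integral>\<^sup>+x. ennreal (exponential_density (lam i) x) * G i x \<partial>lborel) n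
      (\<lambda>i. \<integral>\<^sup>+x. ennreal (exponential_density (lam i) x) * H i x \<partial>lborel)"
proof -
  note [measurable] = measurable_at_chain[of G, OF G] measurable_at_chain[of H, OF H]
  have "(\<integral>\<^sup>+\<omega>. (\<Prod>k<n. G (Z k \<omega>) (S k \<omega>)) * H (Z n \<omega>) (S n \<omega>) \<partial>Q) =
     (\<Sum>i\<in>PiE {..n} (\<lambda>_. E). \<integral>\<^sup>+\<omega>. (\<Prod>k<n. G (Z k \<omega>) (S k \<omega>)) * H (Z n \<omega>) (S n \<omega>) *
        indicator {\<omega> \<in> space Q. \<forall>k\<in>{..n}. Z k \<omega> = i k} \<omega> \<partial>Q)"
    by (intro nn_integral_sum_over_paths finite_E Z_measurable) auto
  also have "\<dots> = path_sum (\<lambda>i. \<integral>\<^sup>+x. ennreal (exponential_density (lam i) x) * G i x \<partial>lborel) n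
      (\<lambda>i. \<integral>\<^sup>+x. ennreal (exponential_density (lam i) x) * H i x \<partial>lborel)"
    unfolding path_sum_def
  proof (intro sum.cong refl)
    fix i assume i: "i \<in> PiE {..n} (\<lambda>_. E)"
    then have iE: "i k \<in> E" if "k \<le> n" for k using that by auto
    define g where "g k = (if k < n then G (i k) else H (i n))" for k
    have "g k \<in> borel_measurable borel" for k using G H iE by (simp add: g_def)
    note path = path_expectation[of n i g, OF iE this]
    have 1: "(\<Prod>k\<le>n. g k (S k \<omega>)) = (\<Prod>k<n. G (i k) (S k \<omega>)) * H (i n) (S n \<omega>)" for \<omega>
      unfolding lessThan_Suc_atMost[symmetric] by (simp add: g_def)
    have 2: "(\<Prod>k\<le>n. \<integral>\<^sup>+x. ennreal (exponential_density (lam (i k)) x) * g k x \<partial>lborel) =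
      (\<Prod>k<n. \<integral>\<^sup>+x. ennreal (exponential_density (lam (i k)) x) * G (i k) x \<partial>lborel) *
      (\<integral>\<^sup>+x. ennreal (exponential_density (lam (i n)) x) * H (i n) x \<partial>lborel)"
      unfolding lessThan_Suc_atMost[symmetric] by (simp add: g_def)
    have "(\<integral>\<^sup>+\<omega>. (\<Prod>k<n. G (Z k \<omega>) (S k \<omega>)) * H (Z n \<omega>) (S n \<omega>) *
        indicator {\<omega> \<in> space Q. \<forall>k\<in>{..n}. Z k \<omega> = i k} \<omega> \<partial>Q) =
      (\<integral>\<^sup>+\<omega>. (\<Prod>k\<le>n. g k (S k \<omega>)) * indicator {\<omega> \<in> space Q. \<forall>k\<in>{..n}. Z k \<omega> = i k} \<omega> \<partial>Q)"
      unfolding 1 by (intro nn_integral_cong) (auto simp: indicator_def)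
    also note path
    finally show "(\<integral>\<^sup>+\<omega>. (\<Prod>k<n. G (Z k \<omega>) (S k \<omega>)) * H (Z n \<omega>) (S n \<omega>) *
        indicator {\<omega> \<in> space Q. \<forall>k\<in>{..n}. Z k \<omega> = i k} \<omega> \<partial>Q) =
      ennreal (prob {\<omega> \<in> space Q. Z 0 \<omega> = i 0} * (\<Prod>k<n. q (i k) (i (Suc k)))) *
      (\<Prod>k<n. \<integral>\<^sup>+x. ennreal (exponential_density (lam (i k)) x) * G (i k) x \<partial>lborel) *
      (\<integral>\<^sup>+x. ennreal (exponential_density (lam (i n)) x) * H (i n) x \<partial>lborel)"
      unfolding 2 by (simp only: mult.assoc)
  qed
  finally show ?thesis .
qed

end

section \<open>Exponential decay of the environment functional\<close>

text \<open>
  The step path is obtained for every function \<open>g\<close> of the state at once: the equation needs it for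
  \<open>a\<close> and for \<open>sg\<close> with common jump times.
\<close>

lemma markov_jump_process_pathsE:
  assumes "markov_jump_process Q E lam q X" "finite E" "\<And>i. i \<in> E \<Longrightarrow> 0 < lam i" "stochastic_matrix E q"
  obtains Z S where "jump_chain Q E lam q Z S"
    and "\<And>\<omega> g. \<omega> \<in> space Q \<Longrightarrow>
       step_function (\<lambda>n. \<Sum>k<n. S k \<omega>) (\<lambda>n. g (Z n \<omega>)) (\<lambda>r. g (X r \<omega>))"
proof -
  obtain Z S where Q: "prob_space Q" and Z: "\<forall>n. Z n \<in> measurable Q (count_space E)"
    and S: "\<forall>n. S n \<in> borel_measurable Q"
    and paths: "\<forall>\<omega>\<in>space Q. (\<forall>n. 0 < S n \<omega>) \<and> filterlim (\<lambda>n. \<Sum>k<n. S k \<omega>) at_top sequentially \<and>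
        (\<forall>n t. (\<Sum>k<n. S k \<omega>) \<le> t \<and> t < (\<Sum>k<Suc n. S k \<omega>) \<longrightarrow> X t \<omega> = Z n \<omega>)"
    and law: "\<forall>n i t. (\<forall>k\<le>n. i k \<in> E) \<and> (\<forall>k\<le>n. 0 \<le> t k) \<longrightarrow>
           measure Q {w \<in> space Q. \<forall>k\<le>n. Z k w = i k \<and> t k < S k w} =
             measure Q {w \<in> space Q. Z 0 w = i 0}
             * (\<Prod>k<n. q (i k) (i (Suc k))) * (\<Prod>k\<le>n. exp (- lam (i k) * t k))"
    using assms(1) unfolding markov_jump_process_def by (elim conjE exE) blast
  interpret prob_space Q by fact
  have "jump_chain Q E lam q Z S"
    using assms(2-4) Z S paths law by unfold_locales (auto simp: stochastic_matrix_def)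
  moreover have "step_function (\<lambda>n. \<Sum>k<n. S k \<omega>) (\<lambda>n. g (Z n \<omega>)) (\<lambda>r. g (X r \<omega>))"
    if "\<omega> \<in> space Q" for \<omega> g
    using paths that by unfold_locales auto
  ultimately show ?thesis by (rule that)
qed

lemma nn_integral_exponential_tilt:
  assumes "0 < l" "\<beta> < l"
  shows "(\<integral>\<^sup>+x. ennreal (exponential_density l x) * ennreal (exp (\<beta> * x)) \<partial>lborel) = ennreal (l / (l - \<beta>))"
proof -
  interpret N: prob_space "density lborel (exponential_density (l - \<beta>))"
    using assms by (intro prob_space_exponential_density) simp
  have total: "(\<integral>\<^sup>+x. ennreal (exponential_density (l - \<beta>) x) \<partial>lborel) = 1"
    using N.emeasure_space_1 by (simp add: emeasure_density)
  have "exponential_density l x * exp (\<beta> * x) = l / (l - \<beta>) * exponential_density (l - \<beta>) x" for x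
  proof -
    have "exp (- x * l) * exp (\<beta> * x) = exp (- x * (l - \<beta>))"
      by (simp add: exp_add[symmetric] algebra_simps)
    then show ?thesis using assms by (simp add: exponential_density_def mult.assoc)
  qed
  then have "(\<integral>\<^sup>+x. ennreal (exponential_density l x) * ennreal (exp (\<beta> * x)) \<partial>lborel)
    = (\<integral>\<^sup>+x. ennreal (l / (l - \<beta>)) * ennreal (exponential_density (l - \<beta>) x) \<partial>lborel)"
    using assms by (intro nn_integral_cong) (simp add: ennreal_mult[symmetric] exponential_density_nonneg)
  also have "\<dots> = ennreal (l / (l - \<beta>))" by (subst nn_integral_cmult) (auto simp: total)
  finally show ?thesis .
qed

context jump_chain begin

text \<open>
  Repeated use of the Markov property turns a sum over paths of length \<open>n\<close> into the \<open>n\<close>-th power of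
  the matrix, applied to the starting state.
\<close>

lemma path_sum_funpow_le:
  assumes "\<And>i. i \<in> E \<Longrightarrow> G i \<le> ennreal (c * \<gamma> i)" "0 \<le> c" "\<And>i. i \<in> E \<Longrightarrow> 0 \<le> \<gamma> i"
    and "\<And>i. i \<in> E \<Longrightarrow> h i \<le> ennreal (y i)" "\<And>i. i \<in> E \<Longrightarrow> 0 \<le> y i"
  shows "path_sum G n h \<le> path_sum G 0 (\<lambda>i. ennreal (c ^ n * (subkernel E q \<gamma> ^^ n) y i))"
  using assms(4,5)
proof (induction n arbitrary: h y)
  case 0
  then show ?case by (auto intro!: path_sum_mono)
next
  case (Suc n)
  let ?y = "\<lambda>i. c * subkernel E q \<gamma> y i"
  have "path_sum G (Suc n) h \<le> path_sum G 0 (\<lambda>i. ennreal (c ^ n * (subkernel E q \<gamma> ^^ n) ?y i))"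
    unfolding path_sum_Suc
  proof (rule Suc.IH)
    fix i assume i: "i \<in> E"
    have "(\<Sum>j\<in>E. ennreal (q i j) * h j) \<le> (\<Sum>j\<in>E. ennreal (q i j) * ennreal (y j))"
      by (intro sum_mono mult_left_mono Suc.prems) auto
    also have "\<dots> = (\<Sum>j\<in>E. ennreal (q i j * y j))"
      using Suc.prems(2) q_nonneg i by (intro sum.cong ennreal_mult[symmetric] refl) auto
    also have "\<dots> = ennreal (\<Sum>j\<in>E. q i j * y j)"
      using Suc.prems(2) q_nonneg i by (intro sum_ennreal) auto
    finally have "G i * (\<Sum>j\<in>E. ennreal (q i j) * h j) \<le> ennreal (c * \<gamma> i) * ennreal (\<Sum>j\<in>E. q i j * y j)"
      by (intro mult_mono assms(1) i) auto
    also have "\<dots> = ennreal (?y i)"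
      unfolding subkernel_def using assms(2,3) i q_nonneg Suc.prems(2)
      by (subst ennreal_mult[symmetric]) (auto intro!: sum_nonneg mult_nonneg_nonneg simp: mult.assoc)
    finally show "G i * (\<Sum>j\<in>E. ennreal (q i j) * h j) \<le> ennreal (?y i)" .
    show "0 \<le> ?y i"
      unfolding subkernel_def using assms(2,3) i q_nonneg Suc.prems(2)
      by (auto intro!: sum_nonneg mult_nonneg_nonneg)
  qed
  also have "(\<lambda>i. c ^ n * (subkernel E q \<gamma> ^^ n) ?y i) = (\<lambda>i. c ^ Suc n * (subkernel E q \<gamma> ^^ Suc n) y i)"
    unfolding subkernel_power_cmult by (simp add: funpow_Suc_right mult_ac del: funpow.simps)
  finally show ?case .
qed

lemma path_sum_0_le:
  assumes "\<And>i. i \<in> E \<Longrightarrow> h i \<le> B" shows "path_sum G 0 h \<le> B"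
proof -
  have G: "path_sum G 0 = path_sum G' 0" for G G' by (rule ext) (simp add: path_sum_def)
  have one: "(\<integral>\<^sup>+x. ennreal (exponential_density (lam i) x) * 1 \<partial>lborel) = 1" if "i \<in> E" for i
    using nn_integral_exponential_tilt[of "lam i" 0] lam_pos[OF that] by simp
  have "path_sum G 0 h \<le> path_sum G 0 (\<lambda>_. B)" using assms by (rule path_sum_mono)
  also have "\<dots> = path_sum G 0 (\<lambda>_. 1) * B" by (simp only: path_sum_def sum_distrib_right mult_1_right)
  also have "path_sum G 0 (\<lambda>_. 1) \<le> path_sum G 0 (\<lambda>i. \<integral>\<^sup>+x. ennreal (exponential_density (lam i) x) * 1 \<partial>lborel)"
    by (intro path_sum_mono) (simp only: one order_refl)
  also have "\<dots> = (\<integral>\<^sup>+\<omega>. (\<Prod>k<(0::nat). 1) * (1::ennreal) \<partial>Q)"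
    using chain_expectation[of "\<lambda>_ _. 1" "\<lambda>_ _. 1" 0] by (subst G) simp
  also have "\<dots> = 1" by (simp add: emeasure_space_1)
  finally show ?thesis by (simp add: mult_right_mono)
qed

end

text \<open>
  On the event that \<open>t\<close> lies between the \<open>n\<close>-th jump time \<open>T n\<close> and the next one, the functional is
  at most its value at time \<open>T n\<close>, and hence at most \<open>exp (\<delta> * (T (n + 1) - t))\<close> times that value.
  Drop the event and sum over \<open>n\<close>: apart from \<open>exp (- \<delta> * t)\<close>, what remains are expectations of
  products along the jump chain. A completed stay in \<open>i\<close> contributes
  \<open>lam i / (lam i + \<kappa> * b i - \<delta>)\<close>, the stay in progress \<open>lam i / (lam i - \<delta>)\<close>. For \<open>\<delta> = 0\<close> the
  product over \<open>n\<close> stays decays like \<open>r ^ n\<close> by the loss of mass in \<open>i0\<close>, and a small \<open>\<delta>\<close> costs at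
  most a factor \<open>c\<close> per stay with \<open>c * r < 1\<close>, so the series over \<open>n\<close> converges.
\<close>

lemma exponential_functional_decay:
  fixes b :: "'s \<Rightarrow> real"
  assumes X: "markov_jump_process Q E lam q X" and E: "finite E" and lam: "\<And>i. i \<in> E \<Longrightarrow> 0 < lam i"
    and q: "stochastic_matrix E q" and irr: "irreducible_kernel E q"
    and b: "\<And>i. i \<in> E \<Longrightarrow> 0 \<le> b i" and i0: "i0 \<in> E" "0 < b i0" and \<kappa>: "0 < \<kappa>"
  obtains C \<delta> where "0 < \<delta>" "0 \<le> C"
    "\<And>t. 0 \<le> t \<Longrightarrow> (\<integral>\<^sup>+\<omega>. ennreal (exp (- \<kappa> * integral {0..t} (\<lambda>r. b (X r \<omega>)))) \<partial>Q) \<le> ennreal (C * exp (- \<delta> * t))"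
proof -
  obtain Z S where "jump_chain Q E lam q Z S"
    and paths: "\<And>\<omega> g. \<omega> \<in> space Q \<Longrightarrow>
       step_function (\<lambda>n. \<Sum>k<n. S k \<omega>) (\<lambda>n. g (Z n \<omega>)) (\<lambda>r. g (X r \<omega>))"
    using markov_jump_process_pathsE[OF X E lam q] by blast
  then interpret jump_chain Q E lam q Z S by simp
  define \<gamma> where "\<gamma> i = lam i / (lam i + \<kappa> * b i)" for i
  have den: "lam i \<le> lam i + \<kappa> * b i" if "i \<in> E" for i using b[OF that] \<kappa> by simp
  have \<gamma>: "0 \<le> \<gamma> i" "\<gamma> i \<le> 1" if "i \<in> E" for i
    using den[OF that] lam[OF that] by (auto simp: \<gamma>_def)
  have "\<gamma> i0 < 1" using lam[OF i0(1)] mult_pos_pos[OF \<kappa> i0(2)] by (simp add: \<gamma>_def)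
  then obtain C0 r where r: "0 < r" "r < 1"
    and decay: "\<And>n i. i \<in> E \<Longrightarrow> (subkernel E q \<gamma> ^^ n) (\<lambda>_. 1) i \<le> C0 * r ^ n"
    using subkernel_power_decay[of E q \<gamma> i0, OF E q irr \<gamma> i0(1)] by metis
  have C0: "0 \<le> C0" using decay[OF i0(1), of 0] by simp
  \<comment> \<open>Any \<open>c\<close> strictly between \<open>1\<close> and \<open>1 / r\<close> would do.\<close>
  define c where "c = (1 + r) / (2 * r)"
  have c: "1 < c" "c * r < 1" using r by (auto simp: c_def field_simps)
  define m where "m = Min (lam ` E)"
  have m: "0 < m" unfolding m_def using E i0 lam by (subst Min_gr_iff) auto
  have m_le: "m \<le> lam i" if "i \<in> E" for i unfolding m_def using E that by simp
  \<comment> \<open>With this \<open>\<delta>\<close>, every rate \<open>l \<ge> m\<close> satisfies \<open>l - \<delta> \<ge> l / c\<close>.\<close>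
  define \<delta> where "\<delta> = (1 - 1 / c) * m"
  have \<delta>: "0 < \<delta>" using c m by (simp add: \<delta>_def)
  have slack: "lam i + \<kappa>' * b i > \<delta>" "lam i / (lam i + \<kappa>' * b i - \<delta>) \<le> c * (lam i / (lam i + \<kappa>' * b i))"
    if "i \<in> E" "0 \<le> \<kappa>'" for i \<kappa>'
  proof -
    let ?l = "lam i + \<kappa>' * b i"
    have l: "m \<le> ?l" using m_le[OF that(1)] b[OF that(1)] that(2) by (simp add: add_increasing2)
    have "(1 - 1 / c) * m \<le> (1 - 1 / c) * ?l" using l c by (intro mult_left_mono) auto
    also have "(1 - 1 / c) * ?l = ?l - ?l / c" by (simp only: left_diff_distrib) simp
    finally have *: "?l / c \<le> ?l - \<delta>" unfolding \<delta>_def by simp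
    moreover have "0 < ?l / c" using l m c by simp
    ultimately show "?l > \<delta>" by linarith
    have "lam i / (?l - \<delta>) \<le> lam i / (?l / c)"
      using * \<open>0 < ?l / c\<close> lam[OF that(1)] by (intro frac_le) auto
    then show "lam i / (?l - \<delta>) \<le> c * (lam i / ?l)" by (simp add: mult.commute)
  qed
  define G where "G i x = ennreal (exp ((\<delta> - \<kappa> * b i) * x))" for i x
  define H where "H i x = ennreal (exp (\<delta> * x))" for i :: 's and x
  let ?G = "\<lambda>i. \<integral>\<^sup>+x. ennreal (exponential_density (lam i) x) * G i x \<partial>lborel"
  let ?H = "\<lambda>i. \<integral>\<^sup>+x. ennreal (exponential_density (lam i) x) * H i x \<partial>lborel"
  have G: "?G i \<le> ennreal (c * \<gamma> i)" if "i \<in> E" for i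
  proof -
    have "?G i = ennreal (lam i / (lam i + \<kappa> * b i - \<delta>))"
      unfolding G_def using nn_integral_exponential_tilt[of "lam i" "\<delta> - \<kappa> * b i"] lam[OF that] slack(1)[OF that, of \<kappa>] \<kappa>
      by (simp add: algebra_simps)
    then show ?thesis using slack(2)[OF that, of \<kappa>] \<kappa> by (simp add: \<gamma>_def ennreal_leI)
  qed
  have H: "?H i \<le> ennreal c" if "i \<in> E" for i
  proof -
    have "?H i = ennreal (lam i / (lam i - \<delta>))"
      unfolding H_def using nn_integral_exponential_tilt[of "lam i" \<delta>] lam[OF that] slack(1)[OF that, of 0]
      by simp
    then show ?thesis using slack(2)[OF that, of 0] lam[OF that] by (simp add: ennreal_leI)
  qed
  have term_bound: "(\<integral>\<^sup>+\<omega>. (\<Prod>k<n. G (Z k \<omega>) (S k \<omega>)) * H (Z n \<omega>) (S n \<omega>) \<partial>Q) \<le> ennreal (c * C0 * (c * r) ^ n)" for n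
  proof -
    have "(\<integral>\<^sup>+\<omega>. (\<Prod>k<n. G (Z k \<omega>) (S k \<omega>)) * H (Z n \<omega>) (S n \<omega>) \<partial>Q) = path_sum ?G n ?H"
      by (rule chain_expectation) (auto simp: G_def H_def)
    also have "\<dots> \<le> path_sum ?G 0 (\<lambda>i. ennreal (c ^ n * (subkernel E q \<gamma> ^^ n) (\<lambda>_. c * 1) i))"
      using G H \<gamma> c by (intro path_sum_funpow_le) auto
    also have "\<dots> \<le> ennreal (c * C0 * (c * r) ^ n)"
    proof (intro path_sum_0_le ennreal_leI)
      fix i assume i: "i \<in> E"
      have "c ^ n * (subkernel E q \<gamma> ^^ n) (\<lambda>_. c * 1) i = c ^ n * (c * (subkernel E q \<gamma> ^^ n) (\<lambda>_. 1) i)"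
        unfolding subkernel_power_cmult by simp
      also have "\<dots> \<le> c ^ n * (c * (C0 * r ^ n))"
        using c decay[OF i] by (intro mult_left_mono) auto
      finally show "c ^ n * (subkernel E q \<gamma> ^^ n) (\<lambda>_. c * 1) i \<le> c * C0 * (c * r) ^ n"
        by (simp add: power_mult_distrib mult_ac)
    qed
    finally show ?thesis .
  qed
  define C where "C = c * C0 / (1 - c * r)"
  have bound: "(\<integral>\<^sup>+\<omega>. ennreal (exp (- \<kappa> * integral {0..t} (\<lambda>r. b (X r \<omega>)))) \<partial>Q) \<le> ennreal (C * exp (- \<delta> * t))" if t: "0 \<le> t" for t
  proof -
    let ?F = "\<lambda>n \<omega>. (\<Prod>k<n. G (Z k \<omega>) (S k \<omega>)) * H (Z n \<omega>) (S n \<omega>)"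
    have [measurable]: "(\<lambda>\<omega>. G (Z k \<omega>) (S k \<omega>)) \<in> borel_measurable Q"
      "(\<lambda>\<omega>. H (Z k \<omega>) (S k \<omega>)) \<in> borel_measurable Q" for k
      by (rule measurable_at_chain, simp add: G_def H_def)+
    have [measurable]: "?F n \<in> borel_measurable Q" for n
      by measurable
    have pointwise: "ennreal (exp (- \<kappa> * integral {0..t} (\<lambda>r. b (X r \<omega>)))) \<le> ennreal (exp (- \<delta> * t)) * (\<Sum>n. ?F n \<omega>)"
      if \<omega>: "\<omega> \<in> space Q" for \<omega>
    proof -
      interpret step_function "\<lambda>n. \<Sum>k<n. S k \<omega>" "\<lambda>n. b (Z n \<omega>)" "\<lambda>r. b (X r \<omega>)"
        using paths[OF \<omega>, of b] .
      have bZ: "0 \<le> b (Z n \<omega>)" "\<bar>b (Z n \<omega>)\<bar> \<le> Max (b ` E)" for n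
        using measurable_space[OF Z_measurable \<omega>, of n] b E by auto
      have bX: "0 \<le> b (X r \<omega>)" if "0 \<le> r" for r using ex_piece[OF that] f_eq bZ(1) by metis
      obtain n where n: "(\<Sum>k<n. S k \<omega>) \<le> t" "t < (\<Sum>k<Suc n. S k \<omega>)" using ex_piece[OF t] .
      have "(\<Sum>k<n. b (Z k \<omega>) * S k \<omega>) = integral {0..\<Sum>k<n. S k \<omega>} (\<lambda>r. b (X r \<omega>))"
        using integral_upto_jump[OF bZ(2), of n] by simp
      also have "\<dots> \<le> integral {0..t} (\<lambda>r. b (X r \<omega>))"
        using n t bX T_nonneg[of n]
        by (intro integral_subset_le integrable[OF bZ(2)]) auto
      finally have *: "(\<Sum>k<n. b (Z k \<omega>) * S k \<omega>) \<le> integral {0..t} (\<lambda>r. b (X r \<omega>))" .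
      have "- \<kappa> * integral {0..t} (\<lambda>r. b (X r \<omega>)) \<le> - \<kappa> * (\<Sum>k<n. b (Z k \<omega>) * S k \<omega>) + \<delta> * ((\<Sum>k<Suc n. S k \<omega>) - t)"
      proof -
        have "\<kappa> * (\<Sum>k<n. b (Z k \<omega>) * S k \<omega>) \<le> \<kappa> * integral {0..t} (\<lambda>r. b (X r \<omega>))"
          using * \<kappa> by (intro mult_left_mono) auto
        moreover have "0 \<le> \<delta> * ((\<Sum>k<Suc n. S k \<omega>) - t)" using \<delta> n by simp
        ultimately show ?thesis by simp
      qed
      also have "\<dots> = - \<delta> * t + ((\<Sum>k<n. (\<delta> - \<kappa> * b (Z k \<omega>)) * S k \<omega>) + \<delta> * S n \<omega>)"
        by (simp add: algebra_simps sum.distrib sum_subtractf sum_distrib_left sum_negf)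
      finally have "exp (- \<kappa> * integral {0..t} (\<lambda>r. b (X r \<omega>))) \<le>
          exp (- \<delta> * t) * ((\<Prod>k<n. exp ((\<delta> - \<kappa> * b (Z k \<omega>)) * S k \<omega>)) * exp (\<delta> * S n \<omega>))"
        unfolding exp_sum[OF finite_lessThan, symmetric] exp_add[symmetric] by simp
      then have "ennreal (exp (- \<kappa> * integral {0..t} (\<lambda>r. b (X r \<omega>)))) \<le> ennreal (exp (- \<delta> * t)) * ?F n \<omega>"
        unfolding G_def H_def by (simp add: ennreal_mult[symmetric] prod_ennreal prod_nonneg)
      also have "?F n \<omega> \<le> (\<Sum>n. ?F n \<omega>)"
        using sum_le_suminf[of "\<lambda>n. ?F n \<omega>" "{n}"] by simp
      finally show ?thesis by (simp add: mult_left_mono)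
    qed
    have "(\<integral>\<^sup>+\<omega>. ennreal (exp (- \<kappa> * integral {0..t} (\<lambda>r. b (X r \<omega>)))) \<partial>Q) \<le>
       (\<integral>\<^sup>+\<omega>. ennreal (exp (- \<delta> * t)) * (\<Sum>n. ?F n \<omega>) \<partial>Q)"
      using pointwise by (intro nn_integral_mono) auto
    also have "\<dots> = ennreal (exp (- \<delta> * t)) * (\<Sum>n. \<integral>\<^sup>+\<omega>. ?F n \<omega> \<partial>Q)"
      by (subst nn_integral_cmult, measurable) (subst nn_integral_suminf, auto)
    also have "\<dots> \<le> ennreal (exp (- \<delta> * t)) * (\<Sum>n. ennreal (c * C0 * (c * r) ^ n))"
      by (intro mult_left_mono suminf_le term_bound) auto
    also have "(\<Sum>n. ennreal (c * C0 * (c * r) ^ n)) = ennreal C"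
      unfolding C_def using c r C0
      by (intro suminf_ennreal_eq sums_mult geometric_sums[THEN sums_mult, of "c * r" "c * C0", simplified]) auto
    finally show ?thesis using C0 c by (simp add: ennreal_mult[symmetric] C_def mult.commute)
  qed
  show ?thesis
    by (rule that[of \<delta> C]) (use \<delta> bound C0 c in \<open>auto simp: C_def\<close>)
qed

section \<open>Stationarity of the environment functional\<close>

lemma riemann_sums_along_path:
  fixes b :: "'s \<Rightarrow> real"
  assumes path: "step_function T (\<lambda>n. b (z n)) (\<lambda>r. b (x r))" and B: "\<And>n. \<bar>b (z n)\<bar> \<le> B"
    and "0 \<le> s" "0 < L"
  shows "(\<lambda>M. L / real (Suc M) * (\<Sum>j<Suc M. b (x (s + L * real (Suc j) / real (Suc M)))))
           \<longlonglongrightarrow> integral {s..s + L} (\<lambda>r. b (x r))"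
proof -
  interpret step_function T "\<lambda>n. b (z n)" "\<lambda>r. b (x r)" by fact
  show ?thesis
    using assms(3,4) bounded_value[OF B] right_continuous
    by (intro riemann_sums_tendsto_integral(2)[where B=B]) auto
qed

text \<open>
  Both sides are finite sums, over the prescribed states at the times in \<open>J\<close>, of \<open>\<phi>\<close> times a
  finite-dimensional probability.
\<close>

lemma stationary_expectation:
  fixes \<phi> :: "(real \<Rightarrow> 's) \<Rightarrow> ennreal"
  assumes Q: "prob_space Q" and X: "\<And>t. 0 \<le> t \<Longrightarrow> X t \<in> measurable Q (count_space E)"
    and E: "finite E" and stat: "stationary_process Q E X mu"
    and h: "0 \<le> h" and J: "finite J" "J \<subseteq> {0..}"
    and meas: "\<And>h. 0 \<le> h \<Longrightarrow> (\<lambda>\<omega>. \<phi> (\<lambda>t\<in>J. X (h + t) \<omega>)) \<in> borel_measurable Q"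
  shows "(\<integral>\<^sup>+\<omega>. \<phi> (\<lambda>t\<in>J. X (h + t) \<omega>) \<partial>Q) = (\<integral>\<^sup>+\<omega>. \<phi> (\<lambda>t\<in>J. X (0 + t) \<omega>) \<partial>Q)"
proof -
  interpret prob_space Q by fact
  have expand: "(\<integral>\<^sup>+\<omega>. \<phi> (\<lambda>t\<in>J. X (h + t) \<omega>) \<partial>Q) =
      (\<Sum>i\<in>PiE J (\<lambda>_. E). \<phi> i * ennreal (prob {\<omega> \<in> space Q. \<forall>t\<in>J. X (t + h) \<omega> = i t}))" if h: "0 \<le> h" for h
  proof -
    have X': "X (h + t) \<in> measurable Q (count_space E)" if "t \<in> J" for t
      using that h J X by auto
    have "(\<integral>\<^sup>+\<omega>. \<phi> (\<lambda>t\<in>J. X (h + t) \<omega>) \<partial>Q) = (\<Sum>i\<in>PiE J (\<lambda>_. E). \<integral>\<^sup>+\<omega>. \<phi> (\<lambda>t\<in>J. X (h + t) \<omega>) *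
        indicator {\<omega> \<in> space Q. \<forall>t\<in>J. X (h + t) \<omega> = i t} \<omega> \<partial>Q)"
      using J(1) E X' meas[OF h] by (rule nn_integral_sum_over_paths)
    also have "\<dots> = (\<Sum>i\<in>PiE J (\<lambda>_. E). \<integral>\<^sup>+\<omega>. \<phi> i * indicator {\<omega> \<in> space Q. \<forall>t\<in>J. X (h + t) \<omega> = i t} \<omega> \<partial>Q)"
    proof (intro sum.cong nn_integral_cong refl)
      fix i \<omega> assume i: "i \<in> PiE J (\<lambda>_. E)"
      have "(\<lambda>t\<in>J. X (h + t) \<omega>) = i" if "\<forall>t\<in>J. X (h + t) \<omega> = i t"
        using i that by (auto simp: fun_eq_iff PiE_iff extensional_def restrict_def)
      then show "\<phi> (\<lambda>t\<in>J. X (h + t) \<omega>) * indicator {\<omega> \<in> space Q. \<forall>t\<in>J. X (h + t) \<omega> = i t} \<omega> =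
          \<phi> i * indicator {\<omega> \<in> space Q. \<forall>t\<in>J. X (h + t) \<omega> = i t} \<omega>"
        by (simp add: indicator_def)
    qed
    also have "\<dots> = (\<Sum>i\<in>PiE J (\<lambda>_. E). \<phi> i * ennreal (prob {\<omega> \<in> space Q. \<forall>t\<in>J. X (t + h) \<omega> = i t}))"
    proof (intro sum.cong refl)
      fix i
      have "{\<omega> \<in> space Q. \<forall>t\<in>J. X (h + t) \<omega> = i t} \<in> sets Q"
        using J(1) X' by (rule path_event_measurable)
      then show "(\<integral>\<^sup>+\<omega>. \<phi> i * indicator {\<omega> \<in> space Q. \<forall>t\<in>J. X (h + t) \<omega> = i t} \<omega> \<partial>Q) =
          \<phi> i * ennreal (prob {\<omega> \<in> space Q. \<forall>t\<in>J. X (t + h) \<omega> = i t})"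
        by (simp add: nn_integral_cmult_indicator emeasure_eq_measure add.commute)
    qed
    finally show ?thesis .
  qed
  have "prob {\<omega> \<in> space Q. \<forall>t\<in>J. X (t + h) \<omega> = i t} = prob {\<omega> \<in> space Q. \<forall>t\<in>J. X (t + 0) \<omega> = i t}"
    if "i \<in> PiE J (\<lambda>_. E)" for i
    using stat h J that unfolding stationary_process_def by (auto simp: PiE_iff)
  then show ?thesis unfolding expand[OF h] expand[OF order_refl] by (intro sum.cong refl) simp
qed

locale stationary_environment =
  fixes Q :: "'w measure" and E :: "'s set" and lam :: "'s \<Rightarrow> real" and q :: "'s \<Rightarrow> 's \<Rightarrow> real"
    and X :: "real \<Rightarrow> 'w \<Rightarrow> 's" and mu :: "'s \<Rightarrow> real"
  assumes jump: "markov_jump_process Q E lam q X" and stat: "stationary_process Q E X mu"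
    and fin: "finite E" and lam_gt_0: "\<And>i. i \<in> E \<Longrightarrow> 0 < lam i" and stoch: "stochastic_matrix E q"
begin

lemma prob_space_Q: "prob_space Q"
  using jump unfolding markov_jump_process_def by blast

lemma X_measurable: "0 \<le> t \<Longrightarrow> X t \<in> measurable Q (count_space E)"
  using jump unfolding markov_jump_process_def by blast

lemma path_cases:
  assumes "\<omega> \<in> space Q"
  obtains z T where "\<And>n. z n \<in> E" "\<And>g. step_function T (\<lambda>n. g (z n)) (\<lambda>r. g (X r \<omega>))"
proof -
  obtain Z S where jc: "jump_chain Q E lam q Z S"
    and paths: "\<And>\<omega> g. \<omega> \<in> space Q \<Longrightarrow>
       step_function (\<lambda>n. \<Sum>k<n. S k \<omega>) (\<lambda>n. g (Z n \<omega>)) (\<lambda>r. g (X r \<omega>))"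
    using markov_jump_process_pathsE[OF jump fin lam_gt_0 stoch] by blast
  have "Z n \<omega> \<in> E" for n
    using measurable_space[OF jump_chain.Z_measurable[OF jc] assms] by simp
  then show ?thesis using paths[OF assms] by (rule that)
qed

lemma bounded_on_states:
  fixes b :: "'s \<Rightarrow> real"
  assumes "i \<in> E" shows "\<bar>b i\<bar> \<le> (\<Sum>i\<in>E. \<bar>b i\<bar>)"
proof (rule member_le_sum[where f="\<lambda>i. \<bar>b i\<bar>"])
  show "i \<in> E" by (rule assms)
  show "finite E" by (rule fin)
qed (rule abs_ge_zero)

lemma riemann_sums:
  assumes "\<omega> \<in> space Q" "0 \<le> s" "0 < L"
  shows "(\<lambda>M. L / real (Suc M) * (\<Sum>j<Suc M. b (X (s + L * real (Suc j) / real (Suc M)) \<omega>)))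
           \<longlonglongrightarrow> integral {s..s + L} (\<lambda>r. b (X r \<omega>))"
proof -
  obtain z T where z: "\<And>n. z n \<in> E" "\<And>g. step_function T (\<lambda>n. g (z n)) (\<lambda>r. g (X r \<omega>))"
    by (rule path_cases[OF assms(1)]) (rule that)
  show ?thesis
    by (rule riemann_sums_along_path[where b=b and z=z and T=T and x="\<lambda>r. X r \<omega>", OF z(2)[of b] bounded_on_states[OF z(1)] assms(2,3)])
qed

lemma state_measurable: "0 \<le> t \<Longrightarrow> (\<lambda>\<omega>. b (X t \<omega>)) \<in> borel_measurable Q" for b :: "'s \<Rightarrow> real"
  by (rule measurable_compose[OF X_measurable borel_measurable_count_space])

text \<open>
  Measurability is known for each single \<open>X t\<close>, and a Riemann sum is a function of finitely many of
  them.
\<close>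

lemma integral_measurable [measurable]:
  fixes b :: "'s \<Rightarrow> real"
  assumes "0 \<le> s"
  shows "(\<lambda>\<omega>. integral {s..t} (\<lambda>r. b (X r \<omega>))) \<in> borel_measurable Q"
proof (cases "s < t")
  case True
  show ?thesis
  proof (rule borel_measurable_LIMSEQ_real)
    show "(\<lambda>M. (t - s) / real (Suc M) * (\<Sum>j<Suc M. b (X (s + (t - s) * real (Suc j) / real (Suc M)) \<omega>)))
        \<longlonglongrightarrow> integral {s..t} (\<lambda>r. b (X r \<omega>))" if "\<omega> \<in> space Q" for \<omega>
      using riemann_sums[OF that assms, of "t - s" b] True by simp
    show "(\<lambda>\<omega>. (t - s) / real (Suc M) * (\<Sum>j<Suc M. b (X (s + (t - s) * real (Suc j) / real (Suc M)) \<omega>)))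
        \<in> borel_measurable Q" for M
      using True assms by (intro borel_measurable_times borel_measurable_sum state_measurable borel_measurable_const) auto
  qed
next
  case False
  have "integral {s..t} g = 0" for g :: "real \<Rightarrow> real"
    using False by (cases "s = t") auto
  then show ?thesis by simp
qed

text \<open>
  Each Riemann sum of the path integral is a function of finitely many coordinates, so its law is
  invariant under the shift. Bounded convergence carries this over to the integral.
\<close>

lemma stationary_exponential_functional:
  fixes b :: "'s \<Rightarrow> real"
  assumes b: "\<And>i. i \<in> E \<Longrightarrow> 0 \<le> b i" and "0 \<le> \<kappa>" "0 \<le> h" "0 \<le> L"
  shows "(\<integral>\<^sup>+\<omega>. ennreal (exp (- \<kappa> * integral {h..h + L} (\<lambda>r. b (X r \<omega>)))) \<partial>Q) =
    (\<integral>\<^sup>+\<omega>. ennreal (exp (- \<kappa> * integral {0..L} (\<lambda>r. b (X r \<omega>)))) \<partial>Q)"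
proof (cases "L = 0")
  case True
  have "integral {h..h} g = 0" for h :: real and g :: "real \<Rightarrow> real" by simp
  then show ?thesis using True by simp
next
  case False
  then have L: "0 < L" using assms by simp
  interpret prob_space Q by (rule prob_space_Q)
  define R where "R h M \<omega> = L / real (Suc M) * (\<Sum>j<Suc M. b (X (h + L * real (Suc j) / real (Suc M)) \<omega>))" for h M \<omega>
  have R_meas [measurable]: "R h M \<in> borel_measurable Q" if "0 \<le> h" for h M
    unfolding R_def using L that
    by (intro borel_measurable_times borel_measurable_sum state_measurable borel_measurable_const) auto
  have R_nonneg: "0 \<le> R h M \<omega>" if "0 \<le> h" "\<omega> \<in> space Q" for h M \<omega>
    unfolding R_def using L that b measurable_space[OF X_measurable that(2)]
    by (intro mult_nonneg_nonneg sum_nonneg) auto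
  have lim: "(\<lambda>M. \<integral>\<^sup>+\<omega>. ennreal (exp (- \<kappa> * R h M \<omega>)) \<partial>Q) \<longlonglongrightarrow>
      (\<integral>\<^sup>+\<omega>. ennreal (exp (- \<kappa> * integral {h..h + L} (\<lambda>r. b (X r \<omega>)))) \<partial>Q)" if h: "0 \<le> h" for h
  proof (rule nn_integral_dominated_convergence[where w="\<lambda>_. 1"])
    show "(\<lambda>\<omega>. ennreal (exp (- \<kappa> * R h M \<omega>))) \<in> borel_measurable Q" for M using R_meas[OF h] by measurable
    show "(\<lambda>\<omega>. ennreal (exp (- \<kappa> * integral {h..h + L} (\<lambda>r. b (X r \<omega>))))) \<in> borel_measurable Q"
      using integral_measurable[OF h] by measurable
    show "AE \<omega> in Q. ennreal (exp (- \<kappa> * R h M \<omega>)) \<le> 1" for M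
      using R_nonneg[OF h] assms(2) by (intro AE_I2) (simp add: ennreal_le_1 del: ennreal_1)
    show "AE \<omega> in Q. (\<lambda>M. ennreal (exp (- \<kappa> * R h M \<omega>))) \<longlonglongrightarrow> ennreal (exp (- \<kappa> * integral {h..h + L} (\<lambda>r. b (X r \<omega>))))"
      using riemann_sums[OF _ h L] unfolding R_def by (intro AE_I2 tendsto_intros) auto
  qed (simp_all add: emeasure_space_1)
  have eq: "(\<integral>\<^sup>+\<omega>. ennreal (exp (- \<kappa> * R h M \<omega>)) \<partial>Q) = (\<integral>\<^sup>+\<omega>. ennreal (exp (- \<kappa> * R 0 M \<omega>)) \<partial>Q)" for M
  proof -
    define J where "J = (\<lambda>j. L * real (Suc j) / real (Suc M)) ` {..<Suc M}"
    define \<phi> where "\<phi> i = ennreal (exp (- \<kappa> * (L / real (Suc M) * (\<Sum>j<Suc M. b (i (L * real (Suc j) / real (Suc M)))))))"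
      for i :: "real \<Rightarrow> 's"
    have \<phi>: "\<phi> (\<lambda>t\<in>J. X (h + t) \<omega>) = ennreal (exp (- \<kappa> * R h M \<omega>))" for h \<omega>
    proof -
      have "(\<Sum>j<Suc M. b ((\<lambda>t\<in>J. X (h + t) \<omega>) (L * real (Suc j) / real (Suc M)))) =
          (\<Sum>j<Suc M. b (X (h + L * real (Suc j) / real (Suc M)) \<omega>))"
        by (intro sum.cong refl) (auto simp: J_def simp del: of_nat_Suc)
      then show ?thesis unfolding \<phi>_def R_def by (simp only:)
    qed
    have "(\<integral>\<^sup>+\<omega>. \<phi> (\<lambda>t\<in>J. X (h + t) \<omega>) \<partial>Q) = (\<integral>\<^sup>+\<omega>. \<phi> (\<lambda>t\<in>J. X (0 + t) \<omega>) \<partial>Q)"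
    proof (rule stationary_expectation[OF prob_space_Q X_measurable fin stat])
      show "(\<lambda>\<omega>. \<phi> (\<lambda>t\<in>J. X (h + t) \<omega>)) \<in> borel_measurable Q" if "0 \<le> h" for h
        unfolding \<phi> using R_meas[OF that] by measurable
    qed (use assms L in \<open>auto simp: J_def\<close>)
    then show ?thesis unfolding \<phi> .
  qed
  show ?thesis
    using LIMSEQ_unique[OF lim[OF \<open>0 \<le> h\<close>]] lim[of 0] unfolding eq by simp
qed

end

section \<open>Moments of Brownian step integrals\<close>

lemma (in prob_space) normal_exponential_moment:
  assumes X: "distributed M lborel X (normal_density 0 \<tau>)" and "0 < \<tau>"
  shows "(\<integral>\<^sup>+\<theta>. ennreal (exp (u * X \<theta>)) \<partial>M) = ennreal (exp (u\<^sup>2 * \<tau>\<^sup>2 / 2))"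
proof -
  have shift: "normal_density 0 \<tau> x * exp (u * x) = exp (u\<^sup>2 * \<tau>\<^sup>2 / 2) * normal_density (u * \<tau>\<^sup>2) \<tau> x" for x
  proof -
    have "- (x - 0)\<^sup>2 / (2 * \<tau>\<^sup>2) + u * x = u\<^sup>2 * \<tau>\<^sup>2 / 2 + - (x - u * \<tau>\<^sup>2)\<^sup>2 / (2 * \<tau>\<^sup>2)"
      using \<open>0 < \<tau>\<close> by (simp add: field_simps power2_eq_square)
    then have "exp (- (x - 0)\<^sup>2 / (2 * \<tau>\<^sup>2)) * exp (u * x) =
        exp (u\<^sup>2 * \<tau>\<^sup>2 / 2) * exp (- (x - u * \<tau>\<^sup>2)\<^sup>2 / (2 * \<tau>\<^sup>2))"
      unfolding exp_add[symmetric] by (rule arg_cong)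
    then show ?thesis unfolding normal_density_def by (simp add: mult.left_commute mult.assoc)
  qed
  interpret N: prob_space "density lborel (normal_density (u * \<tau>\<^sup>2) \<tau>)"
    using \<open>0 < \<tau>\<close> by (rule prob_space_normal_density)
  have total: "(\<integral>\<^sup>+x. ennreal (normal_density (u * \<tau>\<^sup>2) \<tau> x) \<partial>lborel) = 1"
    using N.emeasure_space_1 by (simp add: emeasure_density)
  have "(\<integral>\<^sup>+\<theta>. ennreal (exp (u * X \<theta>)) \<partial>M) = (\<integral>\<^sup>+x. ennreal (normal_density 0 \<tau> x) * ennreal (exp (u * x)) \<partial>lborel)"
    by (rule distributed_nn_integral[OF X, symmetric]) measurable
  also have "\<dots> = (\<integral>\<^sup>+x. ennreal (exp (u\<^sup>2 * \<tau>\<^sup>2 / 2)) * ennreal (normal_density (u * \<tau>\<^sup>2) \<tau> x) \<partial>lborel)"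
    by (intro nn_integral_cong) (simp add: ennreal_mult[symmetric] shift)
  also have "\<dots> = ennreal (exp (u\<^sup>2 * \<tau>\<^sup>2 / 2))"
    by (subst nn_integral_cmult) (auto simp: total)
  finally show ?thesis .
qed

lemma brownian_adapted:
  assumes "standard_brownian_motion M F W" "0 \<le> s" "s \<le> t"
  shows "W s \<in> borel_measurable (F t)"
proof -
  have "subalgebra (F t) (F s)" "W s \<in> borel_measurable (F s)"
    using assms unfolding standard_brownian_motion_def filtration_on_def by blast+
  then show ?thesis by (rule measurable_from_subalg)
qed

lemma filtration_measurable:
  assumes "standard_brownian_motion M F W" "0 \<le> t" "g \<in> borel_measurable (F t)"
  shows "g \<in> borel_measurable M"
proof -
  have "subalgebra M (F t)"
    using assms unfolding standard_brownian_motion_def filtration_on_def by blast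
  then show ?thesis using assms(3) by (rule measurable_from_subalg)
qed

text \<open>
  The increment over \<open>[s, t]\<close> is independent of the past up to \<open>s\<close>. Working with exponential moments
  lets the degenerate increment \<open>s = t\<close>, which has no normal density, take part without an exception.
\<close>

lemma brownian_increment_exponential:
  fixes g :: "'th \<Rightarrow> ennreal"
  assumes W: "standard_brownian_motion M F W" and st: "0 \<le> s" "s \<le> t" and g: "g \<in> borel_measurable (F s)"
  shows "(\<integral>\<^sup>+\<theta>. g \<theta> * ennreal (exp (u * (W t \<theta> - W s \<theta>))) \<partial>M) =
    (\<integral>\<^sup>+\<theta>. g \<theta> \<partial>M) * ennreal (exp (u\<^sup>2 * (t - s) / 2))"
proof (cases "s = t")
  case False
  interpret prob_space M using W by (simp add: standard_brownian_motion_def)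
  define e where "e \<theta> = ennreal (exp (u * (W t \<theta> - W s \<theta>)))" for \<theta>
  let ?D = "\<lambda>\<theta>. W t \<theta> - W s \<theta>"
  have D: "distributed M lborel ?D (normal_density 0 (sqrt (t - s)))"
    and ind: "indep_set (sets (F s)) {?D -` B \<inter> space M | B. B \<in> sets borel}"
  proof -
    have "0 \<le> s \<and> s < t" using st False by simp
    note law = mp[OF W[unfolded standard_brownian_motion_def, THEN conjunct2, THEN conjunct2, THEN conjunct2,
          THEN conjunct2, THEN conjunct2, THEN spec[of _ s], THEN spec[of _ t]] this]
    show "distributed M lborel ?D (normal_density 0 (sqrt (t - s)))"
      using law by (rule conjunct1)
    show "indep_set (sets (F s)) {?D -` B \<inter> space M | B. B \<in> sets borel}"
      using law by (rule conjunct2)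
  qed
  have D_meas: "?D \<in> borel_measurable M" using distributed_measurable[OF D] by simp
  have e_meas: "e \<in> borel_measurable M"
    unfolding e_def by (rule measurable_compose[OF D_meas]) measurable
  have space_F: "space (F s) = space M"
    using W st(1) unfolding standard_brownian_motion_def filtration_on_def subalgebra_def by blast
  have gM: "g \<in> borel_measurable M" using filtration_measurable[OF W st(1) g] .
  have "indep_vars (\<lambda>_. borel) (case_bool g e) UNIV"
    unfolding indep_vars_def2
  proof
    show "\<forall>i\<in>UNIV. random_variable borel (case_bool g e i)"
      using gM e_meas by (auto split: bool.split)
    show "indep_sets (\<lambda>i. {case_bool g e i -` A \<inter> space M | A. A \<in> sets borel}) UNIV"
    proof (rule indep_sets_mono_sets[OF ind[unfolded indep_set_def]])
      fix i :: bool
      have "{g -` A \<inter> space M | A. A \<in> sets borel} \<subseteq> sets (F s)"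
        using measurable_sets[OF g] space_F by auto
      moreover have "{e -` A \<inter> space M | A. A \<in> sets borel} \<subseteq> {?D -` B \<inter> space M | B. B \<in> sets borel}"
      proof clarify
        fix A :: "ennreal set" assume A: "A \<in> sets borel"
        have "(\<lambda>x::real. ennreal (exp (u * x))) -` A \<inter> space borel \<in> sets borel"
          by (rule measurable_sets[OF _ A]) measurable
        moreover have "e -` A \<inter> space M = ?D -` ((\<lambda>x::real. ennreal (exp (u * x))) -` A \<inter> space borel) \<inter> space M"
          by (auto simp: e_def)
        ultimately show "\<exists>B. e -` A \<inter> space M = ?D -` B \<inter> space M \<and> B \<in> sets borel" by blast
      qed
      ultimately show "{case_bool g e i -` A \<inter> space M | A. A \<in> sets borel} \<subseteq>
          case_bool (sets (F s)) {?D -` B \<inter> space M | B. B \<in> sets borel} i"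
        by (cases i) auto
    qed
  qed
  then have "(\<integral>\<^sup>+\<theta>. (\<Prod>i\<in>UNIV. case_bool g e i \<theta>) \<partial>M) = (\<Prod>i\<in>UNIV. \<integral>\<^sup>+\<theta>. case_bool g e i \<theta> \<partial>M)"
    by (intro indep_vars_nn_integral) auto
  then have "(\<integral>\<^sup>+\<theta>. g \<theta> * e \<theta> \<partial>M) = (\<integral>\<^sup>+\<theta>. g \<theta> \<partial>M) * (\<integral>\<^sup>+\<theta>. e \<theta> \<partial>M)"
    by (simp add: UNIV_bool mult.commute)
  also have "(\<integral>\<^sup>+\<theta>. e \<theta> \<partial>M) = ennreal (exp (u\<^sup>2 * (t - s) / 2))"
    unfolding e_def using normal_exponential_moment[OF D, of u] st False by simp
  finally show ?thesis unfolding e_def .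
qed simp

text \<open>
  Peel off the last increment, which is independent of the others; the variances add up to at most
  \<open>\<sigma>\<^sup>2 * (s m - s 0)\<close>, whatever the number of steps.
\<close>

lemma step_sum_exponential_moment:
  assumes W: "standard_brownian_motion M F W"
    and s: "0 \<le> s 0" "\<And>n. s n \<le> s (Suc n)" and c: "\<And>n. \<bar>c n\<bar> \<le> \<sigma>"
  shows "(\<integral>\<^sup>+\<theta>. ennreal (exp (u * (\<Sum>n<m. c n * (W (s (Suc n)) \<theta> - W (s n) \<theta>)))) \<partial>M)
    \<le> ennreal (exp (u\<^sup>2 * \<sigma>\<^sup>2 * (s m - s 0) / 2))"
proof (induction m)
  case 0
  interpret prob_space M using W by (simp add: standard_brownian_motion_def)
  show ?case by (simp add: emeasure_space_1)
next
  case (Suc m)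
  have mono: "s i \<le> s j" if "i \<le> j" for i j using s(2) that by (rule lift_Suc_mono_le)
  have pos: "0 \<le> s i" for i using mono[of 0 i] s(1) by simp
  let ?g = "\<lambda>\<theta>. ennreal (exp (u * (\<Sum>n<m. c n * (W (s (Suc n)) \<theta> - W (s n) \<theta>))))"
  have [measurable]: "(\<lambda>\<theta>. W (s i) \<theta>) \<in> borel_measurable (F (s m))" if "i \<le> m" for i
    using brownian_adapted[OF W pos mono[OF that]] .
  have g: "?g \<in> borel_measurable (F (s m))" by measurable
  have "c m ^ 2 \<le> \<sigma>\<^sup>2" using c[of m] by (simp add: abs_le_square_iff[symmetric])
  then have c2: "(u * c m)\<^sup>2 \<le> u\<^sup>2 * \<sigma>\<^sup>2" by (simp add: power_mult_distrib mult_left_mono)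
  have "(\<integral>\<^sup>+\<theta>. ennreal (exp (u * (\<Sum>n<Suc m. c n * (W (s (Suc n)) \<theta> - W (s n) \<theta>)))) \<partial>M)
     = (\<integral>\<^sup>+\<theta>. ?g \<theta> * ennreal (exp (u * c m * (W (s (Suc m)) \<theta> - W (s m) \<theta>))) \<partial>M)"
    by (simp add: ennreal_mult[symmetric] exp_add[symmetric] distrib_left mult.assoc)
  also have "\<dots> = (\<integral>\<^sup>+\<theta>. ?g \<theta> \<partial>M) * ennreal (exp ((u * c m)\<^sup>2 * (s (Suc m) - s m) / 2))"
    by (rule brownian_increment_exponential[OF W pos s(2) g])
  also have "\<dots> \<le> ennreal (exp (u\<^sup>2 * \<sigma>\<^sup>2 * (s m - s 0) / 2)) * ennreal (exp (u\<^sup>2 * \<sigma>\<^sup>2 * (s (Suc m) - s m) / 2))"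
    using c2 s(2)[of m] by (intro mult_mono Suc ennreal_leI) (auto intro!: mult_right_mono)
  also have "\<dots> = ennreal (exp (u\<^sup>2 * \<sigma>\<^sup>2 * (s (Suc m) - s 0) / 2))"
    by (simp add: ennreal_mult[symmetric] exp_add[symmetric] add_divide_distrib[symmetric] distrib_left[symmetric])
  finally show ?case .
qed

text \<open>
  Compare with a single term of the exponential series of \<open>\<bar>x\<bar>\<close>. Two exponential moments, at \<open>1\<close> and
  \<open>- 1\<close>, thus control all absolute moments.
\<close>

lemma abs_power_le_fact_exp: "\<bar>x\<bar> ^ m \<le> fact m * (exp x + exp (- x))" for x :: real
proof -
  have "\<bar>x\<bar> ^ m / fact m = (\<Sum>n\<in>{m}. \<bar>x\<bar> ^ n /\<^sub>R fact n)" by (simp add: divide_inverse mult.commute)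
  also have "\<dots> \<le> (\<Sum>n. \<bar>x\<bar> ^ n /\<^sub>R fact n)"
    by (intro sum_le_suminf summable_exp_generic) auto
  also have "\<dots> = exp \<bar>x\<bar>" by (simp add: exp_def)
  also have "\<dots> \<le> exp x + exp (- x)" by (cases "0 \<le> x") auto
  finally show ?thesis by (simp add: field_simps)
qed

lemma step_sum_moment:
  assumes W: "standard_brownian_motion M F W"
    and s: "0 \<le> s 0" "\<And>n. s n \<le> s (Suc n)" and c: "\<And>n. \<bar>c n\<bar> \<le> \<sigma>"
  shows "(\<integral>\<^sup>+\<theta>. ennreal (\<bar>\<Sum>n<k. c n * (W (s (Suc n)) \<theta> - W (s n) \<theta>)\<bar> ^ m) \<partial>M)
    \<le> ennreal (2 * fact m * exp (\<sigma>\<^sup>2 * (s k - s 0) / 2))"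
proof -
  let ?J = "\<lambda>\<theta>. \<Sum>n<k. c n * (W (s (Suc n)) \<theta> - W (s n) \<theta>)"
  have pos: "0 \<le> s i" for i using lift_Suc_mono_le[of s 0 i] s by simp
  have [measurable]: "(\<lambda>\<theta>. W (s i) \<theta>) \<in> borel_measurable M" for i
    using filtration_measurable[OF W pos brownian_adapted[OF W pos order_refl]] .
  have "(\<integral>\<^sup>+\<theta>. ennreal (\<bar>?J \<theta>\<bar> ^ m) \<partial>M) \<le>
      (\<integral>\<^sup>+\<theta>. ennreal (fact m) * (ennreal (exp (1 * ?J \<theta>)) + ennreal (exp (- 1 * ?J \<theta>))) \<partial>M)"
    using abs_power_le_fact_exp
    by (intro nn_integral_mono) (simp add: ennreal_mult[symmetric] ennreal_plus[symmetric] del: ennreal_plus)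
  also have "\<dots> = ennreal (fact m) *
      ((\<integral>\<^sup>+\<theta>. ennreal (exp (1 * ?J \<theta>)) \<partial>M) + (\<integral>\<^sup>+\<theta>. ennreal (exp (- 1 * ?J \<theta>)) \<partial>M))"
    by (subst nn_integral_cmult, measurable) (subst nn_integral_add, auto)
  also have "\<dots> \<le> ennreal (fact m) *
     (ennreal (exp (1\<^sup>2 * \<sigma>\<^sup>2 * (s k - s 0) / 2)) + ennreal (exp ((- 1)\<^sup>2 * \<sigma>\<^sup>2 * (s k - s 0) / 2)))"
    by (intro mult_left_mono add_mono step_sum_exponential_moment[OF W s c]) auto
  also have "\<dots> = ennreal (2 * fact m * exp (\<sigma>\<^sup>2 * (s k - s 0) / 2))"
    by (simp add: ennreal_mult[symmetric] ennreal_plus[symmetric] del: ennreal_plus)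
  finally show ?thesis .
qed

section \<open>Solutions over integer times\<close>

lemma power_add_le: "(x + y) ^ m \<le> 2 ^ m * (x ^ m + y ^ m)" if "0 \<le> x" "0 \<le> y" for x y :: real
proof -
  have "(x + y) ^ m \<le> (2 * max x y) ^ m" using that by (intro power_mono) auto
  also have "\<dots> = 2 ^ m * max x y ^ m" by (rule power_mult_distrib)
  also have "max x y ^ m \<le> x ^ m + y ^ m" using that by (cases "x \<le> y") auto
  finally show ?thesis by simp
qed

lemma power_mean_le_mean_power:
  fixes x :: "nat \<Rightarrow> real"
  assumes "\<And>j. 0 \<le> x j"
  shows "((\<Sum>j<Suc M. x j) / real (Suc M)) ^ m \<le> (\<Sum>j<Suc M. x j ^ m) / real (Suc M)"
proof -
  have convex: "convex_on {0..} (\<lambda>x::real. x ^ m)" 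
    by (cases "even m") (auto intro: convex_power_odd convex_on_subset[OF convex_power_even])
  have "(\<Sum>j<Suc M. (1 / real (Suc M)) *\<^sub>R x j) ^ m \<le> (\<Sum>j<Suc M. 1 / real (Suc M) * x j ^ m)"
    by (rule convex_on_sum[OF _ _ convex]) (use assms in auto)
  then show ?thesis by (simp add: sum_divide_distrib del: sum.lessThan_Suc of_nat_Suc)
qed

context step_function begin

text \<open>
  The bound is the same for all step functions with levels in \<open>[- \<sigma>, \<sigma>]\<close>, however many jumps they
  have in \<open>[s, t]\<close>; this is what makes it uniform over the paths of the environment.
\<close>

lemma step_integral_increment_moment:
  assumes W: "standard_brownian_motion M F W" and v: "\<And>n. \<bar>v n\<bar> \<le> \<sigma>"
    and s: "0 \<le> s" "s \<le> t" "t \<le> s + 1"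
  shows "(\<integral>\<^sup>+\<theta>. ennreal (\<bar>step_integral K (\<lambda>r. W r \<theta>) t - step_integral K (\<lambda>r. W r \<theta>) s\<bar> ^ m) \<partial>M)
    \<le> ennreal (2 * fact m * exp (\<sigma>\<^sup>2 / 2))"
proof -
  let ?c = "\<lambda>n. max s (min t (T n))"
  have "(\<integral>\<^sup>+\<theta>. ennreal (\<bar>\<Sum>n<K. v n * (W (?c (Suc n)) \<theta> - W (?c n) \<theta>)\<bar> ^ m) \<partial>M)
      \<le> ennreal (2 * fact m * exp (\<sigma>\<^sup>2 * (?c K - ?c 0) / 2))"
  proof (rule step_sum_moment[OF W _ _ v])
    show "0 \<le> ?c 0" using s by simp
    show "?c n \<le> ?c (Suc n)" for n using T_less_Suc[of n] by (intro max.mono min.mono) auto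
  qed
  also have "\<dots> \<le> ennreal (2 * fact m * exp (\<sigma>\<^sup>2 / 2))"
  proof -
    have "?c K - ?c 0 \<le> 1" using s by auto
    then have "\<sigma>\<^sup>2 * (?c K - ?c 0) \<le> \<sigma>\<^sup>2 * 1" by (rule mult_left_mono) simp
    then show ?thesis by (intro ennreal_leI mult_left_mono) auto
  qed
  finally show ?thesis unfolding step_integral_diff[OF s(2)] .
qed

lemma step_integral_measurable:
  assumes W: "standard_brownian_motion M F W" and "0 \<le> t"
  shows "(\<lambda>\<theta>. step_integral K (\<lambda>r. W r \<theta>) t) \<in> borel_measurable M"
proof -
  have "W r \<in> borel_measurable M" if "0 \<le> r" for r
    using filtration_measurable[OF W that brownian_adapted[OF W that order_refl]] .
  then have "W (min t (T n)) \<in> borel_measurable M" for n using assms(2) T_nonneg[of n] by simp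
  then show ?thesis unfolding step_integral_def
    by (intro borel_measurable_sum borel_measurable_times borel_measurable_diff borel_measurable_const)
qed

text \<open>
  The noise term that \<open>linear_ode_bound\<close> produces over a unit interval. Its time integral is a limit
  of Riemann sums for almost every path, which yields a measurable version \<open>\<xi>\<close>; the moments of the
  Riemann sums are bounded by convexity, and Fatou's lemma passes to the limit.
\<close>

lemma noise_moment:
  assumes W: "standard_brownian_motion M F W" and v: "\<And>n. \<bar>v n\<bar> \<le> \<sigma>" and s: "0 \<le> s" and \<beta>: "0 \<le> \<beta>"
  obtains \<xi> where "\<xi> \<in> borel_measurable M"
    and "AE \<theta> in M. \<xi> \<theta> = \<bar>step_integral K (\<lambda>r. W r \<theta>) (s + 1) - step_integral K (\<lambda>r. W r \<theta>) s\<bar> +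
        \<beta> * integral {s..s + 1} (\<lambda>t. \<bar>step_integral K (\<lambda>r. W r \<theta>) t - step_integral K (\<lambda>r. W r \<theta>) s\<bar>)"
    and "(\<integral>\<^sup>+\<theta>. ennreal (\<xi> \<theta> ^ m) \<partial>M) \<le> ennreal (2 ^ m * (1 + \<beta> ^ m) * (2 * fact m * exp (\<sigma>\<^sup>2 / 2)))"
proof -
  define J where "J t \<theta> = \<bar>step_integral K (\<lambda>r. W r \<theta>) t - step_integral K (\<lambda>r. W r \<theta>) s\<bar>" for t \<theta>
  define B where "B = 2 * fact m * exp (\<sigma>\<^sup>2 / 2)"
  define p where "p k j = s + real (Suc j) / real (Suc k)" for k j
  have p: "s \<le> p k j" "p k j \<le> s + 1" if "j < Suc k" for k j using that by (auto simp: p_def field_simps)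
  have J_meas: "J t \<in> borel_measurable M" if "s \<le> t" for t
    unfolding J_def using s that
    by (intro borel_measurable_abs borel_measurable_diff step_integral_measurable[OF W]) auto
  have J_moment: "(\<integral>\<^sup>+\<theta>. ennreal (J t \<theta> ^ m) \<partial>M) \<le> ennreal B" if "s \<le> t" "t \<le> s + 1" for t
    unfolding J_def B_def by (rule step_integral_increment_moment[OF W v s that])
  define R where "R k \<theta> = (\<Sum>j<Suc k. J (p k j) \<theta>) / real (Suc k)" for k \<theta>
  have [measurable]: "R k \<in> borel_measurable M" for k
    unfolding R_def by (intro borel_measurable_divide borel_measurable_sum J_meas p borel_measurable_const) auto
  have R_nonneg: "0 \<le> R k \<theta>" for k \<theta> unfolding R_def J_def by (intro divide_nonneg_nonneg sum_nonneg) auto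
  have R_moment: "(\<integral>\<^sup>+\<theta>. ennreal (R k \<theta> ^ m) \<partial>M) \<le> ennreal B" for k
  proof -
    have "(\<integral>\<^sup>+\<theta>. ennreal (R k \<theta> ^ m) \<partial>M) \<le> (\<integral>\<^sup>+\<theta>. ennreal (1 / real (Suc k)) * (\<Sum>j<Suc k. ennreal (J (p k j) \<theta> ^ m)) \<partial>M)"
    proof (rule nn_integral_mono)
      fix \<theta>
      have "R k \<theta> ^ m \<le> (\<Sum>j<Suc k. J (p k j) \<theta> ^ m) / real (Suc k)"
        unfolding R_def by (rule power_mean_le_mean_power) (simp add: J_def)
      then have "ennreal (R k \<theta> ^ m) \<le> ennreal (1 / real (Suc k) * (\<Sum>j<Suc k. J (p k j) \<theta> ^ m))"
        by (intro ennreal_leI) (simp del: of_nat_Suc sum.lessThan_Suc)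
      also have "\<dots> = ennreal (1 / real (Suc k)) * ennreal (\<Sum>j<Suc k. J (p k j) \<theta> ^ m)"
        by (intro ennreal_mult sum_nonneg) (auto simp: J_def)
      also have "ennreal (\<Sum>j<Suc k. J (p k j) \<theta> ^ m) = (\<Sum>j<Suc k. ennreal (J (p k j) \<theta> ^ m))"
        by (rule sum_ennreal[symmetric]) (simp add: J_def)
      finally show "ennreal (R k \<theta> ^ m) \<le> ennreal (1 / real (Suc k)) * (\<Sum>j<Suc k. ennreal (J (p k j) \<theta> ^ m))" .
    qed
    also have "\<dots> = ennreal (1 / real (Suc k)) * (\<Sum>j<Suc k. \<integral>\<^sup>+\<theta>. ennreal (J (p k j) \<theta> ^ m) \<partial>M)"
    proof -
      have meas: "(\<lambda>\<theta>. ennreal (J (p k j) \<theta> ^ m)) \<in> borel_measurable M" if "j \<in> {..<Suc k}" for j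
        using J_meas[OF p(1)] that by (intro measurable_compose[OF _ measurable_ennreal] borel_measurable_power) auto
      then show ?thesis
        by (simp only: nn_integral_cmult[OF borel_measurable_sum[OF meas]] nn_integral_sum[OF meas])
    qed
    also have "\<dots> \<le> ennreal (1 / real (Suc k)) * (\<Sum>j<Suc k. ennreal B)"
      by (intro mult_left_mono sum_mono J_moment p) auto
    also have "\<dots> = ennreal (1 / real (Suc k) * (real (Suc k) * B))"
      by (subst ennreal_mult) (auto simp: B_def ennreal_mult ennreal_of_nat_eq_real_of_nat simp del: of_nat_Suc sum.lessThan_Suc)
    also have "1 / real (Suc k) * (real (Suc k) * B) = B" by simp
    finally show ?thesis .
  qed
  define \<xi> where "\<xi> \<theta> = J (s + 1) \<theta> + \<beta> * lim (\<lambda>k. R k \<theta>)" for \<theta>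
  have [measurable]: "J (s + 1) \<in> borel_measurable M" by (rule J_meas) simp
  have \<xi>_meas: "\<xi> \<in> borel_measurable M" unfolding \<xi>_def by measurable
  have "AE \<theta> in M. continuous_on {0..} (\<lambda>t. W t \<theta>)"
    using W unfolding standard_brownian_motion_def by blast
  then have R_lim: "AE \<theta> in M. (\<lambda>k. R k \<theta>) \<longlonglongrightarrow> integral {s..s + 1} (\<lambda>t. J t \<theta>)"
  proof eventually_elim
    case (elim \<theta>)
    have cont: "continuous_on {s..s + 1} (\<lambda>t. J t \<theta>)"
      unfolding J_def using s
      by (intro continuous_intros continuous_on_subset[OF continuous_step_integral[OF elim]]) auto
    then have "bounded ((\<lambda>t. J t \<theta>) ` {s..s + 1})"
      by (intro compact_imp_bounded compact_continuous_image) auto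
    then obtain C where C: "\<forall>x\<in>(\<lambda>t. J t \<theta>) ` {s..s + 1}. norm x \<le> C" unfolding bounded_iff by blast
    have "(\<lambda>k. 1 / real (Suc k) * (\<Sum>j<Suc k. J (s + 1 * real (Suc j) / real (Suc k)) \<theta>)) \<longlonglongrightarrow> integral {s..s + 1} (\<lambda>t. J t \<theta>)"
    proof (rule riemann_sums_tendsto_integral(2)[where B=C])
      show "\<bar>J x \<theta>\<bar> \<le> C" if "x \<in> {s..s+1}" for x using C that by simp
      show "((\<lambda>t. J t \<theta>) \<longlongrightarrow> J x \<theta>) (at_right x)" if x: "x \<in> {s..<s + 1}" for x
      proof -
        have "((\<lambda>t. J t \<theta>) \<longlongrightarrow> J x \<theta>) (at x within {s..s + 1})" using cont x by (simp add: continuous_on_def)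
        then have "((\<lambda>t. J t \<theta>) \<longlongrightarrow> J x \<theta>) (at x within {x..s + 1})" by (rule tendsto_within_subset) (use x in auto)
        then show ?thesis using x by (simp add: at_within_Icc_at_right)
      qed
    qed simp
    then show ?case unfolding R_def p_def by (simp del: of_nat_Suc sum.lessThan_Suc)
  qed
  have \<xi>_eq: "AE \<theta> in M. \<xi> \<theta> = J (s + 1) \<theta> + \<beta> * integral {s..s + 1} (\<lambda>t. J t \<theta>)"
    using R_lim by eventually_elim (simp add: \<xi>_def limI)
  have "(\<integral>\<^sup>+\<theta>. ennreal (\<xi> \<theta> ^ m) \<partial>M) = (\<integral>\<^sup>+\<theta>. liminf (\<lambda>k. ennreal ((J (s + 1) \<theta> + \<beta> * R k \<theta>) ^ m)) \<partial>M)"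
  proof (rule nn_integral_cong_AE)
    show "AE \<theta> in M. ennreal (\<xi> \<theta> ^ m) = liminf (\<lambda>k. ennreal ((J (s + 1) \<theta> + \<beta> * R k \<theta>) ^ m))"
      using R_lim \<xi>_eq
    proof eventually_elim
      case (elim \<theta>)
      have "(\<lambda>k. ennreal ((J (s + 1) \<theta> + \<beta> * R k \<theta>) ^ m)) \<longlonglongrightarrow> ennreal (\<xi> \<theta> ^ m)"
        unfolding elim(2) by (intro tendsto_intros elim(1))
      then show ?case by (simp add: lim_imp_Liminf)
    qed
  qed
  also have "\<dots> \<le> liminf (\<lambda>k. \<integral>\<^sup>+\<theta>. ennreal ((J (s + 1) \<theta> + \<beta> * R k \<theta>) ^ m) \<partial>M)"
    by (rule nn_integral_liminf) measurable
  also have "\<dots> \<le> liminf (\<lambda>k::nat. ennreal (2 ^ m * (1 + \<beta> ^ m) * B))"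
  proof (intro Liminf_mono always_eventually allI)
    fix k
    have "(\<integral>\<^sup>+\<theta>. ennreal ((J (s + 1) \<theta> + \<beta> * R k \<theta>) ^ m) \<partial>M) \<le>
        (\<integral>\<^sup>+\<theta>. ennreal (2 ^ m) * (ennreal (J (s + 1) \<theta> ^ m) + ennreal (\<beta> ^ m) * ennreal (R k \<theta> ^ m)) \<partial>M)"
    proof (rule nn_integral_mono)
      fix \<theta>
      have "(J (s + 1) \<theta> + \<beta> * R k \<theta>) ^ m \<le> 2 ^ m * (J (s + 1) \<theta> ^ m + \<beta> ^ m * R k \<theta> ^ m)"
        using power_add_le[of "J (s + 1) \<theta>" "\<beta> * R k \<theta>" m] R_nonneg[of k \<theta>] \<beta>
        by (simp add: J_def power_mult_distrib)
      then have "ennreal ((J (s + 1) \<theta> + \<beta> * R k \<theta>) ^ m) \<le> ennreal (2 ^ m * (J (s + 1) \<theta> ^ m + \<beta> ^ m * R k \<theta> ^ m))"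
        by (rule ennreal_leI)
      also have "\<dots> = ennreal (2 ^ m) * (ennreal (J (s + 1) \<theta> ^ m) + ennreal (\<beta> ^ m) * ennreal (R k \<theta> ^ m))"
        using R_nonneg[of k \<theta>] \<beta> by (simp add: J_def ennreal_mult)
      finally show "ennreal ((J (s + 1) \<theta> + \<beta> * R k \<theta>) ^ m) \<le>
          ennreal (2 ^ m) * (ennreal (J (s + 1) \<theta> ^ m) + ennreal (\<beta> ^ m) * ennreal (R k \<theta> ^ m))" .
    qed
    also have "\<dots> = ennreal (2 ^ m) * ((\<integral>\<^sup>+\<theta>. ennreal (J (s + 1) \<theta> ^ m) \<partial>M) +
        ennreal (\<beta> ^ m) * (\<integral>\<^sup>+\<theta>. ennreal (R k \<theta> ^ m) \<partial>M))"
      by (subst nn_integral_cmult, measurable) (subst nn_integral_add, measurable, subst nn_integral_cmult, auto)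
    also have "\<dots> \<le> ennreal (2 ^ m) * (ennreal B + ennreal (\<beta> ^ m) * ennreal B)"
      by (intro mult_left_mono add_mono J_moment R_moment) auto
    also have "\<dots> = ennreal (2 ^ m * (1 + \<beta> ^ m) * B)"
    proof -
      have "0 \<le> B" by (simp add: B_def)
      then have "ennreal B + ennreal (\<beta> ^ m) * ennreal B = ennreal (B + \<beta> ^ m * B)"
        using \<beta> by (simp add: ennreal_mult)
      then show ?thesis using \<open>0 \<le> B\<close> \<beta> by (simp add: ennreal_mult[symmetric] algebra_simps del: ennreal_plus)
    qed
    finally show "(\<integral>\<^sup>+\<theta>. ennreal ((J (s + 1) \<theta> + \<beta> * R k \<theta>) ^ m) \<partial>M) \<le> ennreal (2 ^ m * (1 + \<beta> ^ m) * B)" .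
  qed
  also have "\<dots> = ennreal (2 ^ m * (1 + \<beta> ^ m) * B)" by (rule Liminf_const) simp
  finally show ?thesis using \<xi>_meas \<xi>_eq that unfolding J_def B_def by blast
qed

end

text \<open>
  For almost every \<open>\<theta>\<close> the solution obeys a linear integral equation driven by the continuous path
  \<open>step_integral K (\<lambda>r. W r \<theta>)\<close>. The horizon \<open>K\<close> does not depend on \<open>\<theta>\<close>.
\<close>

lemma solution_one_step:
  fixes a sg :: "'s \<Rightarrow> real"
  assumes W: "standard_brownian_motion M F W"
    and sol: "solves_linear_sde M F W a sg x Y0 y"
    and path: "\<And>g. step_function T (\<lambda>n. g (z n)) (\<lambda>r. g (x r))"
    and a: "\<And>n. a (z n) \<le> 0" "\<And>n. - \<beta> \<le> a (z n)" and sg: "\<And>n. \<bar>sg (z n)\<bar> \<le> \<sigma>"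
    and s: "0 \<le> s"
  obtains \<xi> where "\<xi> \<in> borel_measurable M"
    and "AE \<theta> in M. 0 \<le> \<xi> \<theta> \<and> \<bar>y (s + 1) \<theta>\<bar> \<le> exp (integral {s..s + 1} (\<lambda>r. a (x r))) * \<bar>y s \<theta>\<bar> + \<xi> \<theta>"
    and "(\<integral>\<^sup>+\<theta>. ennreal (\<xi> \<theta> ^ m) \<partial>M) \<le> ennreal (2 ^ m * (1 + \<beta> ^ m) * (2 * fact m * exp (\<sigma>\<^sup>2 / 2)))"
proof -
  interpret A: step_function T "\<lambda>n. a (z n)" "\<lambda>r. a (x r)" by (rule path)
  interpret S: step_function T "\<lambda>n. sg (z n)" "\<lambda>r. sg (x r)" by (rule path)
  have \<beta>: "0 \<le> \<beta>" using a[of 0] by linarith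
  obtain K where K: "s + 1 \<le> T K" using A.ex_T_ge by blast
  let ?G = "\<lambda>\<theta>. S.step_integral K (\<lambda>r. W r \<theta>)"
  obtain \<xi> where \<xi>: "\<xi> \<in> borel_measurable M"
    and \<xi>_eq: "AE \<theta> in M. \<xi> \<theta> = \<bar>?G \<theta> (s + 1) - ?G \<theta> s\<bar> + \<beta> * integral {s..s + 1} (\<lambda>t. \<bar>?G \<theta> t - ?G \<theta> s\<bar>)"
    and \<xi>_moment: "(\<integral>\<^sup>+\<theta>. ennreal (\<xi> \<theta> ^ m) \<partial>M) \<le> ennreal (2 ^ m * (1 + \<beta> ^ m) * (2 * fact m * exp (\<sigma>\<^sup>2 / 2)))"
    by (rule S.noise_moment[OF W sg s \<beta>, of K m]) (rule that)
  have W_cont: "AE \<theta> in M. continuous_on {0..} (\<lambda>t. W t \<theta>)"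
    using W unfolding standard_brownian_motion_def by (elim conjE)
  have y: "AE \<theta> in M. continuous_on {0..} (\<lambda>t. y t \<theta>) \<and>
        (\<forall>t\<ge>0. has_step_integral (\<lambda>s. sg (x s)) (\<lambda>s. W s \<theta>) t
           (y t \<theta> - Y0 \<theta> - integral {0..t} (\<lambda>s. a (x s) * y s \<theta>)))"
    using sol unfolding solves_linear_sde_def by (elim conjE)
  have "AE \<theta> in M. 0 \<le> \<xi> \<theta> \<and> \<bar>y (s + 1) \<theta>\<bar> \<le> exp (integral {s..s + 1} (\<lambda>r. a (x r))) * \<bar>y s \<theta>\<bar> + \<xi> \<theta>"
    using \<xi>_eq W_cont y
  proof eventually_elim
    case (elim \<theta>)
    have G: "continuous_on {0..s + 1} (?G \<theta>)"
      by (rule continuous_on_subset[OF S.continuous_step_integral[OF elim(2)]]) auto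
    have y: "continuous_on {0..s + 1} (\<lambda>t. y t \<theta>)"
      by (rule continuous_on_subset[OF elim(3)[THEN conjunct1]]) auto
    have eq: "y r \<theta> = Y0 \<theta> + integral {0..r} (\<lambda>s. a (x s) * y s \<theta>) + ?G \<theta> r" if r: "0 \<le> r" "r \<le> s + 1" for r
    proof -
      have "r \<le> T K" using r K by simp
      have "has_step_integral (\<lambda>s. sg (x s)) (\<lambda>s. W s \<theta>) r (y r \<theta> - Y0 \<theta> - integral {0..r} (\<lambda>s. a (x s) * y s \<theta>))"
        using elim(3) r by blast
      from S.has_step_integral_unique[OF this r(1) \<open>r \<le> T K\<close>] show ?thesis by simp
    qed
    have "\<bar>y (s + 1) \<theta>\<bar> \<le> exp (integral {s..s + 1} (\<lambda>r. a (x r))) * \<bar>y s \<theta>\<bar> +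
        (\<bar>?G \<theta> (s + 1) - ?G \<theta> s\<bar> + \<beta> * integral {s..s + 1} (\<lambda>r. \<bar>?G \<theta> r - ?G \<theta> s\<bar>))"
      by (rule A.linear_ode_bound[OF a y G eq s]) simp_all
    moreover have "0 \<le> integral {s..s + 1} (\<lambda>r. \<bar>?G \<theta> r - ?G \<theta> s\<bar>)"
      by (rule integral_nonneg)
         (use s in \<open>auto intro!: integrable_continuous_real continuous_intros continuous_on_subset[OF G]\<close>)
    ultimately show ?case using \<beta> unfolding elim(1) by simp
  qed
  then show ?thesis using \<xi> \<xi>_moment that by blast
qed

text \<open>
  Each \<open>x k\<close> is at most \<open>w k\<close> times the largest ratio \<open>x j / w j\<close>, and the \<open>m\<close>-th power of the
  largest ratio is at most the sum of the \<open>m\<close>-th powers. This replaces the triangle inequality in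
  \<open>L\<^sup>m\<close>.
\<close>

lemma weighted_sum_power_le:
  fixes x w :: "nat \<Rightarrow> real"
  assumes w: "\<And>k. k < n \<Longrightarrow> 0 < w k" "(\<Sum>k<n. w k) \<le> D" and x: "\<And>k. k < n \<Longrightarrow> 0 \<le> x k" and m: "0 < m"
  shows "(\<Sum>k<n. x k) ^ m \<le> D ^ m * (\<Sum>k<n. (x k / w k) ^ m)"
proof (cases "n = 0")
  case True
  then show ?thesis using m by (simp add: zero_power)
next
  case False
  define R where "R = (\<lambda>k. x k / w k) ` {..<n}"
  have R: "finite R" "R \<noteq> {}" using False by (auto simp: R_def)
  then obtain j where j: "j < n" "Max R = x j / w j" using Max_in[OF R] unfolding R_def by blast
  have "x k \<le> w k * (x j / w j)" if "k < n" for k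
  proof -
    have "x k / w k \<le> Max R" using R that by (intro Max_ge) (auto simp: R_def)
    then show ?thesis using w(1)[OF that] j by (simp add: field_simps)
  qed
  then have "(\<Sum>k<n. x k) \<le> (\<Sum>k<n. w k * (x j / w j))" by (intro sum_mono) simp
  also have "\<dots> = (\<Sum>k<n. w k) * (x j / w j)" by (rule sum_distrib_right[symmetric])
  also have "\<dots> \<le> D * (x j / w j)" using w j x by (intro mult_right_mono) (auto simp: less_imp_le)
  finally have "(\<Sum>k<n. x k) ^ m \<le> (D * (x j / w j)) ^ m" using x by (intro power_mono sum_nonneg) auto
  also have "\<dots> = D ^ m * (x j / w j) ^ m" by (rule power_mult_distrib)
  also have "\<dots> \<le> D ^ m * (\<Sum>k<n. (x k / w k) ^ m)"
  proof (rule mult_left_mono)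
    show "(x j / w j) ^ m \<le> (\<Sum>k<n. (x k / w k) ^ m)"
      by (rule member_le_sum[where f="\<lambda>k. (x k / w k) ^ m"]) (use j w x in \<open>auto simp: less_imp_le\<close>)
    have "0 \<le> (\<Sum>k<n. w k)" using w(1) by (intro sum_nonneg) (auto simp: less_imp_le)
    then show "0 \<le> D ^ m" using w(2) by simp
  qed
  finally show ?thesis .
qed

lemma solution_iterated_bound:
  fixes a sg :: "'s \<Rightarrow> real"
  assumes W: "standard_brownian_motion M F W"
    and sol: "solves_linear_sde M F W a sg x Y0 y"
    and path: "\<And>g. step_function T (\<lambda>n. g (z n)) (\<lambda>r. g (x r))"
    and a: "\<And>n. a (z n) \<le> 0" "\<And>n. - \<beta> \<le> a (z n)" and sg: "\<And>n. \<bar>sg (z n)\<bar> \<le> \<sigma>"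
  obtains \<xi> where "\<And>k. \<xi> k \<in> borel_measurable M"
    and "AE \<theta> in M. \<forall>k. 0 \<le> \<xi> k \<theta>"
    and "AE \<theta> in M. \<forall>n. \<bar>y (real n) \<theta>\<bar> \<le> exp (integral {0..real n} (\<lambda>r. a (x r))) * \<bar>Y0 \<theta>\<bar> +
           (\<Sum>k<n. exp (integral {real (Suc k)..real n} (\<lambda>r. a (x r))) * \<xi> k \<theta>)"
    and "\<And>k. (\<integral>\<^sup>+\<theta>. ennreal (\<xi> k \<theta> ^ m) \<partial>M) \<le> ennreal (2 ^ m * (1 + \<beta> ^ m) * (2 * fact m * exp (\<sigma>\<^sup>2 / 2)))"
proof -
  interpret A: step_function T "\<lambda>n. a (z n)" "\<lambda>r. a (x r)" by (rule path)
  interpret S: step_function T "\<lambda>n. sg (z n)" "\<lambda>r. sg (x r)" by (rule path)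
  let ?I = "\<lambda>s t. integral {s..t} (\<lambda>r. a (x r))"
  define P where "P k \<xi> \<longleftrightarrow> \<xi> \<in> borel_measurable M \<and>
      (AE \<theta> in M. 0 \<le> \<xi> \<theta> \<and> \<bar>y (real k + 1) \<theta>\<bar> \<le> exp (?I (real k) (real k + 1)) * \<bar>y (real k) \<theta>\<bar> + \<xi> \<theta>) \<and>
      (\<integral>\<^sup>+\<theta>. ennreal (\<xi> \<theta> ^ m) \<partial>M) \<le> ennreal (2 ^ m * (1 + \<beta> ^ m) * (2 * fact m * exp (\<sigma>\<^sup>2 / 2)))"
    for k :: nat and \<xi>
  have "\<exists>\<xi>. P k \<xi>" for k
    unfolding P_def by (rule solution_one_step[OF W sol path a sg of_nat_0_le_iff, of k m]) (intro exI conjI)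
  then obtain \<xi> where P: "\<And>k. P k (\<xi> k)" by metis
  note \<xi> = P[unfolded P_def, THEN conjunct1] and step = P[unfolded P_def, THEN conjunct2, THEN conjunct1]
    and moment = P[unfolded P_def, THEN conjunct2, THEN conjunct2]
  have steps: "AE \<theta> in M. \<forall>k. 0 \<le> \<xi> k \<theta> \<and> \<bar>y (real k + 1) \<theta>\<bar> \<le> exp (?I (real k) (real k + 1)) * \<bar>y (real k) \<theta>\<bar> + \<xi> k \<theta>"
    unfolding AE_all_countable using step by blast
  have start: "AE \<theta> in M. y 0 \<theta> = Y0 \<theta>"
  proof -
    have "AE \<theta> in M. continuous_on {0..} (\<lambda>t. y t \<theta>) \<and>
        (\<forall>t\<ge>0. has_step_integral (\<lambda>s. sg (x s)) (\<lambda>s. W s \<theta>) t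
           (y t \<theta> - Y0 \<theta> - integral {0..t} (\<lambda>s. a (x s) * y s \<theta>)))"
      using sol unfolding solves_linear_sde_def by (elim conjE)
    then show ?thesis
    proof eventually_elim
      case (elim \<theta>)
      have "has_step_integral (\<lambda>s. sg (x s)) (\<lambda>s. W s \<theta>) 0 (y 0 \<theta> - Y0 \<theta> - integral {0..0} (\<lambda>s. a (x s) * y s \<theta>))"
        using elim by blast
      from S.has_step_integral_unique[OF this, of 0] show ?case
        using S.T_0 by (simp add: S.step_integral_def)
    qed
  qed
  have a_int: "(\<lambda>r. a (x r)) integrable_on {s..t}" if "0 \<le> s" "s \<le> t" for s t
    by (rule A.integrable[of \<beta>]) (use a that in \<open>auto simp: abs_le_iff minus_le_iff intro: order_trans\<close>)
  have I_add: "?I s (real n) + ?I (real n) (real (Suc n)) = ?I s (real (Suc n))" if "0 \<le> s" "s \<le> real n" for s n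
    using that by (intro Henstock_Kurzweil_Integration.integral_combine a_int) auto
  have "AE \<theta> in M. \<forall>n. \<bar>y (real n) \<theta>\<bar> \<le> exp (?I 0 (real n)) * \<bar>Y0 \<theta>\<bar> + (\<Sum>k<n. exp (?I (real (Suc k)) (real n)) * \<xi> k \<theta>)"
    using steps start
  proof eventually_elim
    case (elim \<theta>)
    show ?case
    proof
      fix n
      show "\<bar>y (real n) \<theta>\<bar> \<le> exp (?I 0 (real n)) * \<bar>Y0 \<theta>\<bar> + (\<Sum>k<n. exp (?I (real (Suc k)) (real n)) * \<xi> k \<theta>)"
      proof (induction n)
        case 0
        then show ?case using elim(2) by simp
      next
        case (Suc n)
        let ?e = "exp (?I (real n) (real (Suc n)))"
        have "\<bar>y (real (Suc n)) \<theta>\<bar> \<le> ?e * \<bar>y (real n) \<theta>\<bar> + \<xi> n \<theta>"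
          using elim(1) by (simp add: add.commute)
        also have "\<dots> \<le> ?e * (exp (?I 0 (real n)) * \<bar>Y0 \<theta>\<bar> + (\<Sum>k<n. exp (?I (real (Suc k)) (real n)) * \<xi> k \<theta>)) + \<xi> n \<theta>"
          using Suc by (intro add_right_mono mult_left_mono) auto
        also have "\<dots> = (exp (?I 0 (real n)) * ?e) * \<bar>Y0 \<theta>\<bar> + ((\<Sum>k<n. exp (?I (real (Suc k)) (real n)) * ?e * \<xi> k \<theta>) + \<xi> n \<theta>)"
          by (simp add: distrib_left sum_distrib_left mult_ac)
        also have "exp (?I 0 (real n)) * ?e = exp (?I 0 (real (Suc n)))"
          by (subst exp_add[symmetric], subst I_add) auto
        also have "(\<Sum>k<n. exp (?I (real (Suc k)) (real n)) * ?e * \<xi> k \<theta>) = (\<Sum>k<n. exp (?I (real (Suc k)) (real (Suc n))) * \<xi> k \<theta>)"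
          by (intro sum.cong refl, subst exp_add[symmetric], subst I_add) auto
        also have "\<dots> + \<xi> n \<theta> = (\<Sum>k<Suc n. exp (?I (real (Suc k)) (real (Suc n))) * \<xi> k \<theta>)" by simp
        finally show ?case .
      qed
    qed
  qed
  moreover have "AE \<theta> in M. \<forall>k. 0 \<le> \<xi> k \<theta>" using steps by eventually_elim blast
  ultimately show ?thesis by (intro that[OF \<xi> _ _ moment])
qed

section \<open>Truncated moments and the weak limit\<close>

text \<open>
  The truncation at \<open>B\<close> handles the initial value \<open>Y\<close>, which may fail to have an \<open>m\<close>-th moment:
  where \<open>\<bar>Y\<bar> ^ m\<close> exceeds a level \<open>L\<close> the trivial bound \<open>B\<close> is used, elsewhere \<open>L * \<Phi> ^ m\<close>.
\<close>

lemma truncated_power_le: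
  fixes v y B L \<Phi> Y :: real
  assumes y: "\<bar>y\<bar> \<le> \<Phi> * \<bar>Y\<bar> + v" and "0 \<le> \<Phi>" "0 \<le> v" "0 \<le> B" "0 \<le> L"
  shows "min (\<bar>y\<bar> ^ m) B \<le> 2 ^ m * (L * \<Phi> ^ m + B * indicator {t. L < \<bar>t\<bar> ^ m} Y + v ^ m)"
proof -
  have "\<bar>y\<bar> ^ m \<le> (\<Phi> * \<bar>Y\<bar> + v) ^ m" using y by (intro power_mono) auto
  also have "\<dots> \<le> 2 ^ m * ((\<Phi> * \<bar>Y\<bar>) ^ m + v ^ m)" using assms by (intro power_add_le) auto
  finally have *: "\<bar>y\<bar> ^ m \<le> 2 ^ m * (\<Phi> ^ m * \<bar>Y\<bar> ^ m + v ^ m)" by (simp add: power_mult_distrib)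
  show ?thesis
  proof (cases "L < \<bar>Y\<bar> ^ m")
    case True
    have "B \<le> 2 ^ m * B" using assms(4) by (simp add: mult_le_cancel_right1)
    also have "\<dots> \<le> 2 ^ m * (L * \<Phi> ^ m + B * indicator {t. L < \<bar>t\<bar> ^ m} Y + v ^ m)"
      using True assms by (intro mult_left_mono) auto
    finally show ?thesis by simp
  next
    case False
    have "\<Phi> ^ m * \<bar>Y\<bar> ^ m \<le> \<Phi> ^ m * L" using False assms by (intro mult_left_mono) auto
    then have "2 ^ m * (\<Phi> ^ m * \<bar>Y\<bar> ^ m + v ^ m) \<le> 2 ^ m * (L * \<Phi> ^ m + v ^ m)"
      by (intro mult_left_mono) (auto simp: mult.commute)
    then have "\<bar>y\<bar> ^ m \<le> 2 ^ m * (L * \<Phi> ^ m + v ^ m)" using * by linarith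
    then show ?thesis using False by (simp add: min.coboundedI1)
  qed
qed

text \<open>
  Integration over the Brownian motion alone, along a fixed path of the environment. On the right the
  environment only enters through exponential functionals whose expectations are known to decay.
\<close>

lemma quenched_truncated_moment:
  fixes a sg :: "'s \<Rightarrow> real"
  assumes W: "standard_brownian_motion M F W"
    and sol: "solves_linear_sde M F W a sg x Y0 y"
    and path: "\<And>g. step_function T (\<lambda>n. g (z n)) (\<lambda>r. g (x r))"
    and a: "\<And>n. a (z n) \<le> 0" "\<And>n. - \<beta> \<le> a (z n)" and sg: "\<And>n. \<bar>sg (z n)\<bar> \<le> \<sigma>"
    and Y0: "Y0 \<in> borel_measurable M" and m: "0 < m" and BL: "0 \<le> B" "0 \<le> L"
    and w: "\<And>k. k < n \<Longrightarrow> 0 < w k" "(\<Sum>k<n. w k) \<le> D"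
  shows "(\<integral>\<^sup>+\<theta>. ennreal (min (\<bar>y (real n) \<theta>\<bar> ^ m) B) \<partial>M) \<le>
     ennreal (2 ^ m) * (ennreal L * ennreal (exp (- real m * integral {0..real n} (\<lambda>r. - a (x r))))
       + ennreal B * emeasure M {\<theta> \<in> space M. L < \<bar>Y0 \<theta>\<bar> ^ m}
       + (\<Sum>k<n. ennreal ((D / w k) ^ m * (2 ^ m * (1 + \<beta> ^ m) * (2 * fact m * exp (\<sigma>\<^sup>2 / 2)))) *
            ennreal (exp (- real m * integral {real (Suc k)..real n} (\<lambda>r. - a (x r))))))"
proof -
  interpret prob_space M using W by (simp add: standard_brownian_motion_def)
  let ?I = "\<lambda>s t. integral {s..t} (\<lambda>r. a (x r))"
  let ?K = "2 ^ m * (1 + \<beta> ^ m) * (2 * fact m * exp (\<sigma>\<^sup>2 / 2))"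
  obtain \<xi> where [measurable]: "\<And>k. \<xi> k \<in> borel_measurable M"
    and pos: "AE \<theta> in M. \<forall>k. 0 \<le> \<xi> k \<theta>"
    and bound: "AE \<theta> in M. \<forall>n. \<bar>y (real n) \<theta>\<bar> \<le> exp (?I 0 (real n)) * \<bar>Y0 \<theta>\<bar> +
           (\<Sum>k<n. exp (?I (real (Suc k)) (real n)) * \<xi> k \<theta>)"
    and moment: "\<And>k. (\<integral>\<^sup>+\<theta>. ennreal (\<xi> k \<theta> ^ m) \<partial>M) \<le> ennreal ?K"
    by (rule solution_iterated_bound[OF W sol path a sg, of m]) (rule that)
  have \<beta>: "0 \<le> \<beta>" using a[of 0] by linarith
  have D: "0 \<le> D"
  proof -
    have "0 \<le> (\<Sum>k<n. w k)" using w(1) by (intro sum_nonneg) (auto simp: less_imp_le)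
    then show ?thesis using w(2) by simp
  qed
  define c where "c k = (exp (?I (real (Suc k)) (real n)) / w k) ^ m * D ^ m" for k
  have c: "0 \<le> c k" if "k < n" for k using w(1)[OF that] D by (simp add: c_def)
  have I_neg: "exp (?I s t) ^ m = exp (- real m * integral {s..t} (\<lambda>r. - a (x r)))" for s t
    by (simp add: exp_of_nat_mult[symmetric])
  have "(\<integral>\<^sup>+\<theta>. ennreal (min (\<bar>y (real n) \<theta>\<bar> ^ m) B) \<partial>M) \<le>
     (\<integral>\<^sup>+\<theta>. ennreal (2 ^ m) * (ennreal L * ennreal (exp (?I 0 (real n)) ^ m)
       + ennreal B * indicator {\<theta> \<in> space M. L < \<bar>Y0 \<theta>\<bar> ^ m} \<theta>
       + (\<Sum>k<n. ennreal (c k) * ennreal (\<xi> k \<theta> ^ m))) \<partial>M)"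
  proof (rule nn_integral_mono_AE)
    show "AE \<theta> in M. ennreal (min (\<bar>y (real n) \<theta>\<bar> ^ m) B) \<le>
       ennreal (2 ^ m) * (ennreal L * ennreal (exp (?I 0 (real n)) ^ m)
       + ennreal B * indicator {\<theta> \<in> space M. L < \<bar>Y0 \<theta>\<bar> ^ m} \<theta>
       + (\<Sum>k<n. ennreal (c k) * ennreal (\<xi> k \<theta> ^ m)))"
      using pos bound AE_space
    proof eventually_elim
      case (elim \<theta>)
      let ?v = "\<Sum>k<n. exp (?I (real (Suc k)) (real n)) * \<xi> k \<theta>"
      have v: "0 \<le> ?v" using elim(1) by (intro sum_nonneg) auto
      have v_pow: "?v ^ m \<le> (\<Sum>k<n. c k * \<xi> k \<theta> ^ m)"
      proof -
        have "?v ^ m \<le> D ^ m * (\<Sum>k<n. (exp (?I (real (Suc k)) (real n)) * \<xi> k \<theta> / w k) ^ m)"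
          using elim(1) by (intro weighted_sum_power_le w m) auto
        also have "\<dots> = (\<Sum>k<n. c k * \<xi> k \<theta> ^ m)"
          unfolding c_def sum_distrib_left by (intro sum.cong refl) (simp add: power_mult_distrib power_divide)
        finally show ?thesis .
      qed
      have "min (\<bar>y (real n) \<theta>\<bar> ^ m) B \<le> 2 ^ m * (L * exp (?I 0 (real n)) ^ m + B * indicator {t. L < \<bar>t\<bar> ^ m} (Y0 \<theta>) + ?v ^ m)"
        using elim(2) v BL by (intro truncated_power_le) auto
      also have "\<dots> \<le> 2 ^ m * (L * exp (?I 0 (real n)) ^ m + B * indicator {t. L < \<bar>t\<bar> ^ m} (Y0 \<theta>) + (\<Sum>k<n. c k * \<xi> k \<theta> ^ m))"
        using v_pow by simp
      finally have "ennreal (min (\<bar>y (real n) \<theta>\<bar> ^ m) B) \<le> ennreal (2 ^ m * (L * exp (?I 0 (real n)) ^ m +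
          B * indicator {t. L < \<bar>t\<bar> ^ m} (Y0 \<theta>) + (\<Sum>k<n. c k * \<xi> k \<theta> ^ m)))" by (rule ennreal_leI)
      also have "\<dots> = ennreal (2 ^ m) * (ennreal L * ennreal (exp (?I 0 (real n)) ^ m)
         + ennreal B * ennreal (indicator {t. L < \<bar>t\<bar> ^ m} (Y0 \<theta>)) + ennreal (\<Sum>k<n. c k * \<xi> k \<theta> ^ m))"
      proof -
        have split: "ennreal (2 ^ m * (p + q + r)) = ennreal (2 ^ m) * (ennreal p + ennreal q + ennreal r)"
          if "0 \<le> p" "0 \<le> q" "0 \<le> r" for p q r :: real
          using that by (subst ennreal_mult) auto
        have "0 \<le> (\<Sum>k<n. c k * \<xi> k \<theta> ^ m)" using c elim(1) by (intro sum_nonneg) auto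
        then show ?thesis using BL by (subst split) (simp_all add: ennreal_mult)
      qed
      also have "ennreal (\<Sum>k<n. c k * \<xi> k \<theta> ^ m) = (\<Sum>k<n. ennreal (c k) * ennreal (\<xi> k \<theta> ^ m))"
        using c elim(1) by (subst sum_ennreal[symmetric]) (auto simp: ennreal_mult)
      also have "ennreal (indicator {t. L < \<bar>t\<bar> ^ m} (Y0 \<theta>)) = indicator {\<theta> \<in> space M. L < \<bar>Y0 \<theta>\<bar> ^ m} \<theta>"
        using elim(3) by (simp add: indicator_def)
      finally show ?case .
    qed
  qed
  also have "\<dots> = ennreal (2 ^ m) * (ennreal L * ennreal (exp (?I 0 (real n)) ^ m)
       + ennreal B * emeasure M {\<theta> \<in> space M. L < \<bar>Y0 \<theta>\<bar> ^ m}
       + (\<Sum>k<n. ennreal (c k) * (\<integral>\<^sup>+\<theta>. ennreal (\<xi> k \<theta> ^ m) \<partial>M)))"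
    using Y0 by (simp add: nn_integral_cmult nn_integral_add nn_integral_sum emeasure_space_1)
  also have "\<dots> \<le> ennreal (2 ^ m) * (ennreal L * ennreal (exp (?I 0 (real n)) ^ m)
       + ennreal B * emeasure M {\<theta> \<in> space M. L < \<bar>Y0 \<theta>\<bar> ^ m}
       + (\<Sum>k<n. ennreal (c k) * ennreal ?K))"
    by (intro mult_left_mono add_left_mono sum_mono moment) auto
  also have "(\<Sum>k<n. ennreal (c k) * ennreal ?K) =
      (\<Sum>k<n. ennreal ((D / w k) ^ m * ?K) * ennreal (exp (- real m * integral {real (Suc k)..real n} (\<lambda>r. - a (x r)))))"
  proof (intro sum.cong refl)
    fix k assume "k \<in> {..<n}"
    then have k: "k < n" by simp
    have "c k * ?K = (D / w k) ^ m * ?K * exp (- real m * integral {real (Suc k)..real n} (\<lambda>r. - a (x r)))"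
      unfolding c_def I_neg[symmetric] by (simp add: power_divide)
    moreover have "0 \<le> ?K" using \<beta> by simp
    moreover have "0 \<le> (D / w k) ^ m * ?K" using D w(1)[OF k] \<beta> by simp
    ultimately show "ennreal (c k) * ennreal ?K =
       ennreal ((D / w k) ^ m * ?K) * ennreal (exp (- real m * integral {real (Suc k)..real n} (\<lambda>r. - a (x r))))"
      using c[OF k] by (simp only: ennreal_mult[symmetric] exp_ge_zero)
  qed
  finally show ?thesis unfolding I_neg .
qed

text \<open>
  Integrate the previous bound over the environment. Over the remaining time \<open>j = n - Suc k\<close> the
  environment decays like \<open>\<rho> ^ (2 * j)\<close>, and the weight \<open>w k = \<psi> ^ j\<close> with \<open>\<psi> ^ m = \<rho>\<close> spends half
  of that, so that a geometric series in \<open>\<rho>\<close> is left.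
\<close>

lemma (in stationary_environment) annealed_truncated_moment:
  fixes a sg :: "'s \<Rightarrow> real" and M :: "'th measure" and Y :: "real \<Rightarrow> 'w \<times> 'th \<Rightarrow> real"
  assumes irr: "irreducible_kernel E q"
    and a: "\<And>i. i \<in> E \<Longrightarrow> a i \<le> 0" and i0: "i0 \<in> E" "a i0 < 0"
    and W: "standard_brownian_motion M F W" and Y0: "Y0 \<in> borel_measurable M"
    and Y: "\<And>t. 0 \<le> t \<Longrightarrow> Y t \<in> borel_measurable (Q \<Otimes>\<^sub>M M)"
    and sol: "\<And>\<omega>. \<omega> \<in> space Q \<Longrightarrow> solves_linear_sde M F W a sg (\<lambda>t. X t \<omega>) Y0 (\<lambda>t \<theta>. Y t (\<omega>, \<theta>))"
    and m: "0 < m"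
  obtains A \<delta> K where "0 < \<delta>" "0 \<le> A" "0 \<le> K"
    and "\<And>n B L. 0 \<le> B \<Longrightarrow> 0 \<le> L \<Longrightarrow>
      (\<integral>\<^sup>+p. ennreal (min (\<bar>Y (real n) p\<bar> ^ m) B) \<partial>(Q \<Otimes>\<^sub>M M)) \<le>
        ennreal (A * L * exp (- \<delta> * real n) + 2 ^ m * B * measure M {\<theta> \<in> space M. L < \<bar>Y0 \<theta>\<bar> ^ m} + K)"
proof -
  interpret Q: prob_space Q by (rule prob_space_Q)
  interpret M: prob_space M using W unfolding standard_brownian_motion_def by (elim conjE)
  let ?I = "\<lambda>s t \<omega>. integral {s..t} (\<lambda>r. - a (X r \<omega>))"
  obtain C \<delta> where \<delta>: "0 < \<delta>" and C: "0 \<le> C"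
    and decay: "\<And>t. 0 \<le> t \<Longrightarrow> (\<integral>\<^sup>+\<omega>. ennreal (exp (- real m * ?I 0 t \<omega>)) \<partial>Q) \<le> ennreal (C * exp (- \<delta> * t))"
  proof (rule exponential_functional_decay[OF jump fin lam_gt_0 stoch irr, of "\<lambda>i. - a i" i0 "real m"])
    show "0 \<le> - a i" if "i \<in> E" for i using a[OF that] by simp
    show "i0 \<in> E" "0 < - a i0" "0 < real m" using i0 m by simp_all
  qed (assumption | (rule that, assumption+))+
  define \<beta> where "\<beta> = (\<Sum>i\<in>E. \<bar>a i\<bar>)"
  define \<sigma> where "\<sigma> = (\<Sum>i\<in>E. \<bar>sg i\<bar>)"
  have \<beta>: "0 \<le> \<beta>" by (simp add: \<beta>_def sum_nonneg)
  define K where "K = 2 ^ m * (1 + \<beta> ^ m) * (2 * fact m * exp (\<sigma>\<^sup>2 / 2))"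
  have K: "0 \<le> K" using \<beta> by (simp add: K_def)
  define \<psi> where "\<psi> = exp (- \<delta> / (2 * real m))"
  define \<rho> where "\<rho> = exp (- \<delta> / 2)"
  have \<psi>: "0 < \<psi>" "\<psi> < 1" using \<delta> m by (simp_all add: \<psi>_def)
  have \<rho>: "0 < \<rho>" "\<rho> < 1" using \<delta> by (simp_all add: \<rho>_def)
  have \<psi>_pow: "\<psi> ^ m = \<rho>" using m by (simp add: \<psi>_def \<rho>_def exp_of_nat_mult[symmetric])
  define D where "D = 1 / (1 - \<psi>)"
  have geom: "(\<Sum>j<n. r ^ j) \<le> 1 / (1 - r)" if "0 < r" "r < 1" for r :: real and n
  proof -
    have "(\<Sum>j<n. r ^ j) \<le> (\<Sum>j. r ^ j)" using that by (intro sum_le_suminf summable_geometric) auto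
    then show ?thesis using that by (simp add: suminf_geometric)
  qed
  have D: "(\<Sum>k<n. \<psi> ^ (n - Suc k)) \<le> D" for n
    using geom[OF \<psi>, of n] by (simp add: sum.nat_diff_reindex D_def)
  have D0: "0 \<le> D" using \<psi> by (simp add: D_def)
  have shift: "(\<integral>\<^sup>+\<omega>. ennreal (exp (- real m * ?I (real (Suc k)) (real n) \<omega>)) \<partial>Q) \<le> ennreal (C * exp (- \<delta> * real (n - Suc k)))"
    if "k < n" for k n
  proof -
    have "real n = real (Suc k) + real (n - Suc k)" using that by simp
    then have "(\<integral>\<^sup>+\<omega>. ennreal (exp (- real m * ?I (real (Suc k)) (real n) \<omega>)) \<partial>Q) =
        (\<integral>\<^sup>+\<omega>. ennreal (exp (- real m * ?I (real (Suc k)) (real (Suc k) + real (n - Suc k)) \<omega>)) \<partial>Q)"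
      by (simp only:)
    also have "\<dots> = (\<integral>\<^sup>+\<omega>. ennreal (exp (- real m * ?I 0 (real (n - Suc k)) \<omega>)) \<partial>Q)"
      using stationary_exponential_functional[of "\<lambda>i. - a i" "real m" "real (Suc k)" "real (n - Suc k)"] a by simp
    also have "\<dots> \<le> ennreal (C * exp (- \<delta> * real (n - Suc k)))" by (rule decay) simp
    finally show ?thesis .
  qed
  have bound: "(\<integral>\<^sup>+p. ennreal (min (\<bar>Y (real n) p\<bar> ^ m) B) \<partial>(Q \<Otimes>\<^sub>M M)) \<le>
      ennreal ((2 ^ m * C) * L * exp (- \<delta> * real n) + 2 ^ m * B * measure M {\<theta> \<in> space M. L < \<bar>Y0 \<theta>\<bar> ^ m}
        + 2 ^ m * (D ^ m * K * C / (1 - \<rho>)))"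
    if B: "0 \<le> B" and L: "0 \<le> L" for n B L
  proof -
    let ?p = "measure M {\<theta> \<in> space M. L < \<bar>Y0 \<theta>\<bar> ^ m}"
    let ?c = "\<lambda>k. (D / \<psi> ^ (n - Suc k)) ^ m * K"
    have [measurable]: "?I s t \<in> borel_measurable Q" if "0 \<le> s" for s t
      using integral_measurable[OF that, of t "\<lambda>i. - a i"] .
    have [measurable]: "Y (real n) \<in> borel_measurable (Q \<Otimes>\<^sub>M M)" by (rule Y) simp
    have "(\<integral>\<^sup>+p. ennreal (min (\<bar>Y (real n) p\<bar> ^ m) B) \<partial>(Q \<Otimes>\<^sub>M M)) =
        (\<integral>\<^sup>+\<omega>. \<integral>\<^sup>+\<theta>. ennreal (min (\<bar>Y (real n) (\<omega>, \<theta>)\<bar> ^ m) B) \<partial>M \<partial>Q)"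
      by (rule M.nn_integral_fst[symmetric]) measurable
    also have "\<dots> \<le> (\<integral>\<^sup>+\<omega>. ennreal (2 ^ m) * (ennreal L * ennreal (exp (- real m * ?I 0 (real n) \<omega>)) + ennreal B * ennreal ?p
       + (\<Sum>k<n. ennreal (?c k) * ennreal (exp (- real m * ?I (real (Suc k)) (real n) \<omega>)))) \<partial>Q)"
    proof (rule nn_integral_mono)
      fix \<omega> assume \<omega>: "\<omega> \<in> space Q"
      obtain z T where z: "\<And>n. z n \<in> E" "\<And>g. step_function T (\<lambda>n. g (z n)) (\<lambda>r. g (X r \<omega>))"
        by (rule path_cases[OF \<omega>]) (rule that)
      have "- \<beta> \<le> a (z k)" for k using bounded_on_states[OF z(1)[of k], of a] by (simp add: \<beta>_def abs_le_iff)
      moreover have "\<bar>sg (z k)\<bar> \<le> \<sigma>" for k using bounded_on_states[OF z(1)[of k], of sg] by (simp add: \<sigma>_def)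
      ultimately show "(\<integral>\<^sup>+\<theta>. ennreal (min (\<bar>Y (real n) (\<omega>, \<theta>)\<bar> ^ m) B) \<partial>M) \<le> ennreal (2 ^ m) * (ennreal L * ennreal (exp (- real m * ?I 0 (real n) \<omega>)) + ennreal B * ennreal ?p
       + (\<Sum>k<n. ennreal (?c k) * ennreal (exp (- real m * ?I (real (Suc k)) (real n) \<omega>))))"
        unfolding K_def M.emeasure_eq_measure[symmetric] using \<psi>(1)
        by (intro quenched_truncated_moment[OF W sol[OF \<omega>] z(2) a[OF z(1)] _ _ Y0 m B L _ D]) auto
    qed
    also have "\<dots> = ennreal (2 ^ m) * (ennreal L * (\<integral>\<^sup>+\<omega>. ennreal (exp (- real m * ?I 0 (real n) \<omega>)) \<partial>Q) + ennreal B * ennreal ?p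
       + (\<Sum>k<n. ennreal (?c k) * (\<integral>\<^sup>+\<omega>. ennreal (exp (- real m * ?I (real (Suc k)) (real n) \<omega>)) \<partial>Q)))"
      by (simp add: nn_integral_cmult nn_integral_add nn_integral_sum Q.emeasure_space_1)
    also have "\<dots> \<le> ennreal (2 ^ m) * (ennreal L * ennreal (C * exp (- \<delta> * real n)) + ennreal B * ennreal ?p
       + (\<Sum>k<n. ennreal (?c k) * ennreal (C * exp (- \<delta> * real (n - Suc k)))))"
      by (intro mult_left_mono add_mono sum_mono decay shift order_refl) auto
    also have "(\<Sum>k<n. ennreal (?c k) * ennreal (C * exp (- \<delta> * real (n - Suc k)))) = ennreal (D ^ m * K * C * (\<Sum>k<n. \<rho> ^ (n - Suc k)))"
    proof -
      have term_eq: "?c k * (C * exp (- \<delta> * real (n - Suc k))) = D ^ m * K * C * \<rho> ^ (n - Suc k)" for k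
      proof -
        have "exp (- \<delta> * real (n - Suc k)) = \<rho> ^ (n - Suc k) * \<rho> ^ (n - Suc k)"
          unfolding \<rho>_def exp_of_nat_mult[symmetric] exp_add[symmetric] by (simp add: field_simps)
        moreover have "(\<psi> ^ (n - Suc k)) ^ m = \<rho> ^ (n - Suc k)"
          unfolding \<psi>_pow[symmetric] power_mult[symmetric] by (simp add: mult.commute)
        ultimately show ?thesis using \<rho> by (simp add: power_divide)
      qed
      have "ennreal (?c k) * ennreal (C * exp (- \<delta> * real (n - Suc k))) = ennreal (?c k * (C * exp (- \<delta> * real (n - Suc k))))" for k
        using D0 K C \<psi> by (intro ennreal_mult[symmetric]) auto
      then have "ennreal (?c k) * ennreal (C * exp (- \<delta> * real (n - Suc k))) = ennreal (D ^ m * K * C * \<rho> ^ (n - Suc k))" for k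
        unfolding term_eq .
      then have "(\<Sum>k<n. ennreal (?c k) * ennreal (C * exp (- \<delta> * real (n - Suc k)))) = (\<Sum>k<n. ennreal (D ^ m * K * C * \<rho> ^ (n - Suc k)))"
        by (simp only:)
      also have "\<dots> = ennreal (\<Sum>k<n. D ^ m * K * C * \<rho> ^ (n - Suc k))"
        by (rule sum_ennreal) (use D0 K C \<rho> in simp)
      finally show ?thesis by (simp only: sum_distrib_left)
    qed
    also have "(\<Sum>k<n. \<rho> ^ (n - Suc k)) = (\<Sum>j<n. \<rho> ^ j)" by (rule sum.nat_diff_reindex)
    also have "ennreal (2 ^ m) * (ennreal L * ennreal (C * exp (- \<delta> * real n)) + ennreal B * ennreal ?p + ennreal (D ^ m * K * C * (\<Sum>j<n. \<rho> ^ j)))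
       \<le> ennreal (2 ^ m) * (ennreal L * ennreal (C * exp (- \<delta> * real n)) + ennreal B * ennreal ?p + ennreal (D ^ m * K * C * (1 / (1 - \<rho>))))"
      using D0 K C by (intro mult_left_mono add_left_mono ennreal_leI geom \<rho>) auto
    also have "\<dots> = ennreal (2 ^ m * (L * (C * exp (- \<delta> * real n)) + B * ?p + D ^ m * K * C * (1 / (1 - \<rho>))))"
      using D0 K C B L \<rho> by (simp add: ennreal_mult)
    finally show ?thesis by (simp add: algebra_simps)
  qed
  show ?thesis
    by (rule that[OF \<delta> _ _ bound]) (use C D0 K \<rho> in auto)
qed

text \<open>
  The bound may hold for each \<open>B\<close> from an index on that depends on \<open>B\<close>: the limit in \<open>n\<close> is taken
  before the truncation is removed.
\<close>

lemma weak_limit_moment_le: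
  assumes P: "prob_space P" and Y: "\<And>n. Y n \<in> borel_measurable P"
    and \<nu>: "real_distribution \<nu>" and conv: "weak_conv_m (\<lambda>n. distr P borel (Y n)) \<nu>"
    and bound: "\<And>B. 0 \<le> B \<Longrightarrow> eventually (\<lambda>n. (\<integral>\<^sup>+p. ennreal (min (\<bar>Y n p\<bar> ^ m) B) \<partial>P) \<le> ennreal K) sequentially"
    and K: "0 \<le> K"
  shows "(\<integral>\<^sup>+x. ennreal (\<bar>x\<bar> ^ m) \<partial>\<nu>) \<le> ennreal K"
proof -
  interpret P: prob_space P by fact
  interpret \<nu>: real_distribution \<nu> by fact
  have trunc: "(\<integral>\<^sup>+x. ennreal (min (\<bar>x\<bar> ^ m) B) \<partial>\<nu>) \<le> ennreal K" if B: "0 \<le> B" for B :: real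
  proof -
    let ?f = "\<lambda>x::real. min (\<bar>x\<bar> ^ m) B"
    have f: "0 \<le> ?f x" "norm (?f x) \<le> B" for x using B by auto
    have lim: "(\<lambda>n. integral\<^sup>L (distr P borel (Y n)) ?f) \<longlonglongrightarrow> integral\<^sup>L \<nu> ?f"
    proof (rule weak_conv_imp_integral_bdd_continuous_conv[OF _ \<nu> conv])
      show "real_distribution (distr P borel (Y n))" for n
        using Y by (rule P.real_distribution_distr)
      show "isCont ?f x" for x by (intro continuous_intros)
    qed (rule f)
    have "integral\<^sup>L \<nu> ?f \<le> K"
    proof (rule tendsto_upperbound[OF lim _ trivial_limit_sequentially])
      show "eventually (\<lambda>n. integral\<^sup>L (distr P borel (Y n)) ?f \<le> K) sequentially"
        using bound[OF B]
      proof eventually_elim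
        case (elim n)
        have int: "integrable P (\<lambda>p. ?f (Y n p))"
          using Y[of n] f by (intro P.integrable_const_bound[where B=B]) auto
        have "integral\<^sup>L (distr P borel (Y n)) ?f = (\<integral>p. ?f (Y n p) \<partial>P)"
          using Y by (intro integral_distr) auto
        moreover have "ennreal (\<integral>p. ?f (Y n p) \<partial>P) \<le> ennreal K"
          using nn_integral_eq_integral[OF int] f(1) elim by simp
        ultimately show ?case using K by simp
      qed
    qed
    moreover have "integrable \<nu> ?f"
      using f by (intro \<nu>.integrable_const_bound[where B=B]) auto
    ultimately show ?thesis using nn_integral_eq_integral[of \<nu> ?f] f(1) by (simp add: ennreal_leI)
  qed
  have "(\<integral>\<^sup>+x. ennreal (\<bar>x\<bar> ^ m) \<partial>\<nu>) = (\<integral>\<^sup>+x. liminf (\<lambda>n. ennreal (min (\<bar>x\<bar> ^ m) (real n))) \<partial>\<nu>)"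
  proof (rule nn_integral_cong)
    fix x :: real
    have "eventually (\<lambda>n. ennreal (\<bar>x\<bar> ^ m) = ennreal (min (\<bar>x\<bar> ^ m) (real n))) sequentially"
      using eventually_ge_at_top[of "nat \<lceil>\<bar>x\<bar> ^ m\<rceil>"]
    proof eventually_elim
      case (elim n)
      then have "\<bar>x\<bar> ^ m \<le> real n" by linarith
      then show ?case by (simp add: min_absorb1)
    qed
    then have "(\<lambda>n. ennreal (min (\<bar>x\<bar> ^ m) (real n))) \<longlonglongrightarrow> ennreal (\<bar>x\<bar> ^ m)"
      by (intro tendsto_eventually) (auto elim: eventually_mono)
    then show "ennreal (\<bar>x\<bar> ^ m) = liminf (\<lambda>n. ennreal (min (\<bar>x\<bar> ^ m) (real n)))"
      by (rule lim_imp_Liminf[OF trivial_limit_sequentially, symmetric])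
  qed
  also have "\<dots> \<le> liminf (\<lambda>n. \<integral>\<^sup>+x. ennreal (min (\<bar>x\<bar> ^ m) (real n)) \<partial>\<nu>)"
    by (rule nn_integral_liminf) measurable
  also have "\<dots> \<le> liminf (\<lambda>n::nat. ennreal K)"
    by (intro Liminf_mono always_eventually allI trunc) simp
  also have "\<dots> = ennreal K" by (rule Liminf_const) simp
  finally show ?thesis .
qed

lemma (in prob_space) tail_small:
  fixes V :: "'a \<Rightarrow> real"
  assumes V: "V \<in> borel_measurable M" and "0 < \<epsilon>"
  obtains L where "0 \<le> L" "prob {\<theta> \<in> space M. L < V \<theta>} < \<epsilon>"
proof -
  let ?A = "\<lambda>n. {\<theta> \<in> space M. real n < V \<theta>}"
  have "(\<lambda>n. prob (?A n)) \<longlonglongrightarrow> prob (\<Inter>n. ?A n)"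
    using V by (intro finite_Lim_measure_decseq) (auto simp: decseq_def)
  moreover have "\<exists>n. V \<theta> \<le> real n" for \<theta> by (rule real_arch_simple)
  then have "(\<Inter>n. ?A n) = {}" by (auto simp: not_less[symmetric])
  ultimately have "(\<lambda>n. prob (?A n)) \<longlonglongrightarrow> 0" by simp
  then have "eventually (\<lambda>n. prob (?A n) < \<epsilon>) sequentially"
    using assms(2) by (rule order_tendstoD)
  then obtain n where "prob (?A n) < \<epsilon>" by (auto simp: eventually_sequentially)
  then show ?thesis using that[of "real n"] by simp
qed

theorem theorem1:
  fixes N :: nat
    and lam mu a sg :: "nat \<Rightarrow> real"
    and q :: "nat \<Rightarrow> nat \<Rightarrow> real"
    and Q :: "'w measure" and X :: "real \<Rightarrow> 'w \<Rightarrow> nat"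
    and Q' :: "'th measure" and F :: "real \<Rightarrow> 'th measure" and W :: "real \<Rightarrow> 'th \<Rightarrow> real"
    and Y0 :: "'th \<Rightarrow> real" and Y :: "real \<Rightarrow> 'w \<times> 'th \<Rightarrow> real"
    and \<nu> :: "real measure"
  assumes "1 < N"
    and "\<And>i. i \<in> {1..N} \<Longrightarrow> 0 < lam i"
    and "stochastic_matrix {1..N} q"
    and "irreducible_kernel {1..N} q"
    and "\<And>i. i \<in> {1..N} \<Longrightarrow> q i i = 0"
    and "markov_jump_process Q {1..N} lam q X"
    and "stationary_process Q {1..N} X mu"
    and "standard_brownian_motion Q' F W"
    and "Y0 \<in> borel_measurable (F 0)"
    and "\<And>t. 0 \<le> t \<Longrightarrow> Y t \<in> borel_measurable (Q \<Otimes>\<^sub>M Q')"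
    and "\<And>\<omega>. \<omega> \<in> space Q \<Longrightarrow>
           solves_linear_sde Q' F W a sg (\<lambda>t. X t \<omega>) Y0 (\<lambda>t \<theta>. Y t (\<omega>, \<theta>))"
    and "(\<Sum>i\<in>{1..N}. a i * mu i) < 0"
    and "real_distribution \<nu>"
    and "weak_conv_at_top (\<lambda>t. distr (Q \<Otimes>\<^sub>M Q') borel (Y t)) \<nu>"
    and "\<And>i. i \<in> {1..N} \<Longrightarrow> a i \<le> 0"
  shows "\<forall>s>0. (\<integral>\<^sup>+ x. ennreal (\<bar>x\<bar> powr s) \<partial>\<nu>) < \<infinity>"
proof (intro allI impI)
  fix s :: real assume s: "0 < s"
  interpret env: stationary_environment Q "{1..N}" lam q X mu
    using assms(2,3,6,7) by unfold_locales auto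
  interpret Q: prob_space Q by (rule env.prob_space_Q)
  interpret Q': prob_space Q' using assms(8) unfolding standard_brownian_motion_def by (elim conjE)
  interpret QQ': pair_prob_space Q Q' ..
  interpret \<nu>: real_distribution \<nu> by fact
  have Y0: "Y0 \<in> borel_measurable Q'"
    using filtration_measurable[OF assms(8) order_refl assms(9)] .
  obtain i0 where i0: "i0 \<in> {1..N}" "a i0 < 0"
  proof -
    have "\<exists>i\<in>{1..N}. a i \<noteq> 0"
    proof (rule ccontr)
      assume "\<not> ?thesis"
      then have "(\<Sum>i\<in>{1..N}. a i * mu i) = 0" by (intro sum.neutral) auto
      then show False using assms(12) by simp
    qed
    then obtain i where "i \<in> {1..N}" "a i \<noteq> 0" by blast
    then show ?thesis using that[of i] assms(15)[of i] by linarith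
  qed
  \<comment> \<open>An integer exponent suffices, because \<open>\<bar>x\<bar> powr s \<le> 1 + \<bar>x\<bar> ^ m\<close> for \<open>s \<le> m\<close>.\<close>
  define m where "m = nat \<lceil>s\<rceil>"
  have m: "0 < m" "s \<le> real m" using s by (auto simp: m_def)
  obtain A \<delta> K where \<delta>: "0 < \<delta>" and A: "0 \<le> A" and K: "0 \<le> K"
    and bound: "\<And>n B L. 0 \<le> B \<Longrightarrow> 0 \<le> L \<Longrightarrow>
      (\<integral>\<^sup>+p. ennreal (min (\<bar>Y (real n) p\<bar> ^ m) B) \<partial>(Q \<Otimes>\<^sub>M Q')) \<le>
        ennreal (A * L * exp (- \<delta> * real n) + 2 ^ m * B * measure Q' {\<theta> \<in> space Q'. L < \<bar>Y0 \<theta>\<bar> ^ m} + K)"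
    by (rule env.annealed_truncated_moment[OF assms(4) assms(15) i0 assms(8) Y0 assms(10) assms(11) m(1)])
      (assumption | (rule that, assumption+))+
  have "(\<integral>\<^sup>+x. ennreal (\<bar>x\<bar> ^ m) \<partial>\<nu>) \<le> ennreal (K + 2)"
  proof (rule weak_limit_moment_le[OF QQ'.prob_space_axioms _ assms(13)])
    show "Y (real n) \<in> borel_measurable (Q \<Otimes>\<^sub>M Q')" for n by (rule assms(10)) simp
    show "weak_conv_m (\<lambda>n. distr (Q \<Otimes>\<^sub>M Q') borel (Y (real n))) \<nu>"
      unfolding weak_conv_m_def weak_conv_def
    proof (intro allI impI)
      fix x assume "isCont (cdf \<nu>) x"
      then have "((\<lambda>t. cdf (distr (Q \<Otimes>\<^sub>M Q') borel (Y t)) x) \<longlongrightarrow> cdf \<nu> x) at_top"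
        using assms(14) unfolding weak_conv_at_top_def by blast
      then show "(\<lambda>n. cdf (distr (Q \<Otimes>\<^sub>M Q') borel (Y (real n))) x) \<longlonglongrightarrow> cdf \<nu> x"
        by (rule filterlim_compose[OF _ filterlim_real_sequentially])
    qed
    show "eventually (\<lambda>n. (\<integral>\<^sup>+p. ennreal (min (\<bar>Y (real n) p\<bar> ^ m) B) \<partial>(Q \<Otimes>\<^sub>M Q')) \<le> ennreal (K + 2)) sequentially"
      if B: "0 \<le> B" for B
    proof -
      \<comment> \<open>First fix \<open>L\<close> so large that the tail term is at most \<open>1\<close>; then let \<open>n\<close> tend to infinity. The
        \<open>2\<close> in the final bound pays for both.\<close>
      have \<epsilon>: "0 < 1 / (2 ^ m * B + 1)" using B by (intro divide_pos_pos add_nonneg_pos) auto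
      have V: "(\<lambda>\<theta>. \<bar>Y0 \<theta>\<bar> ^ m) \<in> borel_measurable Q'" using Y0 by measurable
      obtain L where L: "0 \<le> L" "Q'.prob {\<theta> \<in> space Q'. L < \<bar>Y0 \<theta>\<bar> ^ m} < 1 / (2 ^ m * B + 1)"
        by (rule Q'.tail_small[OF V \<epsilon>]) (rule that)
      have tail: "2 ^ m * B * Q'.prob {\<theta> \<in> space Q'. L < \<bar>Y0 \<theta>\<bar> ^ m} \<le> 1"
      proof -
        have "2 ^ m * B * Q'.prob {\<theta> \<in> space Q'. L < \<bar>Y0 \<theta>\<bar> ^ m} \<le> 2 ^ m * B * (1 / (2 ^ m * B + 1))"
          using L B by (intro mult_left_mono) auto
        also have "\<dots> \<le> 1" using B by (simp add: divide_le_eq_1 add_nonneg_pos)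
        finally show ?thesis .
      qed
      have "(\<lambda>n. A * L * exp (- \<delta> * real n)) \<longlonglongrightarrow> A * L * 0"
      proof (intro tendsto_mult tendsto_const)
        have "(\<lambda>n. exp (- \<delta>) ^ n) \<longlonglongrightarrow> 0" using \<delta> by (intro LIMSEQ_realpow_zero) auto
        then show "(\<lambda>n. exp (- \<delta> * real n)) \<longlonglongrightarrow> 0" by (simp add: exp_of_nat_mult[symmetric] mult.commute)
      qed
      then have "eventually (\<lambda>n. A * L * exp (- \<delta> * real n) < 1) sequentially"
        by (intro order_tendstoD(2)[where y="A * L * 0"]) auto
      then show ?thesis
      proof eventually_elim
        case (elim n)
        have "ennreal (A * L * exp (- \<delta> * real n) + 2 ^ m * B * Q'.prob {\<theta> \<in> space Q'. L < \<bar>Y0 \<theta>\<bar> ^ m} + K) \<le> ennreal (K + 2)"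
          using elim tail by (intro ennreal_leI) linarith
        then show ?case using bound[OF B L(1), of n] by (rule order_trans[rotated])
      qed
    qed
  qed (use K in simp)
  then have fin: "(\<integral>\<^sup>+x. ennreal (\<bar>x\<bar> ^ m) \<partial>\<nu>) < \<infinity>" by (rule order_le_less_trans) simp
  have "(\<integral>\<^sup>+x. ennreal (\<bar>x\<bar> powr s) \<partial>\<nu>) \<le> (\<integral>\<^sup>+x. 1 + ennreal (\<bar>x\<bar> ^ m) \<partial>\<nu>)"
  proof (rule nn_integral_mono)
    fix x :: real
    have "\<bar>x\<bar> powr s \<le> 1 + \<bar>x\<bar> ^ m"
    proof (cases "\<bar>x\<bar> \<le> 1")
      case True
      then have "\<bar>x\<bar> powr s \<le> 1" using s by (intro powr_le1) auto
      then show ?thesis by (simp add: add_increasing2)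
    next
      case False
      then have "\<bar>x\<bar> powr s \<le> \<bar>x\<bar> powr real m" using m by (intro powr_mono) auto
      then show ?thesis using False by (simp add: powr_realpow)
    qed
    then have "ennreal (\<bar>x\<bar> powr s) \<le> ennreal (1 + \<bar>x\<bar> ^ m)" by (rule ennreal_leI)
    then show "ennreal (\<bar>x\<bar> powr s) \<le> 1 + ennreal (\<bar>x\<bar> ^ m)" by simp
  qed
  also have "\<dots> = 1 + (\<integral>\<^sup>+x. ennreal (\<bar>x\<bar> ^ m) \<partial>\<nu>)"
    by (subst nn_integral_add) (auto simp: \<nu>.emeasure_space_1[unfolded \<nu>.space_eq_univ])
  also have "\<dots> < \<infinity>" using fin by (simp add: ennreal_add_less_top less_top)
  finally show "(\<integral>\<^sup>+ x. ennreal (\<bar>x\<bar> powr s) \<partial>\<nu>) < \<infinity>" .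
qed

end
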